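(* Let $d\geq 3$ and let $F\leq\mathrm{Sym}(d)$. Suppose $F$ does not act freely on $\{1,2,\dots,d\}$. Let $\Gamma$ be a cocompact lattice in $G=U(F)$. Then $\Gamma$ has the congruence subgroup property (CSP) in $\mathrm{Comm}_G(\Gamma)$.
   Context: Let $T_d$ be the $d$-regular tree, and fix a coloring $c$ of the (unoriented) edges of $T_d$ by $\{1,\dots,d\}$ that is locally bijective: for every vertex $v$, the $d$ edges around $v$ (whose set is denoted $\mathrm{St}(v)$) have different colors. For $g\in\mathrm{Aut}(T_d)$ and a vertex $v$, the local action $\sigma(g,v)\in\mathrm{Sym}(d)$ is the unique permutation such that $c(ge)=\sigma(g,v)(c(e))$ for all $e\in\mathrm{St}(v)$. For $F\leq\mathrm{Sym}(d)$, $U(F)=\{g\in\mathrm{Aut}(T_d):\sigma(g,v)\in F\text{ for every vertex }v\}$, a closed subgroup of $\mathrm{Aut}(T_d)$ (compact-open topology). A cocompact lattice of a locally compact group $G$ is a discrete subgroup $\Gamma$ such that $G/\Gamma$ is compact. Two subgroups are commensurable if their intersection has finite index in each of them; $\mathrm{Comm}_G(\Gamma)$ is the set of $g\in G$ such that $\Gamma$ and $g\Gamma g^{-1}$ are commensurable. For a group $C$ and a subgroup $\Gamma$ of $C$ commensurable with all its $C$-conjugates, let $\mathcal{N}_{C,\Gamma}$ be the collection of finite index normal subgroups $N$ of $\Gamma$ such that $N$ is the intersection of finitely many $C$-conjugates of $\Gamma$. $\Gamma$ has the CSP in $C$ if every finite index subgroup of $\Gamma$ contains an element of $\mathcal{N}_{C,\Gamma}$.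 *)

theory Defs
  imports "HOL-Analysis.Abstract_Topology" "HOL-Algebra.Bij" "HOL-Algebra.Left_Coset" "HOL-Algebra.Sym_Groups"
begin

section \<open>Regular trees and legal colorings\<close>

text \<open>A simple graph on the vertex set \<open>UNIV :: 'v set\<close> is given by its set of unoriented edges,
  each edge being a two-element set of vertices.\<close>

definition is_cycle :: "'v set set \<Rightarrow> 'v list \<Rightarrow> bool" where
  "is_cycle E xs \<longleftrightarrow> 3 \<le> length xs \<and> distinct xs \<and>
     successively (\<lambda>u v. {u, v} \<in> E) xs \<and> {last xs, hd xs} \<in> E"

definition is_tree :: "'v set set \<Rightarrow> bool" where
  "is_tree E \<longleftrightarrow> (\<forall>e\<in>E. card e = 2) \<and> (\<forall>u v. (\<lambda>x y. {x, y} \<in> E)\<^sup>*\<^sup>* u v) \<and>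
     \<not> (\<exists>xs. is_cycle E xs)"

definition star_edges :: "'v set set \<Rightarrow> 'v \<Rightarrow> 'v set set" where
  "star_edges E v = {e \<in> E. v \<in> e}"

definition regular_tree :: "nat \<Rightarrow> 'v set set \<Rightarrow> bool" where
  "regular_tree d E \<longleftrightarrow>
     is_tree E \<and> (\<forall>v. finite (star_edges E v) \<and> card (star_edges E v) = d)"

text \<open>Only the values of \<open>c\<close> on the edges matter.\<close>

definition legal_coloring :: "nat \<Rightarrow> 'v set set \<Rightarrow> ('v set \<Rightarrow> nat) \<Rightarrow> bool" where
  "legal_coloring d E c \<longleftrightarrow> (\<forall>v. bij_betw c (star_edges E v) {1..d})"

section \<open>The groups \<open>Aut(T_d)\<close> and \<open>U(F)\<close>\<close>

definition tree_aut :: "'v set set \<Rightarrow> ('v \<Rightarrow> 'v) monoid" where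
  "tree_aut E = BijGroup UNIV
     \<lparr>carrier := {g \<in> Bij UNIV. \<forall>u v. {g u, g v} \<in> E \<longleftrightarrow> {u, v} \<in> E}\<rparr>"

definition local_action ::
  "nat \<Rightarrow> 'v set set \<Rightarrow> ('v set \<Rightarrow> nat) \<Rightarrow> ('v \<Rightarrow> 'v) \<Rightarrow> 'v \<Rightarrow> nat \<Rightarrow> nat" where
  "local_action d E c g v =
     (THE p. p \<in> carrier (sym_group d) \<and> (\<forall>e\<in>star_edges E v. c (g ` e) = p (c e)))"

definition universal_group ::
  "nat \<Rightarrow> 'v set set \<Rightarrow> ('v set \<Rightarrow> nat) \<Rightarrow> (nat \<Rightarrow> nat) set \<Rightarrow> ('v \<Rightarrow> 'v) monoid" where
  "universal_group d E c F = tree_aut E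
     \<lparr>carrier := {g \<in> carrier (tree_aut E). \<forall>v. local_action d E c g v \<in> F}\<rparr>"

lemma bij_betw_star_edges:
  assumes E: "is_tree E" and g: "g \<in> carrier (tree_aut E)"
  shows "bij_betw ((`) g) (star_edges E v) (star_edges E (g v))"
proof -
  have bij: "bij g" and adj: "\<And>u w. {g u, g w} \<in> E \<longleftrightarrow> {u, w} \<in> E"
    using g by (auto simp: tree_aut_def Bij_def)
  have edge: "g ` e \<in> E" if "e \<in> E" for e
  proof -
    have "card e = 2" using E that by (simp add: is_tree_def)
    then obtain a b where "e = {a, b}" by (auto simp: card_2_iff)
    then show ?thesis using that adj by simp
  qed
  have "e \<in> (`) g ` star_edges E v" if "e \<in> star_edges E (g v)" for e
  proof -
    have "e \<in> E" and ve: "g v \<in> e" using that by (auto simp: star_edges_def)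
    have "card e = 2" using E \<open>e \<in> E\<close> by (simp add: is_tree_def)
    then obtain a b where "e = {a, b}" by (auto simp: card_2_iff)
    moreover obtain a' b' where "a = g a'" "b = g b'"
      using bij by (meson bij_pointE)
    ultimately have e: "e = g ` {a', b'}" by simp
    have "{a', b'} \<in> E" using \<open>e \<in> E\<close> adj[of a' b'] e by simp
    moreover have "v \<in> {a', b'}" using ve bij by (auto simp: e bij_def inj_eq)
    ultimately show ?thesis unfolding e star_edges_def by blast
  qed
  moreover have "inj_on ((`) g) (star_edges E v)"
    using bij by (auto simp: inj_on_def bij_def inj_image_eq_iff)
  moreover have "g ` e \<in> star_edges E (g v)" if "e \<in> star_edges E v" for e
    using that edge by (auto simp: star_edges_def)
  ultimately show ?thesis
    unfolding bij_betw_def by blast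
qed

lemma ex1_local_action:
  assumes E: "is_tree E" and c: "legal_coloring d E c" and g: "g \<in> carrier (tree_aut E)"
  shows "\<exists>!p. p \<in> carrier (sym_group d) \<and> (\<forall>e\<in>star_edges E v. c (g ` e) = p (c e))"
proof -
  let ?S = "star_edges E v"
  have c1: "bij_betw c ?S {1..d}" and c2: "bij_betw c (star_edges E (g v)) {1..d}"
    using c by (auto simp: legal_coloring_def)
  define q where "q = c \<circ> ((`) g \<circ> inv_into ?S c)"
  define p where "p i = (if i \<in> {1..d} then q i else i)" for i
  have "bij_betw q {1..d} {1..d}"
    unfolding q_def using bij_betw_inv_into[OF c1] bij_betw_star_edges[OF E g] c2
    by (meson bij_betw_trans)
  then have "bij_betw p {1..d} {1..d}"
    by (subst bij_betw_cong[of _ p q]) (auto simp: p_def)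
  then have p: "p permutes {1..d}"
    by (rule bij_imp_permutes) (auto simp: p_def)
  have pc: "c (g ` e) = p (c e)" if "e \<in> ?S" for e
  proof -
    have "c e \<in> {1..d}" "inv_into ?S c (c e) = e"
      using c1 that by (auto simp: bij_betw_def)
    then show ?thesis by (simp add: p_def q_def)
  qed
  show ?thesis
  proof (rule ex1I[of _ p])
    show "p \<in> carrier (sym_group d) \<and> (\<forall>e\<in>?S. c (g ` e) = p (c e))"
      using p pc by (simp add: sym_group_def)
  next
    fix p' assume p': "p' \<in> carrier (sym_group d) \<and> (\<forall>e\<in>?S. c (g ` e) = p' (c e))"
    show "p' = p"
    proof
      fix i
      show "p' i = p i"
      proof (cases "i \<in> {1..d}")
        case True
        then obtain e where "e \<in> ?S" "i = c e"
          using c1 unfolding bij_betw_def by (metis imageE)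
        then show ?thesis using p' pc by metis
      next
        case False
        then show ?thesis using p p' by (auto simp: sym_group_def permutes_def)
      qed
    qed
  qed
qed

lemma local_action:
  assumes "is_tree E" "legal_coloring d E c" "g \<in> carrier (tree_aut E)"
  shows "local_action d E c g v \<in> carrier (sym_group d)"
    and "e \<in> star_edges E v \<Longrightarrow> c (g ` e) = local_action d E c g v (c e)"
  using theI'[OF ex1_local_action[OF assms, of v]] unfolding local_action_def by blast+

lemma local_action_eqI:
  assumes "is_tree E" "legal_coloring d E c" "g \<in> carrier (tree_aut E)"
    and "p \<in> carrier (sym_group d)" "\<And>e. e \<in> star_edges E v \<Longrightarrow> c (g ` e) = p (c e)"
  shows "local_action d E c g v = p"
  unfolding local_action_def
  by (rule the1_equality[OF ex1_local_action[OF assms(1-3)]]) (use assms(4,5) in blast)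

lemma tree_aut_mult:
  assumes "g \<in> Bij UNIV" "h \<in> Bij UNIV"
  shows "g \<otimes>\<^bsub>BijGroup UNIV\<^esub> h = g \<circ> h"
  using assms by (simp add: BijGroup_def compose_def comp_def restrict_def)

lemma carrier_tree_aut:
  "g \<in> carrier (tree_aut E) \<longleftrightarrow> bij g \<and> (\<forall>u v. {g u, g v} \<in> E \<longleftrightarrow> {u, v} \<in> E)"
  by (simp add: tree_aut_def Bij_def)

lemma subgroup_universal_group:
  assumes E: "is_tree E" and c: "legal_coloring d E c" and F: "subgroup F (sym_group d)"
  shows "subgroup (carrier (universal_group d E c F)) (BijGroup UNIV)"
proof -
  interpret group "BijGroup (UNIV :: 'a set)" by (rule group_BijGroup)
  interpret F: subgroup F "sym_group d" by (rule F)
  have U: "g \<in> carrier (universal_group d E c F) \<longleftrightarrow>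
      g \<in> carrier (tree_aut E) \<and> (\<forall>v. local_action d E c g v \<in> F)" for g
    by (simp add: universal_group_def)
  have Bij: "g \<in> Bij UNIV" if "g \<in> carrier (tree_aut E)" for g
    using that by (simp add: tree_aut_def)
  show ?thesis
  proof (rule subgroupI)
    show "carrier (universal_group d E c F) \<subseteq> carrier (BijGroup UNIV)"
      using U Bij by (auto simp: BijGroup_def)
  next
    have id: "id \<in> carrier (tree_aut E)" by (simp add: carrier_tree_aut)
    have "local_action d E c id v = id" for v
      by (rule local_action_eqI[OF E c id]) (auto simp: sym_group_def permutes_id)
    moreover have "id \<in> F" using F.one_closed by (simp add: sym_group_def)
    ultimately show "carrier (universal_group d E c F) \<noteq> {}"
      using U[of id] id by auto
  next
    fix g assume gU: "g \<in> carrier (universal_group d E c F)"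
    then have g: "g \<in> carrier (tree_aut E)" and gF: "\<And>v. local_action d E c g v \<in> F"
      using U by auto
    have bij: "bij g" and adj: "\<And>u w. {g u, g w} \<in> E \<longleftrightarrow> {u, w} \<in> E"
      using g by (auto simp: carrier_tree_aut)
    let ?h = "inv_into UNIV g"
    have gh: "g (?h x) = x" for x using bij by (simp add: bij_is_surj surj_f_inv_f)
    have h: "?h \<in> carrier (tree_aut E)"
      using adj[of "?h _" "?h _"] bij by (simp add: carrier_tree_aut bij_imp_bij_inv gh)
    have "local_action d E c ?h v \<in> F" for v
    proof -
      let ?s = "local_action d E c g (?h v)"
      have s: "?s \<in> carrier (sym_group d)" by (rule local_action(1)[OF E c g])
      have perm: "?s permutes {1..d}" using s by (simp add: sym_group_def)
      have "local_action d E c ?h v = inv_into UNIV ?s"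
      proof (rule local_action_eqI[OF E c h])
        show "inv_into UNIV ?s \<in> carrier (sym_group d)"
          using perm by (simp add: sym_group_def permutes_inv)
      next
        fix e assume "e \<in> star_edges E v"
        then have "?h ` e \<in> star_edges E (?h v)"
          using bij_betw_star_edges[OF E h, of v] by (auto simp: bij_betw_def)
        from local_action(2)[OF E c g this] have "c e = ?s (c (?h ` e))"
          by (simp add: image_image gh)
        then show "c (?h ` e) = inv_into UNIV ?s (c e)"
          using perm by (simp add: permutes_inverses)
      qed
      also have "\<dots> = inv\<^bsub>sym_group d\<^esub> ?s"
        using sym_group_inv_equality[OF s] by simp
      finally show ?thesis using F.m_inv_closed[OF gF] by metis
    qed
    then have "?h \<in> carrier (universal_group d E c F)" using U h by blast
    moreover have "inv\<^bsub>BijGroup UNIV\<^esub> g = ?h"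
      using Bij[OF g] by (subst inv_BijGroup) auto
    ultimately show "inv\<^bsub>BijGroup UNIV\<^esub> g \<in> carrier (universal_group d E c F)" by simp
  next
    fix g h assume gh: "g \<in> carrier (universal_group d E c F)" "h \<in> carrier (universal_group d E c F)"
    then have g: "g \<in> carrier (tree_aut E)" and h: "h \<in> carrier (tree_aut E)" using U by auto
    have k: "g \<circ> h \<in> carrier (tree_aut E)"
      using g h by (simp add: carrier_tree_aut bij_comp)
    have "local_action d E c (g \<circ> h) v \<in> F" for v
    proof -
      let ?s = "local_action d E c g (h v)" and ?t = "local_action d E c h v"
      have st: "?s \<in> F" "?t \<in> F" using gh U by auto
      have "local_action d E c (g \<circ> h) v = ?s \<circ> ?t"
      proof (rule local_action_eqI[OF E c k])
        show "?s \<circ> ?t \<in> carrier (sym_group d)"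
          using F.m_closed[OF st] F.subset by (auto simp: sym_group_def)
      next
        fix e assume e: "e \<in> star_edges E v"
        then have "h ` e \<in> star_edges E (h v)"
          using bij_betw_star_edges[OF E h, of v] by (auto simp: bij_betw_def)
        from local_action(2)[OF E c g this] local_action(2)[OF E c h e]
        show "c ((g \<circ> h) ` e) = (?s \<circ> ?t) (c e)"
          by (simp add: image_comp)
      qed
      then show ?thesis using F.m_closed[OF st] by (simp add: sym_group_def)
    qed
    then show "g \<otimes>\<^bsub>BijGroup UNIV\<^esub> h \<in> carrier (universal_group d E c F)"
      using U k tree_aut_mult[OF Bij[OF g] Bij[OF h]] by simp
  qed
qed

lemma group_universal_group:
  assumes "is_tree E" "legal_coloring d E c" "subgroup F (sym_group d)"
  shows "group (universal_group d E c F)"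
proof -
  have "universal_group d E c F =
      BijGroup UNIV\<lparr>carrier := carrier (universal_group d E c F)\<rparr>"
    by (simp add: universal_group_def tree_aut_def)
  then show ?thesis
    using group.subgroup_imp_group[OF group_BijGroup subgroup_universal_group[OF assms]] by metis
qed

definition acts_freely :: "('a \<Rightarrow> 'a) set \<Rightarrow> 'a set \<Rightarrow> bool" where
  "acts_freely F X \<longleftrightarrow> (\<forall>f\<in>F. \<forall>x\<in>X. f x = x \<longrightarrow> f = id)"

section \<open>Topology and lattices\<close>

text \<open>The topology generated by the sets \<open>{f \<in> A. f ` K \<subseteq> U}\<close> is carried by \<open>A\<close>
  (take \<open>K = {}\<close>).\<close>

definition compact_open_topology ::
  "'a topology \<Rightarrow> 'b topology \<Rightarrow> ('a \<Rightarrow> 'b) set \<Rightarrow> ('a \<Rightarrow> 'b) topology" where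
  "compact_open_topology X Y A =
     topology_generated_by {{f \<in> A. f ` K \<subseteq> U} |K U. compactin X K \<and> openin Y U}"

text \<open>The compact-open topology for the action on the (discrete) set of vertices.\<close>

definition tree_aut_topology :: "'v set set \<Rightarrow> ('v \<Rightarrow> 'v) topology" where
  "tree_aut_topology E =
     compact_open_topology (discrete_topology UNIV) (discrete_topology UNIV) (carrier (tree_aut E))"

definition universal_group_topology ::
  "nat \<Rightarrow> 'v set set \<Rightarrow> ('v set \<Rightarrow> nat) \<Rightarrow> (nat \<Rightarrow> nat) set \<Rightarrow> ('v \<Rightarrow> 'v) topology" where
  "universal_group_topology d E c F =
     subtopology (tree_aut_topology E) (carrier (universal_group d E c F))"

lemma topspace_universal_group_topology:
  "topspace (universal_group_topology d E c F) = carrier (universal_group d E c F)"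
proof -
  have "topspace (tree_aut_topology E) = carrier (tree_aut E)"
    by (auto simp: tree_aut_topology_def compact_open_topology_def topology_generated_by_topspace
             intro!: exI[of _ "{}"] exI[of _ "carrier (tree_aut E)"])
  then show ?thesis
    by (auto simp: universal_group_topology_def universal_group_def)
qed
definition quotient_topology :: "'a topology \<Rightarrow> ('a \<Rightarrow> 'b) \<Rightarrow> 'b topology" where
  "quotient_topology X f =
     topology (\<lambda>U. U \<subseteq> f ` topspace X \<and> openin X {x \<in> topspace X. f x \<in> U})"

lemma openin_quotient_topology:
  "openin (quotient_topology X f) U \<longleftrightarrow>
     U \<subseteq> f ` topspace X \<and> openin X {x \<in> topspace X. f x \<in> U}"
proof -
  have "istopology (\<lambda>U. U \<subseteq> f ` topspace X \<and> openin X {x \<in> topspace X. f x \<in> U})"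
  proof -
    have 1: "openin X {x \<in> topspace X. f x \<in> S \<inter> T}"
      if "openin X {x \<in> topspace X. f x \<in> S}" "openin X {x \<in> topspace X. f x \<in> T}" for S T
    proof -
      have "{x \<in> topspace X. f x \<in> S \<inter> T} = {x \<in> topspace X. f x \<in> S} \<inter> {x \<in> topspace X. f x \<in> T}"
        by auto
      then show ?thesis using that by auto
    qed
    have 2: "openin X {x \<in> topspace X. f x \<in> \<Union>K}"
      if "\<forall>S\<in>K. openin X {x \<in> topspace X. f x \<in> S}" for K
    proof -
      have "{x \<in> topspace X. f x \<in> \<Union>K} = (\<Union>S\<in>K. {x \<in> topspace X. f x \<in> S})"
        by auto
      then show ?thesis using that by auto
    qed
    show ?thesis unfolding istopology_def using 1 2 by (simp add: Sup_le_iff le_infI1)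
  qed
  then show ?thesis
    by (simp add: quotient_topology_def)
qed

lemma quotient_map_quotient_topology: "quotient_map X (quotient_topology X f) f"
proof -
  have "topspace (quotient_topology X f) = f ` topspace X"
  proof
    show "topspace (quotient_topology X f) \<subseteq> f ` topspace X"
      by (auto simp: topspace_def[of "quotient_topology X f"] openin_quotient_topology)
    have "{x \<in> topspace X. f x \<in> f ` topspace X} = topspace X"
      by auto
    then show "f ` topspace X \<subseteq> topspace (quotient_topology X f)"
      by (intro openin_subset) (simp add: openin_quotient_topology)
  qed
  then show ?thesis
    by (auto simp: quotient_map_def openin_quotient_topology)
qed

text \<open>A subgroup \<open>\<Gamma>\<close> of the topological group \<open>(G, T)\<close> that is discrete and has compact
  space of left cosets \<open>G/\<Gamma>\<close>.\<close>

definition cocompact_lattice :: "('a, 'b) monoid_scheme \<Rightarrow> 'a topology \<Rightarrow> 'a set \<Rightarrow> bool" where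
  "cocompact_lattice G T \<Gamma> \<longleftrightarrow> subgroup \<Gamma> G \<and> subtopology T \<Gamma> = discrete_topology \<Gamma> \<and>
     compact_space (quotient_topology T (\<lambda>g. g <#\<^bsub>G\<^esub> \<Gamma>))"

section \<open>Commensurability and the congruence subgroup property\<close>

definition finite_index :: "('a, 'b) monoid_scheme \<Rightarrow> 'a set \<Rightarrow> 'a set \<Rightarrow> bool" where
  "finite_index G H K \<longleftrightarrow>
     subgroup H (G\<lparr>carrier := K\<rparr>) \<and> finite (rcosets\<^bsub>G\<lparr>carrier := K\<rparr>\<^esub> H)"

definition commensurable :: "('a, 'b) monoid_scheme \<Rightarrow> 'a set \<Rightarrow> 'a set \<Rightarrow> bool" where
  "commensurable G H K \<longleftrightarrow> finite_index G (H \<inter> K) H \<and> finite_index G (H \<inter> K) K"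

definition conj_subgroup :: "('a, 'b) monoid_scheme \<Rightarrow> 'a \<Rightarrow> 'a set \<Rightarrow> 'a set" where
  "conj_subgroup G g H = (g <#\<^bsub>G\<^esub> H) #>\<^bsub>G\<^esub> inv\<^bsub>G\<^esub> g"

definition commensurator :: "('a, 'b) monoid_scheme \<Rightarrow> 'a set \<Rightarrow> 'a set" where
  "commensurator G \<Gamma> = {g \<in> carrier G. commensurable G \<Gamma> (conj_subgroup G g \<Gamma>)}"

definition congruence_subgroups :: "('a, 'b) monoid_scheme \<Rightarrow> 'a set \<Rightarrow> 'a set set" where
  "congruence_subgroups C \<Gamma> =
     {N. N \<lhd> C\<lparr>carrier := \<Gamma>\<rparr> \<and> finite_index C N \<Gamma> \<and>
         (\<exists>S. finite S \<and> S \<noteq> {} \<and> S \<subseteq> carrier C \<and> N = (\<Inter>g\<in>S. conj_subgroup C g \<Gamma>))}"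

text \<open>The first two conjuncts are the standing assumptions under which the property is defined:
  \<open>\<Gamma>\<close> is a subgroup of \<open>C\<close> that is commensurable with all its \<open>C\<close>-conjugates.\<close>

definition has_CSP :: "('a, 'b) monoid_scheme \<Rightarrow> 'a set \<Rightarrow> bool" where
  "has_CSP C \<Gamma> \<longleftrightarrow> subgroup \<Gamma> C \<and> commensurator C \<Gamma> = carrier C \<and>
     (\<forall>H. finite_index C H \<Gamma> \<longrightarrow> (\<exists>N\<in>congruence_subgroups C \<Gamma>. N \<subseteq> H))"

end

theory Submission
  imports Defs
begin

text \<open>A cocompact lattice \<open>\<Gamma>\<close> acts on the tree with finite stabilisers and finitely many orbits
  (\<open>finite_stabiliser_if_discrete\<close>, \<open>fin_orbits_if_cocompact\<close>).  For a group with finite stabilisers,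
  a subgroup has finite index as soon as it has finitely many orbits of vertices
  (\<open>fin_index_if_fin_orbits\<close>), so that commensurability can be read off from orbits.  The proof
  compares \<open>\<Gamma>\<close> with the group \<open>\<Lambda>\<close> of all automorphisms that preserve the colouring
  (\<open>colour_group\<close>), which acts simply transitively on the vertices.

  The colouring can be adapted to the lattice.  Two colourings that differ by elements of \<open>F\<close> at
  every vertex define the same group \<open>U(F)\<close>, and there is such a colouring that is preserved by a
  subgroup of finite index in \<open>\<Gamma>\<close> (\<open>invariant_colouring\<close>).  This is a version of
  Leighton's theorem on common coverings of finite graphs.  Here it is elementary: the local
  colourings at the vertices, with auxiliary data, are the points of a covering of the tree on which
  \<open>\<Gamma>\<close> acts, and a sheet of this covering is a colouring.  With this choice, \<open>\<Gamma>\<close> and \<open>\<Lambda>\<close> are commensurable.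

  The group \<open>\<Lambda>\<close> has the congruence subgroup property in a strong form
  (\<open>colour_group_congruence\<close>).  Since \<open>F\<close> does not act freely, some \<open>f \<noteq> id\<close> in \<open>F\<close> fixes a
  colour \<open>i0\<close>.  Any union of components of the tree without the edges of colour \<open>i0\<close> can be
  recoloured by \<open>f\<close>.  The new colouring is the image of the old one under some \<open>g \<in> U(F)\<close>, and an
  element of \<open>\<Lambda>\<close> that also lies in \<open>g \<Lambda> g\<inverse>\<close> preserves the recoloured set.  If the set is invariant
  under a subgroup of finite index, then \<open>g\<close> commensurates \<open>\<Lambda>\<close>.  Finitely many such sets
  suffice to cut out any given subgroup of finite index (\<open>separating_sets\<close>).

  This does not pass to \<open>\<Gamma>\<close> at once, because an element of \<open>\<Gamma>\<close> whose conjugates lie in \<open>\<Gamma>\<close>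
  need not have conjugates in \<open>\<Lambda>\<close>; only a fixed power does.  Let \<open>K0\<close> be a small normal subgroup of finite
  index in \<open>\<Gamma>\<close> that is contained in \<open>\<Lambda>\<close>.  A sufficiently deep congruence subgroup \<open>N\<close> of \<open>\<Gamma>\<close>
  consists of elements a fixed power of which is trivial in the homology of the graph \<open>K0\T\<close> modulo
  an integer \<open>P\<close> prime to the exponent.  It follows that \<open>N \<inter> K0\<close> itself is trivial in this homology, and,
  by taking commutators with \<open>K0\<close>, that \<open>N\<close> acts trivially on the homology.  An automorphism with this
  property is close to the identity: it maps every edge into its orbit under a given subgroup of
  finite index (\<open>preserves_crossings\<close>).  Hence \<open>N\<close> is contained in the given subgroup of \<open>\<Gamma>\<close>
  (\<open>congruence_subgroup_in\<close>).\<close>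

text \<open>The notation \<open>inv\<close> is reserved for inverses in abstract groups.\<close>

abbreviation pinv :: "('a \<Rightarrow> 'b) \<Rightarrow> 'b \<Rightarrow> 'a" where
  "pinv g \<equiv> inv_into UNIV g"

section \<open>Transport along the edges of a tree\<close>

locale tree =
  fixes E :: "'v set set"
  assumes tree: "is_tree E"
begin

lemma edge_distinct: "{u, v} \<in> E \<Longrightarrow> u \<noteq> v"
  using tree by (fastforce simp: is_tree_def)

lemma edge_cases:
  assumes "e \<in> E"
  obtains u v where "e = {u, v}" "u \<noteq> v"
  using tree assms by (auto simp: is_tree_def card_2_iff)

lemma tree_induct [consumes 0, case_names base step]:
  assumes "Q r" "\<And>u v. {u, v} \<in> E \<Longrightarrow> Q u \<Longrightarrow> Q v"
  shows "Q v"
proof -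
  have "(\<lambda>x y. {x, y} \<in> E)\<^sup>*\<^sup>* r v"
    using tree by (auto simp: is_tree_def)
  then show ?thesis
    by (induction rule: rtranclp_induct) (use assms in auto)
qed

abbreviation walk :: "'v list \<Rightarrow> bool" where
  "walk \<equiv> successively (\<lambda>u v. {u, v} \<in> E)"

fun transport :: "('v \<Rightarrow> 'v \<Rightarrow> 'a \<Rightarrow> 'a) \<Rightarrow> 'v list \<Rightarrow> 'a \<Rightarrow> 'a" where
  "transport \<phi> (u # v # xs) x = transport \<phi> (v # xs) (\<phi> u v x)"
| "transport \<phi> xs x = x"

lemma transport_append:
  "transport \<phi> (xs @ [v] @ ys) x = transport \<phi> ([v] @ ys) (transport \<phi> (xs @ [v]) x)"
proof (induction xs arbitrary: x)
  case (Cons a xs)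
  then show ?case by (cases xs) auto
qed auto

lemma walk_append:
  "walk (xs @ [v] @ ys) \<longleftrightarrow> walk (xs @ [v]) \<and> walk ([v] @ ys)"
  by (auto simp: successively_append_iff)

lemma transport_in:
  assumes "\<And>u v x. {u, v} \<in> E \<Longrightarrow> x \<in> P u \<Longrightarrow> \<phi> u v x \<in> P v"
    and "walk xs" "xs \<noteq> []" "x \<in> P (hd xs)"
  shows "transport \<phi> xs x \<in> P (last xs)"
  using assms(2-)
proof (induction xs arbitrary: x)
  case (Cons u xs)
  then show ?case by (cases xs) (auto simp: assms(1))
qed simp

text \<open>A closed walk either repeats an interior vertex, and is then cut into two shorter closed
  walks, or it is a back-and-forth step, or it is a cycle.\<close>

lemma transport_closed_walk:
  assumes \<phi>: "\<And>u v x. {u, v} \<in> E \<Longrightarrow> x \<in> P u \<Longrightarrow> \<phi> u v x \<in> P v"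
    and inv: "\<And>u v x. {u, v} \<in> E \<Longrightarrow> x \<in> P u \<Longrightarrow> \<phi> v u (\<phi> u v x) = x"
    and "walk xs" "xs \<noteq> []" "hd xs = last xs" "x \<in> P (hd xs)"
  shows "transport \<phi> xs x = x"
  using assms(3-)
proof (induction "length xs" arbitrary: xs x rule: less_induct)
  case less
  obtain ys h where xs: "xs = ys @ [h]"
    using \<open>xs \<noteq> []\<close> by (metis append_butlast_last_id)
  show ?case
  proof (cases "distinct ys")
    case False
    then obtain as z bs cs where ys: "ys = as @ [z] @ bs @ [z] @ cs"
      using not_distinct_decomp by blast
    let ?i = "[z] @ bs @ [z]" and ?o = "as @ [z] @ (cs @ [h])"
    have split: "xs = as @ [z] @ (bs @ [z] @ (cs @ [h]))" by (simp add: xs ys)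
    have w: "walk (as @ [z])" "walk ?i" "walk ([z] @ (cs @ [h]))"
      using less.prems(1) walk_append[of as z "bs @ [z] @ (cs @ [h])"]
        walk_append[of "[z] @ bs" z "cs @ [h]"]
      unfolding split by simp_all
    have hd: "hd (as @ [z]) = hd xs" by (cases as) (auto simp: xs ys)
    have z: "transport \<phi> (as @ [z]) x \<in> P z"
      using transport_in[of P \<phi> "as @ [z]" x] \<phi> w(1) less.prems(4) hd by auto
    have "transport \<phi> xs x = transport \<phi> ([z] @ (cs @ [h])) (transport \<phi> ?i (transport \<phi> (as @ [z]) x))"
      using transport_append[of \<phi> as z "bs @ [z] @ (cs @ [h])" x]
        transport_append[of \<phi> "[z] @ bs" z "cs @ [h]" "transport \<phi> (as @ [z]) x"]
      unfolding split by simp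
    also have "transport \<phi> ?i (transport \<phi> (as @ [z]) x) = transport \<phi> (as @ [z]) x"
      by (rule less.hyps) (use w z in \<open>auto simp: xs ys\<close>)
    also have "transport \<phi> ([z] @ (cs @ [h])) \<dots> = transport \<phi> ?o x"
      by (rule transport_append[symmetric])
    also have "\<dots> = x"
    proof (rule less.hyps)
      show "walk ?o" using w walk_append by blast
      show "x \<in> P (hd ?o)" using less.prems(4) by (cases as) (auto simp: xs ys)
      show "hd ?o = last ?o" using less.prems(3) by (cases as) (auto simp: xs ys)
    qed (auto simp: xs ys)
    finally show ?thesis .
  next
    case True
    have nocycle: "\<not> is_cycle E ys" using tree by (auto simp: is_tree_def)
    consider "ys = []" | a where "ys = [a]" | a b where "ys = [a, b]" | "3 \<le> length ys"
    proof (cases ys rule: remdups_adj.cases)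
      case (3 a b cs)
      then show ?thesis using that(3,4) by (cases cs) auto
    qed (use that in auto)
    then show ?thesis
    proof cases
      case 2
      then have "{h, h} \<in> E" using less.prems xs by simp
      then show ?thesis using edge_distinct by blast
    next
      case (3 a b)
      then show ?thesis using less.prems xs inv by auto
    next
      case 4
      then have ne: "ys \<noteq> []" by auto
      then have "hd ys = h" using less.prems(3) xs by simp
      then have "is_cycle E ys"
        using 4 True ne less.prems(1) unfolding xs is_cycle_def
        by (auto simp: successively_append_iff)
      with nocycle show ?thesis ..
    qed (auto simp: xs)
  qed
qed

lemma walk_exists: "\<exists>xs. walk xs \<and> xs \<noteq> [] \<and> hd xs = u \<and> last xs = v"
proof (induction v rule: tree_induct[where r = u])
  case base
  show ?case by (rule exI[of _ "[u]"]) auto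
next
  case (step a b)
  then obtain xs where "walk xs" "xs \<noteq> []" "hd xs = u" "last xs = a" by blast
  then show ?case
    using step by (intro exI[of _ "xs @ [b]"]) (auto simp: successively_append_iff)
qed

lemma walk_rev: "walk xs \<Longrightarrow> walk (rev xs)"
  by (simp add: insert_commute)

lemma transport_eq:
  assumes \<phi>: "\<And>u v x. {u, v} \<in> E \<Longrightarrow> x \<in> P u \<Longrightarrow> \<phi> u v x \<in> P v"
    and inv: "\<And>u v x. {u, v} \<in> E \<Longrightarrow> x \<in> P u \<Longrightarrow> \<phi> v u (\<phi> u v x) = x"
    and xs: "walk xs" "xs \<noteq> []" and ys: "walk ys" "ys \<noteq> []"
    and eq: "hd xs = hd ys" "last xs = last ys" and x: "x \<in> P (hd xs)"
  shows "transport \<phi> xs x = transport \<phi> ys x"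
proof -
  have closed: "transport \<phi> (rev bs) (transport \<phi> as x) = x"
    if as: "walk as" "as \<noteq> []" "x \<in> P (hd as)" and bs: "walk bs" "bs \<noteq> []"
      and eqs: "hd as = hd bs" "last as = last bs" for as bs x
  proof -
    obtain a as' where a: "as = as' @ [a]" using as(2) by (metis append_butlast_last_id)
    obtain bs' where b: "bs = bs' @ [a]"
      using bs(2) eqs(2) a by (metis append_butlast_last_id last_snoc)
    have "transport \<phi> (as' @ [a] @ rev bs') x = x"
    proof (rule transport_closed_walk[of P])
      show "walk (as' @ [a] @ rev bs')"
        using as(1) walk_rev[OF bs(1)] walk_append[of as' a "rev bs'"] a b by simp
      show "hd (as' @ [a] @ rev bs') = last (as' @ [a] @ rev bs')"
        using eqs(1) a b by (cases bs'; cases as') auto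
      show "x \<in> P (hd (as' @ [a] @ rev bs'))" using as(3) a by (cases as') auto
    qed (use \<phi> inv in auto)
    then show ?thesis by (simp add: transport_append[of \<phi> as' a "rev bs'", simplified] a b)
  qed
  have y: "transport \<phi> ys x \<in> P (last ys)"
    by (rule transport_in) (use \<phi> ys eq x in auto)
  have "transport \<phi> (rev (rev ys)) (transport \<phi> (rev xs) (transport \<phi> ys x)) = transport \<phi> ys x"
  proof -
    have "transport \<phi> (rev xs) (transport \<phi> ys x) = x"
      by (rule closed) (use xs ys eq x in auto)
    then show ?thesis by simp
  qed
  moreover have "transport \<phi> (rev (rev xs)) (transport \<phi> (rev xs) (transport \<phi> ys x)) = transport \<phi> ys x"
    by (rule closed) (use xs ys eq y walk_rev in \<open>auto simp: hd_rev last_rev\<close>)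
  moreover have "transport \<phi> (rev xs) (transport \<phi> ys x) = x"
    by (rule closed) (use xs ys eq x in auto)
  ultimately show ?thesis by simp
qed

text \<open>The tree is simply connected: a family of mutually inverse transport maps along the edges
  has a parallel section through every point.\<close>

lemma parallel_section:
  assumes \<phi>: "\<And>u v x. {u, v} \<in> E \<Longrightarrow> x \<in> P u \<Longrightarrow> \<phi> u v x \<in> P v"
    and inv: "\<And>u v x. {u, v} \<in> E \<Longrightarrow> x \<in> P u \<Longrightarrow> \<phi> v u (\<phi> u v x) = x"
    and a: "a \<in> P v0"
  obtains s where "s v0 = a" "\<And>v. s v \<in> P v" "\<And>u v. {u, v} \<in> E \<Longrightarrow> s v = \<phi> u v (s u)"
proof -
  obtain w where w: "\<And>v. walk (w v) \<and> w v \<noteq> [] \<and> hd (w v) = v0 \<and> last (w v) = v"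
    using walk_exists by metis
  define s where "s v = transport \<phi> (w v) a" for v
  show ?thesis
  proof
    have "s v0 = transport \<phi> [v0] a"
      unfolding s_def by (rule transport_eq[of P]) (use \<phi> inv w a in auto)
    then show "s v0 = a" by simp
    show "s v \<in> P v" for v
      using transport_in[of P \<phi> "w v" a] \<phi> w a by (metis s_def)
    show "s v = \<phi> u v (s u)" if "{u, v} \<in> E" for u v
    proof -
      obtain xs where xs: "w u = xs @ [u]" using w by (metis append_butlast_last_id)
      have "s v = transport \<phi> (xs @ [u] @ [v]) a"
        unfolding s_def
      proof (rule transport_eq[of P])
        show "walk (xs @ [u] @ [v])"
          using w[of u] that unfolding xs walk_append by simp
        show "hd (w v) = hd (xs @ [u] @ [v])" using w[of u] w[of v] xs by (cases xs) auto
      qed (use \<phi> inv w a xs in auto)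
      also have "\<dots> = \<phi> u v (s u)" by (simp only: transport_append s_def xs) simp
      finally show ?thesis .
    qed
  qed
qed

lemma parallel_section_unique:
  assumes "\<And>u v. {u, v} \<in> E \<Longrightarrow> s v = \<phi> u v (s u)" "\<And>u v. {u, v} \<in> E \<Longrightarrow> s' v = \<phi> u v (s' u)"
    and "s v0 = s' v0"
  shows "s = s'"
proof
  show "s v = s' v" for v
  proof (induction v rule: tree_induct[where r = v0])
    case (step u v)
    then show ?case using assms(1)[of u v] assms(2)[of u v] by simp
  qed (rule assms)
qed

text \<open>Adding \<open>\<beta> u v\<close> along the edge from \<open>u\<close> to \<open>v\<close> is a transport on the integers;
  antisymmetry makes the transports in the two directions inverse to each other.\<close>

lemma potential:
  fixes \<beta> :: "'v \<Rightarrow> 'v \<Rightarrow> int"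
  assumes "\<And>u v. {u, v} \<in> E \<Longrightarrow> \<beta> v u = - \<beta> u v"
  obtains f where "\<And>u v. {u, v} \<in> E \<Longrightarrow> f v = f u + \<beta> u v"
proof -
  obtain f where "\<And>u v. {u, v} \<in> E \<Longrightarrow> f v = f u + \<beta> u v"
    by (rule parallel_section[of "\<lambda>_. UNIV" "\<lambda>u v x. x + \<beta> u v" 0 undefined])
       (use assms in auto)
  then show thesis using that by blast
qed

lemma constant_if_gradients_equal:
  fixes f g :: "'v \<Rightarrow> int"
  assumes "\<And>u v. {u, v} \<in> E \<Longrightarrow> f v - f u = g v - g u"
  shows "f v - g v = f w - g w"
proof (induction v rule: tree_induct[where r = w])
  case (step u v)
  then show ?case using assms[of u v] by simp
qed simp

abbreviation aut :: "('v \<Rightarrow> 'v) \<Rightarrow> bool" where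
  "aut g \<equiv> g \<in> carrier (tree_aut E)"

lemma aut_iff: "aut g \<longleftrightarrow> bij g \<and> (\<forall>u v. {g u, g v} \<in> E \<longleftrightarrow> {u, v} \<in> E)"
  by (rule carrier_tree_aut)

lemma aut_id: "aut id" by (simp add: aut_iff)

lemma aut_comp: "aut g \<Longrightarrow> aut h \<Longrightarrow> aut (g \<circ> h)"
  by (simp add: aut_iff bij_comp)

lemma aut_pinv: "aut g \<Longrightarrow> aut (pinv g)"
proof -
  assume g: "aut g"
  then have "g (pinv g x) = x" for x
    by (simp add: aut_iff bij_is_surj surj_f_inv_f)
  moreover have "{pinv g u, pinv g v} \<in> E \<longleftrightarrow> {g (pinv g u), g (pinv g v)} \<in> E" for u v
    using g by (simp add: aut_iff)
  ultimately show ?thesis using g by (simp add: aut_iff bij_imp_bij_inv)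
qed

definition parity :: "'v \<Rightarrow> bool" where
  "parity = (SOME s. \<forall>u v. {u, v} \<in> E \<longrightarrow> s v = (\<not> s u))"

lemma parity: assumes "{u, v} \<in> E" shows "parity v = (\<not> parity u)"
proof -
  obtain s where "\<And>u v. {u, v} \<in> E \<Longrightarrow> s v = (\<not> s u)"
    by (rule parallel_section[of "\<lambda>_. UNIV" "\<lambda>u v x. \<not> x" True undefined]) auto
  then have "\<forall>u v. {u, v} \<in> E \<longrightarrow> s v = (\<not> s u)" by blast
  then have "\<forall>u v. {u, v} \<in> E \<longrightarrow> parity v = (\<not> parity u)"
    unfolding parity_def by (rule someI[of "\<lambda>s. \<forall>u v. {u, v} \<in> E \<longrightarrow> s v = (\<not> s u)" s])
  then show ?thesis using assms by blast
qed

lemma parity_aut: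
  assumes "aut g"
  shows "parity (g v) = (parity v = (parity (g w) = parity w))"
proof (induction v rule: tree_induct[where r = w])
  case base
  show ?case by auto
next
  case (step u v)
  then have "{g u, g v} \<in> E" using assms by (simp add: aut_iff)
  then show ?case using step(2) parity[OF step(1)] parity[of "g u" "g v"] by auto
qed

end

section \<open>Legally coloured trees\<close>

locale coloured_tree = tree +
  fixes d :: nat and c :: "'a set \<Rightarrow> nat"
  assumes legal: "legal_coloring d E c"
begin

lemma colour_range: "{u, v} \<in> E \<Longrightarrow> c {u, v} \<in> {1..d}"
proof -
  assume "{u, v} \<in> E"
  then have "c {u, v} \<in> c ` star_edges E u" by (simp add: star_edges_def)
  then show ?thesis using legal by (auto simp: legal_coloring_def bij_betw_def)
qed

lemma colour_inj: "{u, v} \<in> E \<Longrightarrow> {u, w} \<in> E \<Longrightarrow> c {u, v} = c {u, w} \<Longrightarrow> v = w"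
proof -
  assume *: "{u, v} \<in> E" "{u, w} \<in> E" "c {u, v} = c {u, w}"
  have "inj_on c (star_edges E u)" using legal by (auto simp: legal_coloring_def bij_betw_def)
  then have "{u, v} = {u, w}" using * by (auto simp: inj_on_def star_edges_def)
  then show "v = w" by (auto simp: doubleton_eq_iff)
qed

definition nb :: "'a \<Rightarrow> nat \<Rightarrow> 'a" where
  "nb v i = (THE w. {v, w} \<in> E \<and> c {v, w} = i)"

lemma nb_eqI: "{u, v} \<in> E \<Longrightarrow> c {u, v} = i \<Longrightarrow> nb u i = v"
  unfolding nb_def by (rule the_equality) (auto dest: colour_inj[of u _ v])

lemma nb:
  assumes "i \<in> {1..d}"
  shows "{v, nb v i} \<in> E" "c {v, nb v i} = i"
proof -
  obtain e where e: "e \<in> star_edges E v" "c e = i"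
    using legal assms unfolding legal_coloring_def bij_betw_def by (metis imageE)
  then obtain w where "e = {v, w}"
    using edge_cases[of e] by (auto simp: star_edges_def insert_commute)
  then have "{v, w} \<in> E \<and> c {v, w} = i" using e by (auto simp: star_edges_def)
  then show "{v, nb v i} \<in> E" "c {v, nb v i} = i" using nb_eqI by auto
qed

lemma nb_nb [simp]: "i \<in> {1..d} \<Longrightarrow> nb (nb v i) i = v"
  using nb[of i v] by (intro nb_eqI) (auto simp: insert_commute)

lemma star_eq: "star_edges E v = (\<lambda>i. {v, nb v i}) ` {1..d}"
proof -
  have "e \<in> (\<lambda>i. {v, nb v i}) ` {1..d}" if e: "e \<in> star_edges E v" for e
  proof -
    obtain w where w: "e = {v, w}"
      using e edge_cases[of e] by (auto simp: star_edges_def insert_commute)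
    then have "nb v (c e) = w" "c e \<in> {1..d}"
      using e nb_eqI colour_range by (auto simp: star_edges_def)
    then show ?thesis using w by blast
  qed
  then show ?thesis using nb(1) by (auto simp: star_edges_def)
qed

text \<open>The group \<open>U({id})\<close>, a free product of \<open>d\<close> groups of order two: it acts simply
  transitively on the vertices, and every colour \<open>i\<close> yields the involution that moves a base vertex \<open>v\<close>
  to \<open>nb v i\<close>.\<close>

definition colour_group :: "('a \<Rightarrow> 'a) set" where
  "colour_group = {g. aut g \<and> (\<forall>u v. {u, v} \<in> E \<longrightarrow> c {g u, g v} = c {u, v})}"

lemma colour_group_nb:
  assumes "g \<in> colour_group" "i \<in> {1..d}"
  shows "g (nb v i) = nb (g v) i"
  by (rule sym, rule nb_eqI) (use assms nb[OF assms(2), of v] in \<open>auto simp: colour_group_def aut_iff\<close>)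

lemma colour_group_eqI:
  assumes "g \<in> colour_group" "h \<in> colour_group" "g v = h v"
  shows "g = h"
proof (rule parallel_section_unique[where \<phi> = "\<lambda>u v x. nb x (c {u, v})" and ?v0.0 = v])
  show "g v = nb (g u) (c {u, v})" if "{u, v} \<in> E" for u v
    using colour_group_nb[OF assms(1) colour_range[OF that], of u] nb_eqI[OF that refl] by simp
  show "h v = nb (h u) (c {u, v})" if "{u, v} \<in> E" for u v
    using colour_group_nb[OF assms(2) colour_range[OF that], of u] nb_eqI[OF that refl] by simp
qed (use assms in auto)

end

text \<open>A map that respects the colours follows a path by the path with the same sequence of colours.
  Such maps exist in both directions between two colourings, and their composites are the identity
  because a parallel section is determined by one value.\<close>

lemma (in tree) colouring_isomorphism:
  assumes "legal_coloring d E c" "legal_coloring d E c'"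
  obtains g where "aut g" "g v0 = w0" "\<And>u v. {u, v} \<in> E \<Longrightarrow> c' {g u, g v} = c {u, v}"
proof -
  have dev: "\<exists>g. g a = b \<and> (\<forall>u v. {u, v} \<in> E \<longrightarrow>
      {g u, g v} \<in> E \<and> c2 {g u, g v} = c1 {u, v})"
    if "legal_coloring d E c1" "legal_coloring d E c2" for c1 c2 a b
  proof -
    interpret c1: coloured_tree E d c1 by unfold_locales fact
    interpret c2: coloured_tree E d c2 by unfold_locales fact
    have "\<exists>g. g a = b \<and> (\<forall>u v. {u, v} \<in> E \<longrightarrow> g v = c2.nb (g u) (c1 {u, v}))"
      by (rule parallel_section[of "\<lambda>_. UNIV" "\<lambda>u v x. c2.nb x (c1 {u, v})" b a])
         (use c1.colour_range in \<open>auto simp: insert_commute\<close>)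
    then obtain g where g: "g a = b" "\<And>u v. {u, v} \<in> E \<Longrightarrow> g v = c2.nb (g u) (c1 {u, v})"
      by blast
    have "{g u, g v} \<in> E \<and> c2 {g u, g v} = c1 {u, v}" if "{u, v} \<in> E" for u v
      unfolding g(2)[OF that] using c2.nb[OF c1.colour_range[OF that], of "g u"] by simp
    with g(1) show ?thesis by blast
  qed
  have ident: "g v = v" if "legal_coloring d E c1" and fixed: "g a = a"
    and edges: "\<And>u v. {u, v} \<in> E \<Longrightarrow> {g u, g v} \<in> E \<and> c1 {g u, g v} = c1 {u, v}" for c1 g a v
  proof -
    interpret c1: coloured_tree E d c1 by unfold_locales fact
    have "g = id"
    proof (rule parallel_section_unique[where \<phi> = "\<lambda>u v x. c1.nb x (c1 {u, v})" and ?v0.0 = a])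
      show "g v = c1.nb (g u) (c1 {u, v})" if "{u, v} \<in> E" for u v
        using edges[OF that] by (intro c1.nb_eqI[symmetric]) auto
      show "id v = c1.nb (id u) (c1 {u, v})" if "{u, v} \<in> E" for u v
        using that by (intro c1.nb_eqI[symmetric]) auto
    qed (use fixed in auto)
    then show ?thesis by simp
  qed
  obtain g where g: "g v0 = w0" "\<And>u v. {u, v} \<in> E \<Longrightarrow> {g u, g v} \<in> E \<and> c' {g u, g v} = c {u, v}"
    using dev[OF assms, of v0 w0] by blast
  obtain h where h: "h w0 = v0" "\<And>u v. {u, v} \<in> E \<Longrightarrow> {h u, h v} \<in> E \<and> c {h u, h v} = c' {u, v}"
    using dev[OF assms(2,1), of w0 v0] by blast
  have hg: "h (g v) = v" for v
  proof -
    have "{h (g u), h (g w)} \<in> E \<and> c {h (g u), h (g w)} = c {u, w}" if "{u, w} \<in> E" for u w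
      using h(2)[of "g u" "g w"] g(2)[OF that] by simp
    then show ?thesis using ident[OF assms(1), of "h \<circ> g" v0 v] g(1) h(1) by simp
  qed
  have gh: "g (h v) = v" for v
  proof -
    have "{g (h u), g (h w)} \<in> E \<and> c' {g (h u), g (h w)} = c' {u, w}" if "{u, w} \<in> E" for u w
      using g(2)[of "h u" "h w"] h(2)[OF that] by simp
    then show ?thesis using ident[OF assms(2), of "g \<circ> h" w0 v] g(1) h(1) by simp
  qed
  have "bij g" by (rule o_bij[of h]) (auto simp: hg gh)
  moreover have "{u, v} \<in> E" if "{g u, g v} \<in> E" for u v
    using h(2)[OF that] hg by simp
  ultimately have "aut g" using g(2) unfolding aut_iff by blast
  then show thesis using that g by blast
qed

section \<open>Groups of permutations and finite index\<close>

definition perm_group :: "('a \<Rightarrow> 'a) set \<Rightarrow> bool" where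
  "perm_group H \<longleftrightarrow> id \<in> H \<and> (\<forall>g\<in>H. bij g \<and> pinv g \<in> H) \<and> (\<forall>g\<in>H. \<forall>h\<in>H. g \<circ> h \<in> H)"

lemma perm_groupD:
  assumes "perm_group H"
  shows "id \<in> H" "g \<in> H \<Longrightarrow> bij g" "g \<in> H \<Longrightarrow> pinv g \<in> H" "g \<in> H \<Longrightarrow> h \<in> H \<Longrightarrow> g \<circ> h \<in> H"
  using assms by (auto simp: perm_group_def)

lemma pinv_simps:
  assumes "bij g"
  shows "pinv g (g x) = x" "g (pinv g x) = x" "pinv g \<circ> g = id" "g \<circ> pinv g = id"
    "pinv (pinv g) = g" "bij (pinv g)"
  using assms by (auto simp: bij_is_inj bij_is_surj surj_f_inv_f inv_inv_eq bij_imp_bij_inv fun_eq_iff)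

lemma pinv_comp: "bij g \<Longrightarrow> bij h \<Longrightarrow> pinv (g \<circ> h) = pinv h \<circ> pinv g"
  by (rule o_inv_distrib)

lemma perm_group_Int: "perm_group H \<Longrightarrow> perm_group K \<Longrightarrow> perm_group (H \<inter> K)"
  by (auto simp: perm_group_def)

lemma perm_group_funpow: "perm_group H \<Longrightarrow> g \<in> H \<Longrightarrow> g ^^ n \<in> H"
  by (induction n) (auto intro: perm_groupD(1,4))

definition fin_index :: "('a \<Rightarrow> 'a) set \<Rightarrow> ('a \<Rightarrow> 'a) set \<Rightarrow> bool" where
  "fin_index H K \<longleftrightarrow> finite ((\<lambda>a. (\<lambda>h. h \<circ> a) ` H) ` K)"

lemma coset_eq:
  assumes "perm_group H" "h \<in> H"
  shows "(\<lambda>x. x \<circ> (h \<circ> b)) ` H = (\<lambda>x. x \<circ> b) ` H"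
proof -
  have "x \<circ> b \<in> (\<lambda>x. x \<circ> (h \<circ> b)) ` H" if "x \<in> H" for x
  proof (rule image_eqI)
    show "x \<circ> pinv h \<in> H" using that assms by (simp add: perm_groupD(3,4))
    show "x \<circ> b = x \<circ> pinv h \<circ> (h \<circ> b)"
      using perm_groupD(2)[OF assms] by (simp add: fun_eq_iff pinv_simps)
  qed
  moreover have "x \<circ> (h \<circ> b) \<in> (\<lambda>x. x \<circ> b) ` H" if "x \<in> H" for x
    using that assms by (intro image_eqI[of _ _ "x \<circ> h"]) (auto simp: perm_groupD(4))
  ultimately show ?thesis by blast
qed

lemma fin_index_representatives:
  assumes "perm_group H" "perm_group K" "fin_index H K"
  obtains S where "finite S" "S \<subseteq> K" "\<And>k. k \<in> K \<Longrightarrow> \<exists>s\<in>S. k \<circ> pinv s \<in> H"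
proof -
  let ?f = "\<lambda>a. (\<lambda>h. h \<circ> a) ` H"
  obtain S where S: "S \<subseteq> K" "finite S" "?f ` K = ?f ` S"
    using finite_subset_image[OF assms(3)[unfolded fin_index_def] subset_refl] by auto
  have "\<exists>s\<in>S. k \<circ> pinv s \<in> H" if k: "k \<in> K" for k
  proof -
    have "?f k \<in> ?f ` S" using k by (subst S(3)[symmetric]) (rule imageI)
    then obtain s where s: "s \<in> S" "?f k = ?f s" by (elim imageE)
    have "id \<circ> k \<in> ?f k" using perm_groupD(1)[OF assms(1)] by (rule imageI)
    then have "id \<circ> k \<in> ?f s" by (simp only: s(2))
    then obtain h where "h \<in> H" "k = h \<circ> s" by auto
    moreover have "bij s" using perm_groupD(2)[OF assms(2)] s(1) S(1) by blast
    ultimately have "k \<circ> pinv s = h" by (simp add: comp_assoc pinv_simps)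
    then show ?thesis using s \<open>h \<in> H\<close> by blast
  qed
  then show thesis using that S by blast
qed

lemma fin_indexI_representatives:
  assumes "perm_group H" "finite S" "\<And>k. k \<in> K \<Longrightarrow> \<exists>h\<in>H. \<exists>s\<in>S. k = h \<circ> s"
  shows "fin_index H K"
proof -
  have "(\<lambda>a. (\<lambda>h. h \<circ> a) ` H) ` K \<subseteq> (\<lambda>a. (\<lambda>h. h \<circ> a) ` H) ` S"
  proof (rule image_subsetI)
    fix k assume "k \<in> K"
    then obtain h s where "h \<in> H" "s \<in> S" "k = h \<circ> s" using assms(3) by blast
    then show "(\<lambda>h. h \<circ> k) ` H \<in> (\<lambda>a. (\<lambda>h. h \<circ> a) ` H) ` S"
      using coset_eq[OF assms(1), of h s] by (intro image_eqI[of _ _ s]) auto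
  qed
  then show ?thesis unfolding fin_index_def by (rule finite_subset) (use assms(2) in simp)
qed

text \<open>For subgroups that are defined by the vanishing of invariants, the tuple of the invariants is a
  map \<open>\<Phi>\<close> as in the following criterion.\<close>

lemma fin_indexI:
  assumes "perm_group H" "perm_group K" "finite (\<Phi> ` K)"
    and sep: "\<And>a b. a \<in> K \<Longrightarrow> b \<in> K \<Longrightarrow> \<Phi> a = \<Phi> b \<Longrightarrow> a \<circ> pinv b \<in> H"
  shows "fin_index H K"
proof -
  obtain S where S: "S \<subseteq> K" "finite S" "\<Phi> ` K = \<Phi> ` S"
    using finite_subset_image[OF assms(3) subset_refl] by auto
  show ?thesis
  proof (rule fin_indexI_representatives[OF assms(1) S(2)])
    fix k assume k: "k \<in> K"
    then have "\<Phi> k \<in> \<Phi> ` S" by (subst S(3)[symmetric]) (rule imageI)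
    then obtain s where s: "s \<in> S" "\<Phi> k = \<Phi> s" by (elim imageE)
    then have "k = k \<circ> pinv s \<circ> s"
      using perm_groupD(2)[OF assms(2), of s] S(1) by (simp add: comp_assoc pinv_simps subset_iff)
    then show "\<exists>h\<in>H. \<exists>s\<in>S. k = h \<circ> s" using sep k s S(1) by blast
  qed
qed

lemma fin_index_separating_map:
  assumes "perm_group H" "perm_group K" "fin_index H K"
  obtains \<Phi> :: "('a \<Rightarrow> 'a) \<Rightarrow> ('a \<Rightarrow> 'a) set" where "finite (\<Phi> ` K)"
    "\<And>a b. a \<in> K \<Longrightarrow> b \<in> K \<Longrightarrow> \<Phi> a = \<Phi> b \<Longrightarrow> a \<circ> pinv b \<in> H"
proof
  let ?f = "\<lambda>a. (\<lambda>h. h \<circ> a) ` H"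
  show "finite (?f ` K)" using assms(3) by (simp add: fin_index_def)
  fix a b assume ab: "a \<in> K" "b \<in> K" "?f a = ?f b"
  have "id \<circ> a \<in> ?f a" using perm_groupD(1)[OF assms(1)] by (rule imageI)
  then have "id \<circ> a \<in> ?f b" by (simp only: ab(3))
  then obtain h where "h \<in> H" "a = h \<circ> b" by auto
  then show "a \<circ> pinv b \<in> H"
    using perm_groupD(2)[OF assms(2) ab(2)] by (simp add: comp_assoc pinv_simps)
qed

lemma fin_index_Int:
  assumes "perm_group H1" "perm_group H2" "perm_group K" "fin_index H1 K" "fin_index H2 K"
  shows "fin_index (H1 \<inter> H2) K"
proof -
  obtain \<Phi>1 :: "('a \<Rightarrow> 'a) \<Rightarrow> ('a \<Rightarrow> 'a) set" where 1: "finite (\<Phi>1 ` K)"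
    "\<And>a b. a \<in> K \<Longrightarrow> b \<in> K \<Longrightarrow> \<Phi>1 a = \<Phi>1 b \<Longrightarrow> a \<circ> pinv b \<in> H1"
    by (rule fin_index_separating_map[OF assms(1,3,4)]) blast
  obtain \<Phi>2 :: "('a \<Rightarrow> 'a) \<Rightarrow> ('a \<Rightarrow> 'a) set" where 2: "finite (\<Phi>2 ` K)"
    "\<And>a b. a \<in> K \<Longrightarrow> b \<in> K \<Longrightarrow> \<Phi>2 a = \<Phi>2 b \<Longrightarrow> a \<circ> pinv b \<in> H2"
    by (rule fin_index_separating_map[OF assms(2,3,5)]) blast
  show ?thesis
  proof (rule fin_indexI[where \<Phi> = "\<lambda>a. (\<Phi>1 a, \<Phi>2 a)"])
    have "(\<lambda>a. (\<Phi>1 a, \<Phi>2 a)) ` K \<subseteq> \<Phi>1 ` K \<times> \<Phi>2 ` K" by auto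
    then show "finite ((\<lambda>a. (\<Phi>1 a, \<Phi>2 a)) ` K)"
      by (rule finite_subset) (use 1(1) 2(1) in simp)
    show "a \<circ> pinv b \<in> H1 \<inter> H2" if "a \<in> K" "b \<in> K" "(\<Phi>1 a, \<Phi>2 a) = (\<Phi>1 b, \<Phi>2 b)" for a b
      using that 1(2)[of a b] 2(2)[of a b] by simp
  qed (use assms perm_group_Int in auto)
qed

lemma fin_index_trans:
  assumes "perm_group H" "perm_group K" "perm_group M" "fin_index H K" "fin_index K M"
  shows "fin_index H M"
proof -
  obtain S where S: "finite S" "S \<subseteq> K" "\<And>k. k \<in> K \<Longrightarrow> \<exists>s\<in>S. k \<circ> pinv s \<in> H"
    by (rule fin_index_representatives[OF assms(1,2,4)]) blast
  obtain T where T: "finite T" "T \<subseteq> M" "\<And>k. k \<in> M \<Longrightarrow> \<exists>s\<in>T. k \<circ> pinv s \<in> K"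
    by (rule fin_index_representatives[OF assms(2,3,5)]) blast
  show ?thesis
  proof (rule fin_indexI_representatives[where S = "(\<lambda>(s, t). s \<circ> t) ` (S \<times> T)"])
    fix k assume "k \<in> M"
    then obtain t where t: "t \<in> T" "k \<circ> pinv t \<in> K" using T by blast
    then obtain s where s: "s \<in> S" "k \<circ> pinv t \<circ> pinv s \<in> H" using S by blast
    have "bij s" "bij t" using perm_groupD(2)[OF assms(2), of s] perm_groupD(2)[OF assms(3), of t] s(1) t(1) S(2) T(2) by blast+
    then have "k = (k \<circ> pinv t \<circ> pinv s) \<circ> (s \<circ> t)"
      by (simp add: fun_eq_iff pinv_simps)
    then show "\<exists>h\<in>H. \<exists>s\<in>(\<lambda>(s, t). s \<circ> t) ` (S \<times> T). k = h \<circ> s"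
      using s t by blast
  qed (use assms S T in auto)
qed

lemma fin_index_restrict:
  assumes "perm_group H" "perm_group K" "fin_index H K" "perm_group K'" "K' \<subseteq> K"
  shows "fin_index (H \<inter> K') K'"
proof -
  obtain \<Phi> :: "('a \<Rightarrow> 'a) \<Rightarrow> ('a \<Rightarrow> 'a) set" where \<Phi>: "finite (\<Phi> ` K)"
    "\<And>a b. a \<in> K \<Longrightarrow> b \<in> K \<Longrightarrow> \<Phi> a = \<Phi> b \<Longrightarrow> a \<circ> pinv b \<in> H"
    by (rule fin_index_separating_map[OF assms(1,2,3)]) blast
  show ?thesis
  proof (rule fin_indexI[where \<Phi> = \<Phi>])
    show "finite (\<Phi> ` K')" using \<Phi>(1) assms(5) by (meson finite_subset image_mono)
    show "a \<circ> pinv b \<in> H \<inter> K'" if "a \<in> K'" "b \<in> K'" "\<Phi> a = \<Phi> b" for a b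
      using that \<Phi>(2)[of a b] assms(5) perm_groupD(3,4)[OF assms(4)] by blast
  qed (use assms perm_group_Int in auto)
qed

lemma fin_index_mono:
  assumes "perm_group H" "perm_group K" "fin_index H K" "perm_group H'" "H \<subseteq> H'"
  shows "fin_index H' K"
proof -
  obtain S where S: "finite S" "S \<subseteq> K" "\<And>k. k \<in> K \<Longrightarrow> \<exists>s\<in>S. k \<circ> pinv s \<in> H"
    by (rule fin_index_representatives[OF assms(1,2,3)]) blast
  show ?thesis
  proof (rule fin_indexI_representatives[OF assms(4) S(1)])
    fix k assume k: "k \<in> K"
    then obtain s where s: "s \<in> S" "k \<circ> pinv s \<in> H" using S by blast
    then have "k = k \<circ> pinv s \<circ> s"
      using perm_groupD(2)[OF assms(2), of s] S(2) by (simp add: comp_assoc pinv_simps subset_iff)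
    then show "\<exists>h\<in>H'. \<exists>s\<in>S. k = h \<circ> s" using s assms by blast
  qed
qed

definition conj_by :: "('a \<Rightarrow> 'a) \<Rightarrow> ('a \<Rightarrow> 'a) set \<Rightarrow> ('a \<Rightarrow> 'a) set" where
  "conj_by g H = (\<lambda>h. g \<circ> h \<circ> pinv g) ` H"

lemma mem_conj_by:
  assumes g: "bij g"
  shows "x \<in> conj_by g H \<longleftrightarrow> pinv g \<circ> x \<circ> g \<in> H"
proof
  assume "x \<in> conj_by g H"
  then obtain h where h: "h \<in> H" "x = g \<circ> h \<circ> pinv g" by (auto simp: conj_by_def)
  have "pinv g \<circ> x \<circ> g = h" using g by (simp add: h fun_eq_iff pinv_simps)
  with h(1) show "pinv g \<circ> x \<circ> g \<in> H" by simp
next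
  assume "pinv g \<circ> x \<circ> g \<in> H"
  then have "g \<circ> (pinv g \<circ> x \<circ> g) \<circ> pinv g \<in> conj_by g H" unfolding conj_by_def by (rule imageI)
  moreover have "g \<circ> (pinv g \<circ> x \<circ> g) \<circ> pinv g = x" using g by (simp add: fun_eq_iff pinv_simps)
  ultimately show "x \<in> conj_by g H" by simp
qed

lemma conj_by_conj_by: "bij g \<Longrightarrow> bij h \<Longrightarrow> conj_by g (conj_by h H) = conj_by (g \<circ> h) H"
  by (simp add: set_eq_iff mem_conj_by bij_comp pinv_comp comp_assoc)

lemma conj_by_id [simp]: "conj_by id H = H"
  by (auto simp: conj_by_def)

lemma conj_by_Int: "bij g \<Longrightarrow> conj_by g (H \<inter> K) = conj_by g H \<inter> conj_by g K"
  by (auto simp: mem_conj_by)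

lemma conj_by_mem:
  assumes "perm_group H" "g \<in> H" shows "conj_by g H = H"
proof -
  have "pinv g \<circ> x \<circ> g \<in> H \<longleftrightarrow> x \<in> H" for x
  proof
    assume "pinv g \<circ> x \<circ> g \<in> H"
    then have "g \<circ> (pinv g \<circ> x \<circ> g) \<circ> pinv g \<in> H" using assms by (blast intro: perm_groupD(3,4))
    moreover have "g \<circ> (pinv g \<circ> x \<circ> g) \<circ> pinv g = x"
      using perm_groupD(2)[OF assms] by (simp add: fun_eq_iff pinv_simps)
    ultimately show "x \<in> H" by simp
  qed (use assms in \<open>blast intro: perm_groupD(3,4)\<close>)
  then show ?thesis using perm_groupD(2)[OF assms] by (simp add: set_eq_iff mem_conj_by)
qed

lemma perm_group_conj_by:
  assumes "bij g" "perm_group H" shows "perm_group (conj_by g H)"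
  unfolding perm_group_def
proof (intro conjI ballI)
  show "id \<in> conj_by g H" using assms by (simp add: mem_conj_by pinv_simps perm_groupD(1))
next
  fix x assume "x \<in> conj_by g H"
  then obtain h where h: "h \<in> H" "x = g \<circ> h \<circ> pinv g" by (auto simp: conj_by_def)
  have "bij h" by (rule perm_groupD(2)[OF assms(2) h(1)])
  then have "pinv x = g \<circ> pinv h \<circ> pinv g"
    using assms h by (simp add: pinv_comp bij_comp pinv_simps comp_assoc)
  then show "pinv x \<in> conj_by g H" using h assms by (auto simp: conj_by_def perm_groupD(3))
  show "bij x" using h assms \<open>bij h\<close> by (simp add: bij_comp pinv_simps)
next
  fix x y assume "x \<in> conj_by g H" "y \<in> conj_by g H"
  then obtain h k where h: "h \<in> H" "x = g \<circ> h \<circ> pinv g" and k: "k \<in> H" "y = g \<circ> k \<circ> pinv g"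
    by (auto simp: conj_by_def)
  have "x \<circ> y = g \<circ> (h \<circ> k) \<circ> pinv g" using assms h k by (simp add: fun_eq_iff pinv_simps)
  then show "x \<circ> y \<in> conj_by g H" using h k assms by (auto simp: conj_by_def perm_groupD(4))
qed

lemma fin_index_conj_by:
  assumes "bij g" "perm_group H" "perm_group K" "fin_index H K"
  shows "fin_index (conj_by g H) (conj_by g K)"
proof -
  obtain S where S: "finite S" "S \<subseteq> K" "\<And>k. k \<in> K \<Longrightarrow> \<exists>s\<in>S. k \<circ> pinv s \<in> H"
    by (rule fin_index_representatives[OF assms(2,3,4)]) blast
  show ?thesis
  proof (rule fin_indexI_representatives[where S = "conj_by g S"])
    show "perm_group (conj_by g H)" using assms perm_group_conj_by by blast
    show "finite (conj_by g S)" using S by (simp add: conj_by_def)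
    fix x assume "x \<in> conj_by g K"
    then obtain k where k: "k \<in> K" "x = g \<circ> k \<circ> pinv g" by (auto simp: conj_by_def)
    then obtain s where s: "s \<in> S" "k \<circ> pinv s \<in> H" using S by blast
    have "bij s" using perm_groupD(2)[OF assms(3), of s] s(1) S(2) by blast
    then have "x = (g \<circ> (k \<circ> pinv s) \<circ> pinv g) \<circ> (g \<circ> s \<circ> pinv g)"
      using assms k by (simp add: fun_eq_iff pinv_simps)
    then show "\<exists>h\<in>conj_by g H. \<exists>s\<in>conj_by g S. x = h \<circ> s"
      unfolding conj_by_def using s by blast
  qed
qed

lemma fin_index_power:
  assumes "perm_group H" "perm_group K" "fin_index H K"
  obtains n where "n > 0" "\<And>x. x \<in> K \<Longrightarrow> x ^^ n \<in> H"
proof -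
  obtain \<Phi> :: "('a \<Rightarrow> 'a) \<Rightarrow> ('a \<Rightarrow> 'a) set" where \<Phi>: "finite (\<Phi> ` K)"
    "\<And>a b. a \<in> K \<Longrightarrow> b \<in> K \<Longrightarrow> \<Phi> a = \<Phi> b \<Longrightarrow> a \<circ> pinv b \<in> H"
    by (rule fin_index_separating_map[OF assms(1,2,3)]) blast
  let ?N = "card (\<Phi> ` K)"
  have "x ^^ fact ?N \<in> H" if x: "x \<in> K" for x
  proof -
    have pw: "x ^^ i \<in> K" for i using perm_group_funpow[OF assms(2) x] .
    have "(\<lambda>i. \<Phi> (x ^^ i)) ` {0..?N} \<subseteq> \<Phi> ` K" using pw by auto
    from card_mono[OF \<Phi>(1) this]
    have "card ((\<lambda>i. \<Phi> (x ^^ i)) ` {0..?N}) < card {0..?N}" by simp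
    then have "\<not> inj_on (\<lambda>i. \<Phi> (x ^^ i)) {0..?N}" using pigeonhole by blast
    then obtain a b where "a \<le> ?N" "b \<le> ?N" "\<Phi> (x ^^ a) = \<Phi> (x ^^ b)" "a \<noteq> b"
      by (auto simp: inj_on_def)
    then obtain i j where ij: "i < j" "j \<le> ?N" "\<Phi> (x ^^ j) = \<Phi> (x ^^ i)"
      by (metis linorder_neqE_nat)
    have "x ^^ j = x ^^ (j - i) \<circ> x ^^ i" using ij by (simp flip: funpow_add)
    then have "x ^^ j \<circ> pinv (x ^^ i) = x ^^ (j - i)"
      using perm_groupD(2)[OF assms(2) pw[of i]] by (simp add: comp_assoc pinv_simps)
    then have H: "x ^^ (j - i) \<in> H" using \<Phi>(2)[OF pw[of j] pw[of i] ij(3)] by simp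
    have "(j - i) dvd fact ?N" using ij by (intro dvd_fact) auto
    then obtain q where "fact ?N = (j - i) * q" by blast
    then have "x ^^ fact ?N = (x ^^ (j - i)) ^^ q" by (simp add: funpow_mult)
    then show ?thesis using perm_group_funpow[OF assms(1) H] by simp
  qed
  then show thesis using that[of "fact ?N"] by simp
qed

definition core :: "('a \<Rightarrow> 'a) set \<Rightarrow> ('a \<Rightarrow> 'a) set \<Rightarrow> ('a \<Rightarrow> 'a) set" where
  "core K H = {x \<in> K. \<forall>k\<in>K. k \<circ> x \<circ> pinv k \<in> H}"

lemma perm_group_core:
  assumes K: "perm_group K" and H: "perm_group H" shows "perm_group (core K H)"
  unfolding perm_group_def
proof (intro conjI ballI)
  show "id \<in> core K H" using perm_groupD(1)[OF K] perm_groupD(1)[OF H] perm_groupD(2)[OF K] by (simp add: core_def pinv_simps)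
next
  fix x assume x: "x \<in> core K H"
  then have "x \<in> K" by (simp add: core_def)
  then show "bij x" using perm_groupD(2)[OF K] by blast
  have "k \<circ> pinv x \<circ> pinv k = pinv (k \<circ> x \<circ> pinv k)" if "k \<in> K" for k
    using perm_groupD(2)[OF K that] \<open>bij x\<close> by (simp add: pinv_comp bij_comp pinv_simps comp_assoc)
  then show "pinv x \<in> core K H" using x assms by (auto simp: core_def perm_groupD(3))
next
  fix x y assume xy: "x \<in> core K H" "y \<in> core K H"
  have "k \<circ> (x \<circ> y) \<circ> pinv k = (k \<circ> x \<circ> pinv k) \<circ> (k \<circ> y \<circ> pinv k)" if "k \<in> K" for k
    using perm_groupD(2)[OF K that] by (simp add: fun_eq_iff pinv_simps)
  then show "x \<circ> y \<in> core K H" using xy assms by (auto simp: core_def perm_groupD(4))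
qed

lemma core_normal:
  assumes K: "perm_group K" and "x \<in> core K H" "g \<in> K"
  shows "g \<circ> x \<circ> pinv g \<in> core K H"
proof -
  have "k \<circ> (g \<circ> x \<circ> pinv g) \<circ> pinv k = (k \<circ> g) \<circ> x \<circ> pinv (k \<circ> g)" if "k \<in> K" for k
    using perm_groupD(2)[OF K] that assms(3) by (simp add: pinv_comp comp_assoc)
  moreover have "g \<circ> x \<circ> pinv g \<in> K"
    using assms by (intro perm_groupD(3,4)[OF K]) (simp_all add: core_def)
  moreover have "(k \<circ> g) \<circ> x \<circ> pinv (k \<circ> g) \<in> H" if "k \<in> K" for k
    using assms(2) perm_groupD(4)[OF K that assms(3)] by (simp only: core_def mem_Collect_eq)
  ultimately show ?thesis by (simp add: core_def)
qed

lemma core_subset: "perm_group K \<Longrightarrow> core K H \<subseteq> H \<inter> K"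
  using perm_groupD(1)[of K] pinv_simps(3)[of id] by (force simp: core_def)

text \<open>Conjugation by elements of one coset of \<open>H\<close> gives the same condition, so that the core is
  an intersection of finitely many conjugates.\<close>

lemma core_finite_intersection:
  assumes K: "perm_group K" and H: "perm_group H" and "H \<subseteq> K" "fin_index H K"
  obtains R where "finite R" "R \<noteq> {}" "R \<subseteq> K" "core K H = (\<Inter>r\<in>R. conj_by r H)"
proof -
  obtain S where S: "finite S" "S \<subseteq> K" "\<And>k. k \<in> K \<Longrightarrow> \<exists>s\<in>S. k \<circ> pinv s \<in> H"
    by (rule fin_index_representatives[OF assms(2,1,4)]) blast
  have ne: "S \<noteq> {}" using S(3)[OF perm_groupD(1)[OF K]] by blast
  have bijS: "bij s" if "s \<in> S" for s using perm_groupD(2)[OF K, of s] that S(2) by blast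
  have mem: "x \<in> conj_by (pinv s) H \<longleftrightarrow> s \<circ> x \<circ> pinv s \<in> H" if "s \<in> S" for s x
    using bijS[OF that] by (simp add: mem_conj_by pinv_simps)
  have "x \<in> core K H" if x: "\<And>s. s \<in> S \<Longrightarrow> s \<circ> x \<circ> pinv s \<in> H" for x
  proof -
    obtain s where s: "s \<in> S" using ne by blast
    have "pinv s \<circ> (s \<circ> x \<circ> pinv s) \<circ> s \<in> K"
      using x[OF s] s S assms by (blast intro: perm_groupD(3,4))
    moreover have "pinv s \<circ> (s \<circ> x \<circ> pinv s) \<circ> s = x"
      using bijS[OF s] by (simp add: fun_eq_iff pinv_simps)
    ultimately have "x \<in> K" by simp
    moreover have "k \<circ> x \<circ> pinv k \<in> H" if k: "k \<in> K" for k
    proof -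
      obtain s where s: "s \<in> S" "k \<circ> pinv s \<in> H" using S k by blast
      have "bij k" by (rule perm_groupD(2)[OF K k])
      then have "k \<circ> x \<circ> pinv k = (k \<circ> pinv s) \<circ> (s \<circ> x \<circ> pinv s) \<circ> pinv (k \<circ> pinv s)"
        using bijS[OF s(1)] by (simp add: fun_eq_iff pinv_simps pinv_comp)
      then show ?thesis using s x H by (metis perm_groupD(3,4))
    qed
    ultimately show ?thesis by (simp add: core_def)
  qed
  then have "core K H = {x. \<forall>s\<in>S. s \<circ> x \<circ> pinv s \<in> H}"
    using S by (auto simp: core_def)
  also have "\<dots> = (\<Inter>r\<in>pinv ` S. conj_by r H)" using mem by auto
  finally show thesis
    using that[of "pinv ` S"] S ne K by (auto intro: perm_groupD(3))
qed

lemma fin_index_core: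
  assumes K: "perm_group K" and H: "perm_group H" and "H \<subseteq> K" "fin_index H K"
  shows "fin_index (core K H) K"
proof -
  obtain R where R: "finite R" "R \<noteq> {}" "R \<subseteq> K" "core K H = (\<Inter>r\<in>R. conj_by r H)"
    using core_finite_intersection[OF assms] .
  have 1: "perm_group (conj_by r H)" "fin_index (conj_by r H) K" if "r \<in> R" for r
  proof -
    have r: "r \<in> K" using that R(3) by blast
    show "perm_group (conj_by r H)" by (rule perm_group_conj_by[OF perm_groupD(2)[OF K r] H])
    show "fin_index (conj_by r H) K"
      using fin_index_conj_by[OF perm_groupD(2)[OF K r] H K assms(4)] conj_by_mem[OF K r] by simp
  qed
  have "perm_group (\<Inter>r\<in>R. conj_by r H) \<and> fin_index (\<Inter>r\<in>R. conj_by r H) K"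
    using R(1,2) 1
  proof (induction R rule: finite_ne_induct)
    case (insert r R)
    then show ?case by (auto intro!: perm_group_Int fin_index_Int K)
  qed auto
  then show ?thesis using R by simp
qed

section \<open>Finite index and finitely many orbits\<close>

definition fin_orbits :: "('a \<Rightarrow> 'a) set \<Rightarrow> bool" where
  "fin_orbits H \<longleftrightarrow> (\<exists>R. finite R \<and> (\<forall>v. \<exists>h\<in>H. \<exists>r\<in>R. v = h r))"

lemma fin_orbitsE:
  assumes "fin_orbits H"
  obtains R where "finite R" "\<And>v. \<exists>h\<in>H. \<exists>r\<in>R. v = h r"
proof -
  obtain R where R: "finite R \<and> (\<forall>v. \<exists>h\<in>H. \<exists>r\<in>R. v = h r)"
    using assms[unfolded fin_orbits_def] by (elim exE)
  show thesis by (rule that[of R]) (rule R[THEN conjunct1], rule R[THEN conjunct2, THEN spec])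
qed

lemma fin_orbits_fin_index:
  assumes "perm_group H" "perm_group K" "fin_index H K" "fin_orbits K"
  shows "fin_orbits H"
proof -
  obtain S where S: "finite S" "S \<subseteq> K" "\<And>k. k \<in> K \<Longrightarrow> \<exists>s\<in>S. k \<circ> pinv s \<in> H"
    by (rule fin_index_representatives[OF assms(1,2,3)]) blast
  obtain R where R: "finite R" "\<And>v. \<exists>h\<in>K. \<exists>r\<in>R. v = h r"
    by (rule fin_orbitsE[OF assms(4)]) (rule that)
  have "\<exists>h\<in>H. \<exists>r\<in>(\<lambda>(s, r). s r) ` (S \<times> R). v = h r" for v
  proof -
    obtain k r where k: "k \<in> K" "r \<in> R" "v = k r" using R(2)[of v] by blast
    obtain s where s: "s \<in> S" "k \<circ> pinv s \<in> H" using S k by blast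
    have "v = (k \<circ> pinv s) (s r)"
      using perm_groupD(2)[OF assms(2), of s] k s S(2) by (simp add: pinv_simps subset_iff)
    then show ?thesis using k s by (intro bexI[of _ "k \<circ> pinv s"] bexI[of _ "s r"]) auto
  qed
  then show ?thesis unfolding fin_orbits_def
    by (intro exI[of _ "(\<lambda>(s, r). s r) ` (S \<times> R)"]) (use R(1) S(1) in simp)
qed

lemma fin_orbits_mono: "fin_orbits H \<Longrightarrow> H \<subseteq> K \<Longrightarrow> fin_orbits K"
  unfolding fin_orbits_def by (meson subsetD)

text \<open>If \<open>h\<inverse> k\<close> and \<open>t\<close> both map \<open>v\<close> to the representative \<open>r\<close> of an orbit, then they differ by an
  element of the stabiliser of \<open>v\<close>.  Hence there are only finitely many cosets.\<close>

lemma fin_index_if_fin_orbits: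
  assumes H: "perm_group H" and K: "perm_group K" and "H \<subseteq> K" "fin_orbits H"
    and stab: "finite {k \<in> K. k v = v}"
  shows "fin_index H K"
proof -
  obtain R where R: "finite R" "\<And>v. \<exists>h\<in>H. \<exists>r\<in>R. v = h r"
    by (rule fin_orbitsE[OF assms(4)]) (rule that)
  define t where "t r = (SOME k. k \<in> K \<and> k v = r)" for r
  show ?thesis
  proof (rule fin_indexI_representatives[OF H, where S = "(\<lambda>(r, k). t r \<circ> k) ` (R \<times> {k \<in> K. k v = v})"])
    fix k assume k: "k \<in> K"
    obtain h r where h: "h \<in> H" "r \<in> R" "k v = h r" using R(2)[of "k v"] by blast
    have hK: "h \<in> K" using h assms by blast
    have bij: "bij h" "bij k" by (rule perm_groupD(2)[OF K hK], rule perm_groupD(2)[OF K k])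
    have hk: "pinv h \<circ> k \<in> K" by (rule perm_groupD(4)[OF K perm_groupD(3)[OF K hK] k])
    have hkv: "(pinv h \<circ> k) v = r" using h(3) bij by (simp add: pinv_simps)
    have t: "t r \<in> K" "t r v = r"
      using someI[of "\<lambda>k. k \<in> K \<and> k v = r", OF conjI[OF hk hkv]] unfolding t_def by (rule conjunct1, rule conjunct2)
    let ?s = "pinv (t r) \<circ> (pinv h \<circ> k)"
    have bt: "bij (t r)" by (rule perm_groupD(2)[OF K t(1)])
    have "?s \<in> K" by (rule perm_groupD(4)[OF K perm_groupD(3)[OF K t(1)] hk])
    moreover have "?s v = v"
    proof -
      have "?s v = pinv (t r) (t r v)" using hkv t(2) by simp
      then show ?thesis using bt by (simp only: pinv_simps)
    qed
    moreover have "k = h \<circ> (t r \<circ> ?s)" using bij bt by (simp add: fun_eq_iff pinv_simps)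
    ultimately show "\<exists>h\<in>H. \<exists>s\<in>(\<lambda>(r, k). t r \<circ> k) ` (R \<times> {k \<in> K. k v = v}). k = h \<circ> s"
      using h(1,2) by (intro bexI[of _ h] bexI[of _ "t r \<circ> ?s"] image_eqI[of _ _ "(r, ?s)"]) auto
  qed (use R stab in auto)
qed

section \<open>The group of colour-preserving automorphisms\<close>

context tree
begin

definition even_group :: "('v \<Rightarrow> 'v) set" where
  "even_group = {g. aut g \<and> (\<forall>v. parity (g v) = parity v)}"

lemma perm_group_even_group: "perm_group even_group"
  unfolding perm_group_def
proof (intro conjI ballI)
  show "id \<in> even_group" using aut_id by (simp add: even_group_def)
next
  fix g assume g: "g \<in> even_group"
  then show "bij g" by (simp add: even_group_def aut_iff)
  have "parity (pinv g v) = parity v" for v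
  proof -
    have "parity (g (pinv g v)) = parity (pinv g v)" using g by (simp add: even_group_def)
    then show ?thesis using \<open>bij g\<close> by (simp add: pinv_simps)
  qed
  then show "pinv g \<in> even_group" using g aut_pinv by (simp add: even_group_def)
next
  fix g h assume "g \<in> even_group" "h \<in> even_group"
  then show "g \<circ> h \<in> even_group" using aut_comp[of g h] by (simp add: even_group_def)
qed

text \<open>An automorphism either preserves both classes of the bipartition or exchanges them, so that two
  values of the parity at one vertex separate the cosets.\<close>

lemma fin_index_even:
  assumes K: "perm_group K" and aut: "\<And>g. g \<in> K \<Longrightarrow> aut g"
  shows "fin_index (K \<inter> even_group) K"
proof (rule fin_indexI[where \<Phi> = "\<lambda>g. parity (g undefined) = parity undefined"])
  show "perm_group (K \<inter> even_group)" by (rule perm_group_Int[OF K perm_group_even_group])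
  show "finite ((\<lambda>g. parity (g undefined) = parity undefined) ` K)"
    by (rule finite_subset[of _ "UNIV :: bool set"]) auto
  fix a b assume a: "a \<in> K" and b: "b \<in> K"
    and eq: "(parity (a undefined) = parity undefined) = (parity (b undefined) = parity undefined)"
  have bij: "bij b" by (rule perm_groupD(2)[OF K b])
  have ab: "a \<circ> pinv b \<in> K" by (rule perm_groupD(4)[OF K a perm_groupD(3)[OF K b]])
  have "parity ((a \<circ> pinv b) v) = parity v" for v
  proof -
    have "parity (a (pinv b v)) = (parity (pinv b v) = (parity (a undefined) = parity undefined))"
      by (rule parity_aut[OF aut[OF a]])
    also have "\<dots> = (parity (pinv b v) = (parity (b undefined) = parity undefined))"
      by (simp only: eq)
    also have "\<dots> = parity (b (pinv b v))"
      by (rule parity_aut[OF aut[OF b], symmetric])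
    finally show ?thesis using bij by (simp add: pinv_simps)
  qed
  then show "a \<circ> pinv b \<in> K \<inter> even_group" using ab aut[OF ab] by (simp add: even_group_def)
qed (rule K)

end

context coloured_tree
begin

lemma perm_group_colour_group: "perm_group colour_group"
  unfolding perm_group_def
proof (intro conjI ballI)
  show "id \<in> colour_group" using aut_id by (simp add: colour_group_def)
next
  fix g assume g: "g \<in> colour_group"
  then have a: "aut g" by (simp add: colour_group_def)
  then show bij: "bij g" by (simp add: aut_iff)
  have "c {pinv g u, pinv g v} = c {u, v}" if "{u, v} \<in> E" for u v
  proof -
    have "{pinv g u, pinv g v} \<in> E" using aut_pinv[OF a] that by (simp add: aut_iff)
    then have "c {g (pinv g u), g (pinv g v)} = c {pinv g u, pinv g v}"
      using g unfolding colour_group_def by blast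
    then show ?thesis using bij by (simp add: pinv_simps)
  qed
  then show "pinv g \<in> colour_group" using aut_pinv[OF a] by (simp add: colour_group_def)
next
  fix g h assume "g \<in> colour_group" "h \<in> colour_group"
  then show "g \<circ> h \<in> colour_group"
    using aut_comp[of g h] by (simp add: colour_group_def aut_iff)
qed

lemma colour_group_aut: "g \<in> colour_group \<Longrightarrow> aut g"
  by (simp add: colour_group_def)

lemma colour_group_transitive: obtains g where "g \<in> colour_group" "g v = w"
proof -
  obtain g where "aut g" "g v = w" "\<And>u v. {u, v} \<in> E \<Longrightarrow> c {g u, g v} = c {u, v}"
    by (rule colouring_isomorphism[OF legal legal]) blast
  then show thesis by (intro that[of g]) (simp_all add: colour_group_def)
qed

lemma fin_orbits_colour_group: "fin_orbits colour_group"
  unfolding fin_orbits_def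
proof (intro exI[of _ "{undefined}"] conjI allI)
  show "\<exists>h\<in>colour_group. \<exists>r\<in>{undefined}. v = h r" for v
    by (rule colour_group_transitive[of undefined v]) auto
qed simp

lemma colour_group_stabiliser: "{k \<in> colour_group. k v = v} = {id}"
proof -
  have "k = id" if "k \<in> colour_group" "k v = v" for k
    by (rule colour_group_eqI[OF that(1) perm_groupD(1)[OF perm_group_colour_group], of v])
       (simp add: that)
  then show ?thesis using perm_groupD(1)[OF perm_group_colour_group] by auto
qed

lemma fin_index_colour_group:
  assumes "perm_group H" "H \<subseteq> colour_group" "fin_orbits H"
  shows "fin_index H colour_group"
  by (rule fin_index_if_fin_orbits[OF assms(1) perm_group_colour_group assms(2,3), of undefined])
     (simp add: colour_group_stabiliser)

text \<open>The finite graph \<open>H\T\<close> with the edge of colour \<open>i0\<close> at the vertex \<open>H v0\<close> cut open and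
  attached to an additional vertex is a finite set with an action of the colour group, in which the
  additional vertex is fixed by all generators except the one of colour \<open>i0\<close>.  Transporting this
  action along paths gives a permutation \<open>D v\<close> for every vertex \<open>v\<close>.  The image of the additional
  vertex under \<open>D v\<close> and the image of \<open>H v\<close> under \<open>D v\<close> do not change across edges of colours
  other than \<open>i0\<close>, and an element of the colour group that preserves both of them lies in \<open>H\<close>.\<close>

lemma separating_sets:
  assumes H: "perm_group H" "H \<subseteq> colour_group" "fin_index H colour_group" and i0: "i0 \<in> {1..d}"
  obtains \<A> L where "finite \<A>" "perm_group L" "L \<subseteq> colour_group" "fin_index L colour_group"
    "\<And>A l v. A \<in> \<A> \<Longrightarrow> l \<in> L \<Longrightarrow> l v \<in> A \<longleftrightarrow> v \<in> A"
    "\<And>A i v. A \<in> \<A> \<Longrightarrow> i \<in> {1..d} \<Longrightarrow> i \<noteq> i0 \<Longrightarrow> nb v i \<in> A \<longleftrightarrow> v \<in> A"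
    "\<And>g. g \<in> colour_group \<Longrightarrow> (\<And>A v. A \<in> \<A> \<Longrightarrow> g v \<in> A \<longleftrightarrow> v \<in> A) \<Longrightarrow> g \<in> H"
proof -
  note CG = perm_group_colour_group
  define orb where "orb v = (\<lambda>h. h v) ` H" for v
  define step where "step i O' = (\<lambda>v. nb v i) ` O'" for i O'
  define X where "X = range orb"
  fix v0 :: 'a
  define x0 where "x0 = orb v0"
  have orb_mem: "orb (h v) = orb v" if h: "h \<in> H" for h v
  proof
    show "orb (h v) \<subseteq> orb v"
      unfolding orb_def
    proof (rule image_subsetI)
      fix k assume "k \<in> H"
      then show "k (h v) \<in> (\<lambda>h. h v) ` H"
        by (intro image_eqI[of _ _ "k \<circ> h"]) (simp_all add: perm_groupD(4)[OF H(1)] h)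
    qed
    show "orb v \<subseteq> orb (h v)"
      unfolding orb_def
    proof (rule image_subsetI)
      fix k assume "k \<in> H"
      then show "k v \<in> (\<lambda>k. k (h v)) ` H"
        using perm_groupD(2)[OF H(1) h]
        by (intro image_eqI[of _ _ "k \<circ> pinv h"])
           (simp_all add: perm_groupD(3,4)[OF H(1)] h pinv_simps)
    qed
  qed
  have orb_self: "v \<in> orb v" for v
    unfolding orb_def by (rule image_eqI[of _ _ id]) (simp_all add: perm_groupD(1)[OF H(1)])
  have orb_eqD: "\<exists>h\<in>H. w = h v" if "orb w = orb v" for v w
    using orb_self[of w] unfolding that unfolding orb_def by (rule imageE) blast
  have orb_nb: "orb (nb v i) = step i (orb v)" if "i \<in> {1..d}" for v i
    unfolding orb_def step_def image_image
    by (rule image_cong[OF refl]) (use H(2) colour_group_nb[OF _ that] in auto)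
  have step_step: "step i (step i O') = O'" if "i \<in> {1..d}" for i O'
    unfolding step_def image_image using that by simp
  have finX: "finite X"
  proof -
    have "fin_orbits H"
      by (rule fin_orbits_fin_index[OF H(1) CG H(3) fin_orbits_colour_group])
    then obtain R where R: "finite R" "\<And>v. \<exists>h\<in>H. \<exists>r\<in>R. v = h r" by (rule fin_orbitsE) blast
    have "X \<subseteq> orb ` R"
      unfolding X_def
    proof (rule image_subsetI)
      fix v
      obtain h r where "h \<in> H" "r \<in> R" "v = h r" using R(2)[of v] by blast
      then show "orb v \<in> orb ` R" using orb_mem by simp
    qed
    then show ?thesis using R(1) finite_surj by blast
  qed
  define Z where "Z = insert None (Some ` X)"
  have finZ: "finite Z" using finX by (simp add: Z_def)
  \<comment> \<open>\<open>None\<close> is the additional vertex.\<close>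
  define \<tau> where "\<tau> i z = (if i = i0 then (if z = None then Some x0 else if z = Some x0 then None else z)
      else (case z of None \<Rightarrow> None | Some O' \<Rightarrow> if O' \<in> X then Some (step i O') else z))" for i z
  have stepX: "step i O' \<in> X" if "O' \<in> X" "i \<in> {1..d}" for i O'
  proof -
    obtain v where "O' = orb v" using \<open>O' \<in> X\<close> unfolding X_def by (rule rangeE)
    then show ?thesis using orb_nb[OF that(2), of v] by (simp add: X_def flip: orb_nb[OF that(2)])
  qed
  have \<tau>\<tau>: "\<tau> i (\<tau> i z) = z" if "i \<in> {1..d}" for i z
    using stepX step_step that by (auto simp: \<tau>_def split: option.splits)
  have x0: "x0 \<in> X" by (simp add: x0_def X_def)
  have \<tau>Z: "\<tau> i permutes Z" if i: "i \<in> {1..d}" for i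
  proof (rule bij_imp_permutes)
    have "\<tau> i z \<in> Z" if "z \<in> Z" for z
      using that x0 stepX[OF _ i] by (auto simp: Z_def \<tau>_def)
    then show "bij_betw (\<tau> i) Z Z"
      by (intro bij_betw_byWitness[of _ "\<tau> i"]) (use \<tau>\<tau>[OF i] in auto)
    show "\<tau> i z = z" if "z \<notin> Z" for z
      using that x0 by (cases z) (auto simp: Z_def \<tau>_def)
  qed
  obtain D where D0: "D v0 = id" and DZ: "\<And>v. D v permutes Z"
    and D: "\<And>u v. {u, v} \<in> E \<Longrightarrow> D v = D u \<circ> \<tau> (c {u, v})"
  proof (rule parallel_section[of "\<lambda>_. {f. f permutes Z}" "\<lambda>u v f. f \<circ> \<tau> (c {u, v})" id v0])
    fix u v x assume uv: "{u, v} \<in> E" and x: "x \<in> {f. f permutes Z}"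
    show "x \<circ> \<tau> (c {u, v}) \<in> {f. f permutes Z}"
      using x permutes_compose[OF \<tau>Z[OF colour_range[OF uv]], of x] by simp
    show "x \<circ> \<tau> (c {u, v}) \<circ> \<tau> (c {v, u}) = x"
      using \<tau>\<tau>[OF colour_range[OF uv]] by (simp add: fun_eq_iff insert_commute)
  qed (auto simp: permutes_id)
  have D_nb: "D (nb v i) = D v \<circ> \<tau> i" if "i \<in> {1..d}" for v i
    using D[OF nb(1)[OF that, of v]] nb(2)[OF that, of v] by simp
  have D_mult: "D (g v) = D (g v0) \<circ> D v" if g: "g \<in> colour_group" for g v
  proof -
    have "(\<lambda>v. D (g v)) = (\<lambda>v. D (g v0) \<circ> D v)"
    proof (rule parallel_section_unique[where \<phi> = "\<lambda>u v f. f \<circ> \<tau> (c {u, v})" and ?v0.0 = v0])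
      fix u v assume uv: "{u, v} \<in> E"
      show "D (g v0) \<circ> D v = D (g v0) \<circ> D u \<circ> \<tau> (c {u, v})"
        by (simp add: D[OF uv] comp_assoc)
      have "{g u, g v} \<in> E" "c {g u, g v} = c {u, v}"
        using g uv by (simp_all add: colour_group_def aut_iff)
      then show "D (g v) = D (g u) \<circ> \<tau> (c {u, v})" using D by metis
    qed (simp add: D0)
    then show ?thesis by (rule fun_cong)
  qed
  have inj: "D v z = D v z' \<Longrightarrow> z = z'" for v z z'
    using permutes_inj[OF DZ] by (rule injD)
  \<comment> \<open>Across an edge of colour \<open>i\<close> other than \<open>i0\<close>, the factor \<open>\<tau> i\<close> undoes the change of \<open>orb v\<close>.\<close>
  define I where "I v = D v (Some (orb v))" for v
  define J where "J v = D v None" for v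
  have IZ: "I v \<in> Z" "J v \<in> Z" for v
    using permutes_in_image[OF DZ] by (simp_all add: I_def J_def Z_def X_def)
  have I_nb: "I (nb v i) = I v" "J (nb v i) = J v" if i: "i \<in> {1..d}" "i \<noteq> i0" for v i
  proof -
    have "\<tau> i (Some (orb (nb v i))) = Some (orb v)"
      using i orb_nb[OF i(1)] step_step[OF i(1)] stepX[OF _ i(1)] by (simp add: \<tau>_def X_def flip: orb_nb)
    then show "I (nb v i) = I v" by (simp add: I_def D_nb[OF i(1)])
    show "J (nb v i) = J v" using i by (simp add: J_def D_nb[OF i(1)] \<tau>_def)
  qed
  define L where "L = {h \<in> H. D (h v0) = id}"
  have L_D: "D (l v) = D v" if "l \<in> L" for l v
  proof -
    have "l \<in> colour_group" using that H(2) by (auto simp: L_def)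
    from D_mult[OF this, of v] that show ?thesis by (simp add: L_def)
  qed
  have L: "perm_group L"
    unfolding perm_group_def
  proof (intro conjI ballI)
    show "id \<in> L" using perm_groupD(1)[OF H(1)] D0 by (simp add: L_def)
  next
    fix g assume g: "g \<in> L"
    then have gH: "g \<in> H" by (simp add: L_def)
    show bij: "bij g" by (rule perm_groupD(2)[OF H(1) gH])
    have "D (pinv g v0) = D (g (pinv g v0))" by (rule L_D[OF g, symmetric])
    then show "pinv g \<in> L"
      using perm_groupD(3)[OF H(1) gH] D0 bij by (simp add: L_def pinv_simps)
  next
    fix g h assume gh: "g \<in> L" "h \<in> L"
    then have "g \<circ> h \<in> H" by (intro perm_groupD(4)[OF H(1)]) (simp_all add: L_def)
    moreover have "D ((g \<circ> h) v0) = id" using L_D[OF gh(1)] L_D[OF gh(2)] D0 by simp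
    ultimately show "g \<circ> h \<in> L" by (simp add: L_def)
  qed
  have finL: "fin_index L colour_group"
  proof -
    obtain \<Phi> :: "('a \<Rightarrow> 'a) \<Rightarrow> ('a \<Rightarrow> 'a) set" where \<Phi>: "finite (\<Phi> ` colour_group)"
      "\<And>a b. a \<in> colour_group \<Longrightarrow> b \<in> colour_group \<Longrightarrow> \<Phi> a = \<Phi> b \<Longrightarrow> a \<circ> pinv b \<in> H"
      by (rule fin_index_separating_map[OF H(1) CG H(3)]) blast
    show ?thesis
    proof (rule fin_indexI[OF L CG, where \<Phi> = "\<lambda>a. (\<Phi> a, D (a v0))"])
      have "(\<lambda>a. (\<Phi> a, D (a v0))) ` colour_group \<subseteq> \<Phi> ` colour_group \<times> {f. f permutes Z}"
        using DZ by auto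
      then show "finite ((\<lambda>a. (\<Phi> a, D (a v0))) ` colour_group)"
        by (rule finite_subset) (use \<Phi>(1) finite_permutations[OF finZ] in simp)
      fix a b assume a: "a \<in> colour_group" and b: "b \<in> colour_group"
        and eq: "(\<Phi> a, D (a v0)) = (\<Phi> b, D (b v0))"
      have ab: "a \<circ> pinv b \<in> H" using \<Phi>(2)[OF a b] eq by simp
      have "D ((a \<circ> pinv b) (b v0)) = D ((a \<circ> pinv b) v0) \<circ> D (b v0)"
        by (rule D_mult[OF subsetD[OF H(2) ab]])
      moreover have "(a \<circ> pinv b) (b v0) = a v0"
        using perm_groupD(2)[OF CG b] by (simp add: pinv_simps)
      ultimately have "D ((a \<circ> pinv b) v0) \<circ> D (b v0) = D (b v0)" using eq by simp
      moreover have "surj (D (b v0))" using permutes_surj[OF DZ] .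
      ultimately have "D ((a \<circ> pinv b) v0) y = y" for y
        by (metis comp_apply surjD)
      then have "D ((a \<circ> pinv b) v0) = id" by (simp add: fun_eq_iff)
      then show "a \<circ> pinv b \<in> L" using ab by (simp add: L_def)
    qed
  qed
  let ?\<A> = "(\<lambda>z. {v. I v = z}) ` Z \<union> (\<lambda>z. {v. J v = z}) ` Z"
  show thesis
  proof (rule that[of ?\<A> L])
    show "finite ?\<A>" using finZ by simp
    show "L \<subseteq> colour_group" using H(2) by (auto simp: L_def)
    show "l v \<in> A \<longleftrightarrow> v \<in> A" if A: "A \<in> ?\<A>" and l: "l \<in> L" for A l v
    proof -
      have "I (l v) = I v" "J (l v) = J v"
        using L_D[OF l] orb_mem[of l v] l by (simp_all add: I_def J_def L_def)
      then show ?thesis using A by auto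
    qed
    show "nb v i \<in> A \<longleftrightarrow> v \<in> A" if "A \<in> ?\<A>" "i \<in> {1..d}" "i \<noteq> i0" for A i v
      using that(1) I_nb[OF that(2,3)] by auto
    show "g \<in> H" if g: "g \<in> colour_group"
      and pres: "\<And>A v. A \<in> ?\<A> \<Longrightarrow> g v \<in> A \<longleftrightarrow> v \<in> A" for g
    proof -
      have eqI: "I (g v) = I v" for v
        using pres[of "{w. I w = I v}" v] IZ(1)[of v] by auto
      have eqJ: "J (g v) = J v" for v
        using pres[of "{w. J w = J v}" v] IZ(2)[of v] by auto
      \<comment> \<open>Both \<open>orb (g v0)\<close> and \<open>x0\<close> are mapped to \<open>x0\<close> by \<open>D (g v0)\<close>.\<close>
      have "J (nb v0 i0) = Some x0" by (simp add: J_def D_nb[OF i0] D0 \<tau>_def)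
      moreover have "J (g (nb v0 i0)) = D (g v0) (Some x0)"
        by (simp add: J_def D_mult[OF g, of "nb v0 i0"] D_nb[OF i0] D0 \<tau>_def)
      moreover have "I v0 = Some x0" by (simp add: I_def D0 x0_def)
      moreover have "I (g v0) = D (g v0) (Some (orb (g v0)))" by (simp add: I_def)
      ultimately have "D (g v0) (Some (orb (g v0))) = D (g v0) (Some x0)"
        using eqI[of v0] eqJ[of "nb v0 i0"] by simp
      then have "orb (g v0) = orb v0" using inj x0_def by blast
      then obtain h where h: "h \<in> H" "g v0 = h v0" using orb_eqD by blast
      then have "g = h" using colour_group_eqI[OF g, of h v0] H(2) by blast
      then show ?thesis using h by simp
    qed
  qed (use L finL in auto)
qed

end

section \<open>Recolouring the tree\<close>

lemma perm_subgroup: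
  assumes "subgroup F (sym_group d)"
  shows "id \<in> F" "f \<in> F \<Longrightarrow> f permutes {1..d}" "f \<in> F \<Longrightarrow> pinv f \<in> F"
    "f \<in> F \<Longrightarrow> g \<in> F \<Longrightarrow> f \<circ> g \<in> F"
proof -
  interpret subgroup F "sym_group d" by fact
  show "id \<in> F" using one_closed by (simp add: sym_group_def)
  show perm: "f permutes {1..d}" if "f \<in> F" for f using subset that by (auto simp: sym_group_def)
  show "pinv f \<in> F" if "f \<in> F"
    using m_inv_closed[OF that] sym_group_inv_equality[of f d] perm[OF that] by (simp add: sym_group_def)
  show "f \<circ> g \<in> F" if "f \<in> F" "g \<in> F" using m_closed[OF that] by (simp add: sym_group_def)
qed

context coloured_tree
begin

abbreviation univ_group :: "(nat \<Rightarrow> nat) set \<Rightarrow> ('a \<Rightarrow> 'a) set" where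
  "univ_group F \<equiv> carrier (universal_group d E c F)"

lemma univ_group_iff:
  assumes F: "subgroup F (sym_group d)"
  shows "g \<in> univ_group F \<longleftrightarrow>
    aut g \<and> (\<forall>v. \<exists>p\<in>F. \<forall>w. {v, w} \<in> E \<longrightarrow> c {g v, g w} = p (c {v, w}))" (is "_ \<longleftrightarrow> ?R")
proof
  assume g: "g \<in> univ_group F"
  then have a: "aut g" and l: "\<And>v. local_action d E c g v \<in> F" by (auto simp: universal_group_def)
  have "c {g v, g w} = local_action d E c g v (c {v, w})" if "{v, w} \<in> E" for v w
    using local_action(2)[OF tree legal a, of "{v, w}" v] that by (simp add: star_edges_def)
  then show ?R using a l by blast
next
  assume R: ?R
  have "local_action d E c g v \<in> F" for v
  proof -
    obtain p where p: "p \<in> F" "\<And>w. {v, w} \<in> E \<Longrightarrow> c {g v, g w} = p (c {v, w})" using R by blast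
    have "local_action d E c g v = p"
    proof (rule local_action_eqI[OF tree legal])
      show "p \<in> carrier (sym_group d)" using perm_subgroup(2)[OF F p(1)] by (simp add: sym_group_def)
      fix e assume "e \<in> star_edges E v"
      then show "c (g ` e) = p (c e)" unfolding star_eq using p(2)[OF nb(1)] by auto
    qed (use R in blast)
    then show ?thesis using p(1) by simp
  qed
  then show "g \<in> univ_group F" using R by (simp add: universal_group_def)
qed

lemma colour_group_subset_univ_group:
  assumes F: "subgroup F (sym_group d)" shows "colour_group \<subseteq> univ_group F"
proof
  fix g assume "g \<in> colour_group"
  then show "g \<in> univ_group F"
    unfolding univ_group_iff[OF F] using perm_subgroup(1)[OF F]
    by (auto simp: colour_group_def intro!: bexI[of _ id])
qed

lemma perm_group_univ_group:
  assumes F: "subgroup F (sym_group d)" shows "perm_group (univ_group F)"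
  unfolding perm_group_def
proof (intro conjI ballI)
  show "id \<in> univ_group F"
    using colour_group_subset_univ_group[OF F] perm_groupD(1)[OF perm_group_colour_group] by blast
next
  fix g assume g: "g \<in> univ_group F"
  then have a: "aut g" by (simp add: univ_group_iff[OF F])
  then show bij: "bij g" by (simp add: aut_iff)
  have "\<exists>p\<in>F. \<forall>w. {v, w} \<in> E \<longrightarrow> c {pinv g v, pinv g w} = p (c {v, w})" for v
  proof -
    obtain p where p: "p \<in> F" "\<And>w. {pinv g v, w} \<in> E \<Longrightarrow> c {g (pinv g v), g w} = p (c {pinv g v, w})"
      using g unfolding univ_group_iff[OF F] by blast
    have "c {pinv g v, pinv g w} = pinv p (c {v, w})" if "{v, w} \<in> E" for w
    proof -
      have "{pinv g v, pinv g w} \<in> E" using aut_pinv[OF a] that by (simp add: aut_iff)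
      from p(2)[OF this] have "c {v, w} = p (c {pinv g v, pinv g w})" using bij by (simp add: pinv_simps)
      then show ?thesis using permutes_inverses(2)[OF perm_subgroup(2)[OF F p(1)]] by simp
    qed
    then show ?thesis using perm_subgroup(3)[OF F p(1)] by blast
  qed
  then show "pinv g \<in> univ_group F" using aut_pinv[OF a] by (simp add: univ_group_iff[OF F])
next
  fix g h assume g: "g \<in> univ_group F" and h: "h \<in> univ_group F"
  have "\<exists>p\<in>F. \<forall>w. {v, w} \<in> E \<longrightarrow> c {(g \<circ> h) v, (g \<circ> h) w} = p (c {v, w})" for v
  proof -
    obtain p where p: "p \<in> F" "\<And>w. {v, w} \<in> E \<Longrightarrow> c {h v, h w} = p (c {v, w})"
      using h unfolding univ_group_iff[OF F] by blast
    obtain q where q: "q \<in> F" "\<And>w. {h v, w} \<in> E \<Longrightarrow> c {g (h v), g w} = q (c {h v, w})"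
      using g unfolding univ_group_iff[OF F] by blast
    have "c {(g \<circ> h) v, (g \<circ> h) w} = (q \<circ> p) (c {v, w})" if "{v, w} \<in> E" for w
      using q(2)[of "h w"] p(2)[OF that] that h by (simp add: univ_group_iff[OF F] aut_iff)
    then show ?thesis by (intro bexI[OF _ perm_subgroup(4)[OF F q(1) p(1)]]) simp
  qed
  then show "g \<circ> h \<in> univ_group F"
    using g h aut_comp[of g h] by (simp add: univ_group_iff[OF F])
qed

end

text \<open>Equivalent colourings define the same group \<open>U(F)\<close>, so that a colouring may be replaced by
  an equivalent one that is better adapted to a given subgroup.\<close>

definition (in tree) colouring_equiv :: "(nat \<Rightarrow> nat) set \<Rightarrow> ('v set \<Rightarrow> nat) \<Rightarrow> ('v set \<Rightarrow> nat) \<Rightarrow> bool" where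
  "colouring_equiv F c c' \<longleftrightarrow> (\<forall>v. \<exists>p\<in>F. \<forall>w. {v, w} \<in> E \<longrightarrow> c' {v, w} = p (c {v, w}))"

context coloured_tree
begin

lemma legal_if_equiv:
  assumes F: "subgroup F (sym_group d)" and eq: "colouring_equiv F c c'"
  shows "legal_coloring d E c'"
  unfolding legal_coloring_def
proof
  fix v
  obtain p where p: "p \<in> F" "\<And>w. {v, w} \<in> E \<Longrightarrow> c' {v, w} = p (c {v, w})"
    using eq unfolding colouring_equiv_def by blast
  have "bij_betw (p \<circ> c) (star_edges E v) {1..d}"
    using legal permutes_imp_bij[OF perm_subgroup(2)[OF F p(1)]]
    unfolding legal_coloring_def by (blast intro: bij_betw_trans)
  moreover have "c' e = (p \<circ> c) e" if "e \<in> star_edges E v" for e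
    using that unfolding star_eq using p(2)[OF nb(1)] by auto
  ultimately show "bij_betw c' (star_edges E v) {1..d}"
    by (simp cong: bij_betw_cong)
qed

lemma univ_group_equiv:
  assumes F: "subgroup F (sym_group d)" and eq: "colouring_equiv F c c'"
    and g: "g \<in> univ_group F"
  shows "g \<in> carrier (universal_group d E c' F)"
proof -
  interpret c': coloured_tree E d c' by unfold_locales (rule legal_if_equiv[OF F eq])
  have a: "aut g" using g by (simp add: univ_group_iff[OF F])
  have "\<exists>p\<in>F. \<forall>w. {v, w} \<in> E \<longrightarrow> c' {g v, g w} = p (c' {v, w})" for v
  proof -
    obtain p where p: "p \<in> F" "\<And>w. {v, w} \<in> E \<Longrightarrow> c' {v, w} = p (c {v, w})"
      using eq unfolding colouring_equiv_def by blast
    obtain q where q: "q \<in> F" "\<And>w. {g v, w} \<in> E \<Longrightarrow> c' {g v, w} = q (c {g v, w})"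
      using eq unfolding colouring_equiv_def by blast
    obtain r where r: "r \<in> F" "\<And>w. {v, w} \<in> E \<Longrightarrow> c {g v, g w} = r (c {v, w})"
      using g unfolding univ_group_iff[OF F] by blast
    have "c' {g v, g w} = (q \<circ> (r \<circ> pinv p)) (c' {v, w})" if "{v, w} \<in> E" for w
    proof -
      have "pinv p (c' {v, w}) = c {v, w}"
        using p(2)[OF that] permutes_inverses(2)[OF perm_subgroup(2)[OF F p(1)]] by simp
      moreover have "{g v, g w} \<in> E" using a that by (simp add: aut_iff)
      ultimately show ?thesis using q(2) r(2)[OF that] by simp
    qed
    moreover have "q \<circ> (r \<circ> pinv p) \<in> F" by (intro perm_subgroup(3,4)[OF F] p q r)
    ultimately show ?thesis by blast
  qed
  then show ?thesis using a by (simp add: c'.univ_group_iff[OF F])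
qed

lemma colouring_equiv_sym:
  assumes F: "subgroup F (sym_group d)" and eq: "colouring_equiv F c c'"
  shows "colouring_equiv F c' c"
  unfolding colouring_equiv_def
proof
  fix v
  obtain p where p: "p \<in> F" "\<And>w. {v, w} \<in> E \<Longrightarrow> c' {v, w} = p (c {v, w})"
    using eq unfolding colouring_equiv_def by blast
  have "c {v, w} = pinv p (c' {v, w})" if "{v, w} \<in> E" for w
    using p(2)[OF that] permutes_inverses(2)[OF perm_subgroup(2)[OF F p(1)]] by simp
  then show "\<exists>p\<in>F. \<forall>w. {v, w} \<in> E \<longrightarrow> c {v, w} = p (c' {v, w})"
    using perm_subgroup(3)[OF F p(1)] by blast
qed

text \<open>The isomorphism between two equivalent colourings changes the colours at a vertex by an element
  of \<open>F\<close>, because it preserves the labels up to the passage from one colouring to the other.\<close>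

lemma equiv_colouring_isomorphism:
  assumes F: "subgroup F (sym_group d)" and eq: "colouring_equiv F c c'"
  obtains g where "g \<in> univ_group F" "\<And>u v. {u, v} \<in> E \<Longrightarrow> c' {g u, g v} = c {u, v}"
proof -
  obtain g where g: "aut g" "\<And>u v. {u, v} \<in> E \<Longrightarrow> c' {g u, g v} = c {u, v}"
    by (rule colouring_isomorphism[OF legal legal_if_equiv[OF F eq], of undefined undefined]) blast
  have "\<exists>p\<in>F. \<forall>w. {v, w} \<in> E \<longrightarrow> c {g v, g w} = p (c {v, w})" for v
  proof -
    obtain p where p: "p \<in> F" "\<And>w. {g v, w} \<in> E \<Longrightarrow> c {g v, w} = p (c' {g v, w})"
      using colouring_equiv_sym[OF F eq] unfolding colouring_equiv_def by blast
    have "c {g v, g w} = p (c {v, w})" if "{v, w} \<in> E" for w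
      using p(2)[of "g w"] g that by (simp add: aut_iff)
    then show ?thesis using p(1) by blast
  qed
  then show thesis using that[of g] g by (simp add: univ_group_iff[OF F])
qed

text \<open>Let \<open>f \<in> F\<close> fix the colour \<open>i0\<close>.  A set of vertices that is a union of components of the tree
  without the edges of colour \<open>i0\<close> can be recoloured by \<open>f\<close>, which gives an equivalent colouring.
  An automorphism that preserves both colourings preserves the set, because \<open>f\<close> moves some colour
  \<open>i1\<close>.  If the set is invariant under a subgroup of finite index, then the corresponding element of
  \<open>U(F)\<close> commensurates the colour group.  Sets of this kind that cut out \<open>H\<close> are provided by
  \<open>separating_sets\<close>.\<close>

lemma colour_group_congruence:
  assumes F: "subgroup F (sym_group d)" and nf: "\<not> acts_freely F {1..d}"
    and H: "perm_group H" "H \<subseteq> colour_group" "fin_index H colour_group"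
  obtains S where "finite S" "S \<subseteq> univ_group F"
    "\<And>g. g \<in> S \<Longrightarrow> fin_orbits (colour_group \<inter> conj_by g colour_group)"
    "\<And>x. x \<in> colour_group \<Longrightarrow> (\<And>g. g \<in> S \<Longrightarrow> x \<in> conj_by g colour_group) \<Longrightarrow> x \<in> H"
proof -
  obtain f i0 where f: "f \<in> F" "i0 \<in> {1..d}" "f i0 = i0" "f \<noteq> id"
    using nf by (auto simp: acts_freely_def)
  have fp: "f permutes {1..d}" by (rule perm_subgroup(2)[OF F f(1)])
  obtain i1 where i1: "i1 \<in> {1..d}" "f i1 \<noteq> i1"
  proof -
    obtain i1 where "f i1 \<noteq> i1" using f(4) by (auto simp: fun_eq_iff)
    then show thesis using that[of i1] permutes_not_in[OF fp] by blast
  qed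
  obtain \<A> L where \<A>: "finite \<A>" and L: "perm_group L" "L \<subseteq> colour_group" "fin_index L colour_group"
    and LA: "\<And>A l v. A \<in> \<A> \<Longrightarrow> l \<in> L \<Longrightarrow> l v \<in> A \<longleftrightarrow> v \<in> A"
    and nbA: "\<And>A i v. A \<in> \<A> \<Longrightarrow> i \<in> {1..d} \<Longrightarrow> i \<noteq> i0 \<Longrightarrow> nb v i \<in> A \<longleftrightarrow> v \<in> A"
    and sep: "\<And>g. g \<in> colour_group \<Longrightarrow> (\<And>A v. A \<in> \<A> \<Longrightarrow> g v \<in> A \<longleftrightarrow> v \<in> A) \<Longrightarrow> g \<in> H"
    by (rule separating_sets[OF H f(2)]) blast
  define cA where "cA A e = (if e \<inter> A = {} then c e else f (c e))" for A e
  have cA: "cA A {v, w} = (if v \<in> A then f else id) (c {v, w})" if A: "A \<in> \<A>" and e: "{v, w} \<in> E" for A v w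
  proof (cases "c {v, w} = i0")
    case True
    then show ?thesis using f(3) by (simp add: cA_def)
  next
    case False
    then have "w \<in> A \<longleftrightarrow> v \<in> A"
      using nbA[OF A colour_range[OF e] False, of v] nb_eqI[OF e refl] by simp
    then show ?thesis by (auto simp: cA_def)
  qed
  have eqv: "colouring_equiv F c (cA A)" if A: "A \<in> \<A>" for A
    unfolding colouring_equiv_def
  proof
    fix v
    show "\<exists>p\<in>F. \<forall>w. {v, w} \<in> E \<longrightarrow> cA A {v, w} = p (c {v, w})"
      using cA[OF A] f(1) perm_subgroup(1)[OF F] by (intro bexI[of _ "if v \<in> A then f else id"]) auto
  qed
  have "\<exists>g. g \<in> univ_group F \<and> (\<forall>u v. {u, v} \<in> E \<longrightarrow> cA A {g u, g v} = c {u, v})" if A: "A \<in> \<A>" for A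
    by (rule equiv_colouring_isomorphism[OF F eqv[OF A]]) blast
  then obtain g where g: "\<And>A. A \<in> \<A> \<Longrightarrow> g A \<in> univ_group F"
    "\<And>A u v. A \<in> \<A> \<Longrightarrow> {u, v} \<in> E \<Longrightarrow> cA A {g A u, g A v} = c {u, v}"
    by metis
  have ag: "aut (g A)" "bij (g A)" if "A \<in> \<A>" for A
    using g(1)[OF that] by (simp_all add: univ_group_iff[OF F] aut_iff)
  \<comment> \<open>The conjugate of the colour group by \<open>g A\<close> is the group that preserves the new colouring.\<close>
  have g': "c {pinv (g A) u, pinv (g A) v} = cA A {u, v}" if A: "A \<in> \<A>" and e: "{u, v} \<in> E" for A u v
  proof -
    have "{pinv (g A) u, pinv (g A) v} \<in> E" using aut_pinv[OF ag(1)[OF A]] e by (simp add: aut_iff)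
    from g(2)[OF A this] show ?thesis using ag(2)[OF A] by (simp add: pinv_simps)
  qed
  have conj: "x \<in> conj_by (g A) colour_group \<longleftrightarrow> (\<forall>u v. {u, v} \<in> E \<longrightarrow> cA A {x u, x v} = cA A {u, v})"
    if A: "A \<in> \<A>" and x: "aut x" for A x
  proof -
    let ?y = "pinv (g A) \<circ> x \<circ> g A"
    have ay: "aut ?y" using ag(1)[OF A] x aut_comp aut_pinv by blast
    have "c {?y u, ?y v} = cA A {x (g A u), x (g A v)}" if "{u, v} \<in> E" for u v
      using g'[OF A, of "x (g A u)" "x (g A v)"] that x ag(1)[OF A] by (simp add: aut_iff)
    then have "?y \<in> colour_group \<longleftrightarrow> (\<forall>u v. {u, v} \<in> E \<longrightarrow> cA A {x (g A u), x (g A v)} = cA A {g A u, g A v})"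
      using ay g(2)[OF A] by (auto simp: colour_group_def)
    also have "\<dots> \<longleftrightarrow> (\<forall>u v. {u, v} \<in> E \<longrightarrow> cA A {x u, x v} = cA A {u, v})"
    proof (intro iffI allI impI)
      fix u v assume *: "\<forall>u v. {u, v} \<in> E \<longrightarrow> cA A {x (g A u), x (g A v)} = cA A {g A u, g A v}" "{u, v} \<in> E"
      have "{pinv (g A) u, pinv (g A) v} \<in> E" using aut_pinv[OF ag(1)[OF A]] *(2) by (simp add: aut_iff)
      with *(1) have "cA A {x (g A (pinv (g A) u)), x (g A (pinv (g A) v))} = cA A {g A (pinv (g A) u), g A (pinv (g A) v)}"
        by blast
      then show "cA A {x u, x v} = cA A {u, v}" using ag(2)[OF A] by (simp add: pinv_simps)
    next
      fix u v assume *: "\<forall>u v. {u, v} \<in> E \<longrightarrow> cA A {x u, x v} = cA A {u, v}" "{u, v} \<in> E"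
      have "{g A u, g A v} \<in> E" using ag(1)[OF A] *(2) by (simp add: aut_iff)
      then show "cA A {x (g A u), x (g A v)} = cA A {g A u, g A v}" using *(1) by blast
    qed
    finally show ?thesis using mem_conj_by[OF ag(2)[OF A]] by simp
  qed
  show thesis
  proof (rule that[of "g ` \<A>"])
    show "finite (g ` \<A>)" using \<A> by simp
    show "g ` \<A> \<subseteq> univ_group F" using g(1) by blast
    fix h assume "h \<in> g ` \<A>"
    then obtain A where A: "A \<in> \<A>" "h = g A" by blast
    have "L \<subseteq> conj_by (g A) colour_group"
    proof
      fix l assume l: "l \<in> L"
      then have lc: "l \<in> colour_group" using L(2) by blast
      have al: "aut l" by (rule colour_group_aut[OF lc])
      have "cA A {l u, l v} = cA A {u, v}" if e: "{u, v} \<in> E" for u v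
      proof -
        have "{l u, l v} \<in> E" "c {l u, l v} = c {u, v}" using lc e al by (auto simp: colour_group_def aut_iff)
        then show ?thesis using cA[OF A(1)] e LA[OF A(1) l] by simp
      qed
      then show "l \<in> conj_by (g A) colour_group" unfolding conj[OF A(1) al] by blast
    qed
    moreover have "fin_orbits L"
      by (rule fin_orbits_fin_index[OF L(1) perm_group_colour_group L(3) fin_orbits_colour_group])
    ultimately show "fin_orbits (colour_group \<inter> conj_by h colour_group)"
      unfolding A(2) using fin_orbits_mono Int_greatest[OF L(2)] by blast
  next
    fix x assume x: "x \<in> colour_group" "\<And>h. h \<in> g ` \<A> \<Longrightarrow> x \<in> conj_by h colour_group"
    show "x \<in> H"
    proof (rule sep[OF x(1)])
      fix A v assume A: "A \<in> \<A>"
      have e: "{v, nb v i1} \<in> E" "c {v, nb v i1} = i1" using nb[OF i1(1)] by auto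
      have xe: "{x v, x (nb v i1)} \<in> E" "c {x v, x (nb v i1)} = i1"
        using x(1) e by (auto simp: colour_group_def aut_iff)
      have "x \<in> conj_by (g A) colour_group" using x(2)[of "g A"] A by simp
      then have "\<forall>u v. {u, v} \<in> E \<longrightarrow> cA A {x u, x v} = cA A {u, v}"
        by (simp only: conj[OF A colour_group_aut[OF x(1)]])
      then have "cA A {x v, x (nb v i1)} = cA A {v, nb v i1}" using e(1) by blast
      then have "(if x v \<in> A then f else id) i1 = (if v \<in> A then f else id) i1"
        using cA[OF A e(1)] cA[OF A xe(1)] e(2) xe(2) by simp
      then show "x v \<in> A \<longleftrightarrow> v \<in> A" using i1(2) by (auto split: if_splits)
    qed
  qed
qed

end

section \<open>Counting edge crossings\<close>

context coloured_tree
begin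

text \<open>The cochain that is dual to the oriented edge from \<open>p\<close> to \<open>p'\<close> of the quotient graph \<open>K\T\<close>,
  pulled back to the tree, where it has the primitive \<open>height\<close>.\<close>

definition crossing :: "('a \<Rightarrow> 'a) set \<Rightarrow> 'a \<Rightarrow> 'a \<Rightarrow> 'a \<Rightarrow> 'a \<Rightarrow> int" where
  "crossing K p p' a b = of_bool (\<exists>k\<in>K. a = k p \<and> b = k p') - of_bool (\<exists>k\<in>K. b = k p \<and> a = k p')"

definition height :: "('a \<Rightarrow> 'a) set \<Rightarrow> 'a \<Rightarrow> 'a \<Rightarrow> 'a \<Rightarrow> int" where
  "height K p p' = (SOME f. \<forall>a b. {a, b} \<in> E \<longrightarrow> f b = f a + crossing K p p' a b)"

lemma height: assumes "{a, b} \<in> E" shows "height K p p' b = height K p p' a + crossing K p p' a b"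
proof -
  obtain f where "\<And>a b. {a, b} \<in> E \<Longrightarrow> f b = f a + crossing K p p' a b"
    by (rule potential[of "crossing K p p'"]) (auto simp: crossing_def)
  then have "\<forall>a b. {a, b} \<in> E \<longrightarrow> f b = f a + crossing K p p' a b" by blast
  then have "\<forall>a b. {a, b} \<in> E \<longrightarrow> height K p p' b = height K p p' a + crossing K p p' a b"
    unfolding height_def
    by (rule someI[of "\<lambda>f. \<forall>a b. {a, b} \<in> E \<longrightarrow> f b = f a + crossing K p p' a b"])
  then show ?thesis using assms by blast
qed

lemma crossing_orbit:
  assumes K: "perm_group K" and h: "h \<in> K"
  shows "crossing K p p' (h a) (h b) = crossing K p p' a b"
    and "crossing K (h p) (h p') a b = crossing K p p' a b"
proof -
  have bij: "bij h" by (rule perm_groupD(2)[OF K h])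
  have 1: "(\<exists>k\<in>K. h a = k p \<and> h b = k p') \<longleftrightarrow> (\<exists>k\<in>K. a = k p \<and> b = k p')" for a b p p'
  proof
    assume "\<exists>k\<in>K. h a = k p \<and> h b = k p'"
    then obtain k where k: "k \<in> K" "h a = k p" "h b = k p'" by blast
    have "a = (pinv h \<circ> k) p" "b = (pinv h \<circ> k) p'"
      using bij by (simp_all add: pinv_simps flip: k(2,3))
    then show "\<exists>k\<in>K. a = k p \<and> b = k p'"
      using perm_groupD(4)[OF K perm_groupD(3)[OF K h] k(1)] by blast
  next
    assume "\<exists>k\<in>K. a = k p \<and> b = k p'"
    then obtain k where k: "k \<in> K" "a = k p" "b = k p'" by blast
    then have "h a = (h \<circ> k) p" "h b = (h \<circ> k) p'" by simp_all
    then show "\<exists>k\<in>K. h a = k p \<and> h b = k p'"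
      using perm_groupD(4)[OF K h k(1)] by blast
  qed
  show "crossing K p p' (h a) (h b) = crossing K p p' a b" by (simp add: crossing_def 1)
  have 2: "(\<exists>k\<in>K. a = k (h p) \<and> b = k (h p')) \<longleftrightarrow> (\<exists>k\<in>K. a = k p \<and> b = k p')" for a b p p'
  proof
    assume "\<exists>k\<in>K. a = k (h p) \<and> b = k (h p')"
    then obtain k where k: "k \<in> K" "a = k (h p)" "b = k (h p')" by blast
    then have "a = (k \<circ> h) p" "b = (k \<circ> h) p'" by simp_all
    then show "\<exists>k\<in>K. a = k p \<and> b = k p'"
      using perm_groupD(4)[OF K k(1) h] by blast
  next
    assume "\<exists>k\<in>K. a = k p \<and> b = k p'"
    then obtain k where k: "k \<in> K" "a = k p" "b = k p'" by blast
    have "a = (k \<circ> pinv h) (h p)" "b = (k \<circ> pinv h) (h p')"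
      using bij by (simp_all add: pinv_simps k(2,3))
    then show "\<exists>k\<in>K. a = k (h p) \<and> b = k (h p')"
      using perm_groupD(4)[OF K k(1) perm_groupD(3)[OF K h]] by blast
  qed
  show "crossing K (h p) (h p') a b = crossing K p p' a b" by (simp add: crossing_def 2)
qed

text \<open>The homomorphism from \<open>K\<close> to the integers that counts how often a path from a vertex \<open>v\<close>
  to \<open>k v\<close> crosses the \<open>K\<close>-orbit of an oriented edge.\<close>

definition crossings :: "('a \<Rightarrow> 'a) set \<Rightarrow> 'a \<Rightarrow> 'a \<Rightarrow> ('a \<Rightarrow> 'a) \<Rightarrow> int" where
  "crossings K p p' k = height K p p' (k undefined) - height K p p' undefined"

lemma crossings:
  assumes K: "perm_group K" "K \<subseteq> colour_group" and k: "k \<in> K"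
  shows "crossings K p p' k = height K p p' (k v) - height K p p' v"
proof -
  have "height K p p' (k undefined) - height K p p' undefined = height K p p' (k v) - height K p p' v"
  proof (rule constant_if_gradients_equal)
    fix u w assume e: "{u, w} \<in> E"
    have "{k u, k w} \<in> E" using subsetD[OF K(2) k] e by (simp add: colour_group_def aut_iff)
    then show "height K p p' (k w) - height K p p' (k u) = height K p p' w - height K p p' u"
      using height[OF e, of K p p'] height[of "k u" "k w" K p p'] crossing_orbit(1)[OF K(1) k] by simp
  qed
  then show ?thesis by (simp add: crossings_def)
qed

lemma crossings_comp:
  assumes K: "perm_group K" "K \<subseteq> colour_group" and "h \<in> K" "k \<in> K"
  shows "crossings K p p' (h \<circ> k) = crossings K p p' h + crossings K p p' k"
  using crossings[OF K assms(3), of p p' "k undefined"] by (simp add: crossings_def)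

lemma crossings_id: "crossings K p p' id = 0"
  by (simp add: crossings_def)

lemma crossings_pinv:
  assumes K: "perm_group K" "K \<subseteq> colour_group" and k: "k \<in> K"
  shows "crossings K p p' (pinv k) = - crossings K p p' k"
  using crossings_comp[OF K perm_groupD(3)[OF K(1) k] k, of p p'] perm_groupD(2)[OF K(1) k]
  by (simp add: pinv_simps crossings_id)

lemma crossings_funpow:
  assumes K: "perm_group K" "K \<subseteq> colour_group" and k: "k \<in> K"
  shows "crossings K p p' (k ^^ n) = int n * crossings K p p' k"
proof (induction n)
  case (Suc n)
  show ?case
    unfolding funpow.simps(2) crossings_comp[OF K k perm_group_funpow[OF K(1) k]] Suc
    by (simp add: algebra_simps)
qed (simp add: crossings_def)

lemma crossings_orbit:
  assumes K: "perm_group K" "K \<subseteq> colour_group" and h: "h \<in> K" and k: "k \<in> K"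
  shows "crossings K (h p) (h p') k = crossings K p p' k"
proof -
  have "height K (h p) (h p') (k undefined) - height K p p' (k undefined) =
      height K (h p) (h p') undefined - height K p p' undefined"
  proof (rule constant_if_gradients_equal)
    fix u w assume e: "{u, w} \<in> E"
    show "height K (h p) (h p') w - height K (h p) (h p') u = height K p p' w - height K p p' u"
      using height[OF e, of K p p'] height[OF e, of K "h p" "h p'"] crossing_orbit(2)[OF K(1) h] by simp
  qed
  then show ?thesis by (simp add: crossings_def)
qed

text \<open>Transport of structure by an automorphism that normalises \<open>K\<close>.\<close>

lemma crossings_conj:
  assumes K: "perm_group K" "K \<subseteq> colour_group" and y: "aut y"
    and norm: "\<And>k. k \<in> K \<Longrightarrow> pinv y \<circ> k \<circ> y \<in> K" "\<And>k. k \<in> K \<Longrightarrow> y \<circ> k \<circ> pinv y \<in> K"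
    and k: "k \<in> K"
  shows "crossings K (pinv y p) (pinv y p') (pinv y \<circ> k \<circ> y) = crossings K p p' k"
proof -
  have bij: "bij y" using y by (simp add: aut_iff)
  have 1: "(\<exists>k\<in>K. pinv y a = k (pinv y p) \<and> pinv y b = k (pinv y p')) \<longleftrightarrow> (\<exists>k\<in>K. a = k p \<and> b = k p')"
    for a b p p'
  proof
    assume "\<exists>k\<in>K. pinv y a = k (pinv y p) \<and> pinv y b = k (pinv y p')"
    then obtain k where k: "k \<in> K" "pinv y a = k (pinv y p)" "pinv y b = k (pinv y p')" by blast
    have "a = (y \<circ> k \<circ> pinv y) p" "b = (y \<circ> k \<circ> pinv y) p'"
      using bij by (simp_all add: pinv_simps flip: k(2,3))
    then show "\<exists>k\<in>K. a = k p \<and> b = k p'" using norm(2)[OF k(1)] by blast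
  next
    assume "\<exists>k\<in>K. a = k p \<and> b = k p'"
    then obtain k where k: "k \<in> K" "a = k p" "b = k p'" by blast
    have "pinv y a = (pinv y \<circ> k \<circ> y) (pinv y p)" "pinv y b = (pinv y \<circ> k \<circ> y) (pinv y p')"
      using bij by (simp_all add: pinv_simps k(2,3))
    then show "\<exists>k\<in>K. pinv y a = k (pinv y p) \<and> pinv y b = k (pinv y p')" using norm(1)[OF k(1)] by blast
  qed
  let ?f = "height K (pinv y p) (pinv y p')"
  have "?f (pinv y (k v)) - height K p p' (k v) = ?f (pinv y v) - height K p p' v" for v
  proof (rule constant_if_gradients_equal)
    fix u w assume e: "{u, w} \<in> E"
    have "{pinv y u, pinv y w} \<in> E" using aut_pinv[OF y] e by (simp add: aut_iff)
    from height[OF this, of K "pinv y p" "pinv y p'"] height[OF e, of K p p']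
    show "?f (pinv y w) - ?f (pinv y u) = height K p p' w - height K p p' u"
      by (simp add: crossing_def 1)
  qed
  from this[of "y undefined"]
  have "?f ((pinv y \<circ> k \<circ> y) undefined) - ?f undefined = height K p p' (k (y undefined)) - height K p p' (y undefined)"
    using bij by (simp add: pinv_simps)
  then show ?thesis using crossings[OF K k, of p p' "y undefined"] by (simp add: crossings_def)
qed

text \<open>The translation along the line that contains \<open>u\<close> and has colours \<open>i\<close> and \<open>j\<close>.\<close>

definition translation :: "'a \<Rightarrow> nat \<Rightarrow> nat \<Rightarrow> 'a \<Rightarrow> 'a" where
  "translation u i j = (SOME g. g \<in> colour_group \<and> g u = nb (nb u i) j)"

lemma translation:
  "translation u i j \<in> colour_group" "translation u i j u = nb (nb u i) j"
proof -
  obtain g where "g \<in> colour_group" "g u = nb (nb u i) j" by (rule colour_group_transitive)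
  then have "g \<in> colour_group \<and> g u = nb (nb u i) j" by blast
  then have "translation u i j \<in> colour_group \<and> translation u i j u = nb (nb u i) j"
    unfolding translation_def by (rule someI[of "\<lambda>g. g \<in> colour_group \<and> g u = nb (nb u i) j"])
  then show "translation u i j \<in> colour_group" "translation u i j u = nb (nb u i) j" by auto
qed

lemma translation_funpow:
  assumes "i \<in> {1..d}" "j \<in> {1..d}"
  shows "(translation u i j ^^ Suc a) u = nb (nb ((translation u i j ^^ a) u) i) j"
proof -
  have t: "translation u i j ^^ a \<in> colour_group"
    by (rule perm_group_funpow[OF perm_group_colour_group translation(1)])
  have "(translation u i j ^^ Suc a) u = (translation u i j ^^ a) (translation u i j u)"
    by (simp add: funpow_swap1)
  also have "\<dots> = nb (nb ((translation u i j ^^ a) u) i) j"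
    by (simp add: translation(2) colour_group_nb[OF t assms(1)] colour_group_nb[OF t assms(2)])
  finally show ?thesis .
qed

lemma parity_translation:
  assumes "i \<in> {1..d}" "j \<in> {1..d}"
  shows "parity ((translation u i j ^^ a) u) = parity u"
proof (induction a)
  case (Suc a)
  then show ?case
    unfolding translation_funpow[OF assms] parity[OF nb(1)[OF assms(2)]] parity[OF nb(1)[OF assms(1)]]
    by simp
qed simp

lemma crossing_colour:
  assumes K: "K \<subseteq> colour_group" and e: "{p, p'} \<in> E" and ab: "{a, b} \<in> E"
  shows "c {a, b} \<noteq> c {p, p'} \<Longrightarrow> crossing K p p' a b = 0"
    and "c {a, b} = c {p, p'} \<Longrightarrow>
      crossing K p p' a b = of_bool (\<exists>k\<in>K. a = k p) - of_bool (\<exists>k\<in>K. a = k p')"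
proof -
  have col: "{k p, k p'} \<in> E" "c {k p, k p'} = c {p, p'}" if "k \<in> K" for k
    using subsetD[OF K that] e by (simp_all add: colour_group_def aut_iff)
  show "crossing K p p' a b = 0" if "c {a, b} \<noteq> c {p, p'}"
  proof -
    have "\<not> (\<exists>k\<in>K. a = k p \<and> b = k p')" using col(2) that by metis
    moreover have "\<not> (\<exists>k\<in>K. b = k p \<and> a = k p')" using col(2) that by (metis insert_commute)
    ultimately show ?thesis by (auto simp: crossing_def)
  qed
  show "crossing K p p' a b = of_bool (\<exists>k\<in>K. a = k p) - of_bool (\<exists>k\<in>K. a = k p')"
    if eq: "c {a, b} = c {p, p'}"
  proof -
    have "b = k p'" if "k \<in> K" "a = k p" for k
      using colour_inj[of a b "k p'"] col[OF that(1)] ab eq that(2) by simp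
    then have 1: "(\<exists>k\<in>K. a = k p \<and> b = k p') \<longleftrightarrow> (\<exists>k\<in>K. a = k p)" by blast
    have "b = k p" if "k \<in> K" "a = k p'" for k
      using colour_inj[of a b "k p"] col[OF that(1)] ab eq that(2) by (simp add: insert_commute)
    then have 2: "(\<exists>k\<in>K. b = k p \<and> a = k p') \<longleftrightarrow> (\<exists>k\<in>K. a = k p')" by blast
    show ?thesis by (simp only: crossing_def 1 2)
  qed
qed

text \<open>The edges of colour \<open>i\<close> of the line are all traversed in the direction away from the vertices
  \<open>x a\<close>.  Hence an edge of this colour is crossed in the positive or negative direction according
  to which of its ends lies in the orbit of \<open>x a\<close>.\<close>

lemma height_translation:
  fixes u :: 'a
  assumes K: "K \<subseteq> colour_group" and e: "{p, p'} \<in> E" and ij: "i \<in> {1..d}" "j \<in> {1..d}" "i \<noteq> j"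
  defines "x \<equiv> \<lambda>a. (translation u i j ^^ a) u"
  shows "c {p, p'} \<notin> {i, j} \<Longrightarrow> height K p p' (x M) - height K p p' u = 0"
    and "c {p, p'} = i \<Longrightarrow> height K p p' (x M) - height K p p' u =
      (\<Sum>a<M. of_bool (\<exists>k\<in>K. x a = k p)) - (\<Sum>a<M. of_bool (\<exists>k\<in>K. x a = k p'))"
proof -
  have step: "height K p p' (x (Suc a)) = height K p p' (x a) +
      (crossing K p p' (x a) (nb (x a) i) + crossing K p p' (nb (x a) i) (x (Suc a)))" for a
    using height[OF nb(1)[OF ij(1), of "x a"], of K p p'] height[OF nb(1)[OF ij(2), of "nb (x a) i"], of K p p']
    unfolding x_def translation_funpow[OF ij(1,2)] by simp
  have edge: "{x a, nb (x a) i} \<in> E" "c {x a, nb (x a) i} = i"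
    "{nb (x a) i, x (Suc a)} \<in> E" "c {nb (x a) i, x (Suc a)} = j" for a
    using nb[OF ij(1), of "x a"] nb[OF ij(2), of "nb (x a) i"]
    unfolding x_def translation_funpow[OF ij(1,2)] by simp_all
  have x0: "x 0 = u" by (simp add: x_def)
  show "height K p p' (x M) - height K p p' u = 0" if "c {p, p'} \<notin> {i, j}"
  proof (induction M)
    case (Suc M)
    have "crossing K p p' (x M) (nb (x M) i) = 0" "crossing K p p' (nb (x M) i) (x (Suc M)) = 0"
      by (rule crossing_colour(1)[OF K e]; use edge that in simp)+
    then show ?case using step[of M] Suc by simp
  qed (simp add: x0)
  show "height K p p' (x M) - height K p p' u =
      (\<Sum>a<M. of_bool (\<exists>k\<in>K. x a = k p)) - (\<Sum>a<M. of_bool (\<exists>k\<in>K. x a = k p'))" if "c {p, p'} = i"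
  proof (induction M)
    case (Suc M)
    have "crossing K p p' (nb (x M) i) (x (Suc M)) = 0"
      by (rule crossing_colour(1)[OF K e]; use edge that ij in simp)
    moreover have "crossing K p p' (x M) (nb (x M) i) =
        of_bool (\<exists>k\<in>K. x M = k p) - of_bool (\<exists>k\<in>K. x M = k p')"
      by (rule crossing_colour(2)[OF K e]; use edge that in simp)
    ultimately show ?case using step[of M] Suc by simp
  qed (simp add: x0)
qed

text \<open>If \<open>M\<close> is the period of the line modulo \<open>K\<close>, then the vertices of one period lie in
  different orbits, so that an orbit is met at most once.\<close>

lemma crossings_translation:
  fixes u :: 'a
  assumes K: "perm_group K" "K \<subseteq> colour_group" and e: "{p, p'} \<in> E"
    and ij: "i \<in> {1..d}" "j \<in> {1..d}" "i \<noteq> j"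
    and M: "translation u i j ^^ M \<in> K" "\<forall>a. 0 < a \<longrightarrow> a < M \<longrightarrow> translation u i j ^^ a \<notin> K"
  defines "x \<equiv> \<lambda>a. (translation u i j ^^ a) u"
  shows "c {p, p'} \<notin> {i, j} \<Longrightarrow> crossings K p p' (translation u i j ^^ M) = 0"
    and "c {p, p'} = i \<Longrightarrow> crossings K p p' (translation u i j ^^ M) =
      of_bool (\<exists>a<M. \<exists>k\<in>K. x a = k p) - of_bool (\<exists>a<M. \<exists>k\<in>K. x a = k p')"
proof -
  let ?t = "translation u i j"
  have cr: "crossings K p p' (?t ^^ M) = height K p p' (x M) - height K p p' u"
    unfolding x_def by (rule crossings[OF K M(1)])
  show "c {p, p'} \<notin> {i, j} \<Longrightarrow> crossings K p p' (?t ^^ M) = 0"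
    using height_translation(1)[OF K(2) e ij, where u = u and M = M] by (simp add: cr x_def)
  have uniq: "a = b" if "a \<le> b" "b < M" "k \<in> K" "x a = k q" "h \<in> K" "x b = h q" for a b k h q
  proof (rule ccontr)
    assume "a \<noteq> b"
    have hk: "h \<circ> pinv k \<in> K" by (rule perm_groupD(4)[OF K(1) that(5) perm_groupD(3)[OF K(1) that(3)]])
    have "(h \<circ> pinv k) (x a) = x b"
      using that perm_groupD(2)[OF K(1) that(3)] by (simp add: pinv_simps)
    moreover have "(?t ^^ (b - a)) (x a) = x b"
      using that(1) funpow_add[of "b - a" a ?t] by (simp add: x_def)
    moreover have "?t ^^ (b - a) \<in> colour_group"
      by (rule perm_group_funpow[OF perm_group_colour_group translation(1)])
    ultimately have "?t ^^ (b - a) = h \<circ> pinv k"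
      using colour_group_eqI[of "?t ^^ (b - a)" "h \<circ> pinv k" "x a"] subsetD[OF K(2) hk] by simp
    then show False
      using M(2)[rule_format, of "b - a"] hk that(1,2) \<open>a \<noteq> b\<close> less_imp_diff_less[of b M a] by simp
  qed
  have count: "(\<Sum>a<M. of_bool (\<exists>k\<in>K. x a = k q)) = (of_bool (\<exists>a<M. \<exists>k\<in>K. x a = k q) :: int)" for q
  proof (cases "\<exists>a<M. \<exists>k\<in>K. x a = k q")
    case True
    then obtain a k where a: "a < M" "k \<in> K" "x a = k q" by blast
    have "(\<exists>k\<in>K. x b = k q) \<longleftrightarrow> b = a" if b: "b < M" for b
    proof
      assume "\<exists>k\<in>K. x b = k q"
      then obtain h where h: "h \<in> K" "x b = h q" by blast
      show "b = a"
        using uniq[OF _ b a(2,3) h] uniq[OF _ a(1) h a(2,3)] by (cases "a \<le> b") auto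
    qed (use a in blast)
    then have "(\<Sum>b<M. of_bool (\<exists>k\<in>K. x b = k q)) = (\<Sum>b<M. (of_bool (b = a) :: int))"
      by (intro sum.cong) auto
    also have "\<dots> = 1" using a(1) by (simp add: of_bool_def sum.delta)
    finally show ?thesis using True by simp
  next
    case False
    then show ?thesis by simp
  qed
  show "c {p, p'} = i \<Longrightarrow> crossings K p p' (?t ^^ M) =
      of_bool (\<exists>a<M. \<exists>k\<in>K. x a = k p) - of_bool (\<exists>a<M. \<exists>k\<in>K. x a = k p')"
    using height_translation(2)[OF K(2) e ij, where u = u and M = M] count unfolding cr x_def by simp
qed

text \<open>The number of edges of colour \<open>j\<close> on a path, counted with a sign that depends on the
  orientation with respect to the bipartition, is additive and invariant under the even elements of
  the colour group.  It changes by the same amount in every period of a line with colours \<open>i\<close> and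
  \<open>j\<close>, and its values at the two ends of a period of a line with colours \<open>i\<close> and \<open>k\<close> agree.\<close>

definition signed_colour :: "nat \<Rightarrow> 'a \<Rightarrow> 'a \<Rightarrow> int" where
  "signed_colour j a b = (if c {a, b} = j then (if parity a then 1 else - 1) else 0)"

definition colour_count :: "nat \<Rightarrow> 'a \<Rightarrow> int" where
  "colour_count j = (SOME f. \<forall>a b. {a, b} \<in> E \<longrightarrow> f b = f a + signed_colour j a b)"

lemma colour_count:
  assumes "{a, b} \<in> E" shows "colour_count j b = colour_count j a + signed_colour j a b"
proof -
  have "signed_colour j b a = - signed_colour j a b" if "{a, b} \<in> E" for a b
    using parity[OF that] by (simp add: signed_colour_def insert_commute)
  then obtain f where "\<And>a b. {a, b} \<in> E \<Longrightarrow> f b = f a + signed_colour j a b"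
    by (rule potential[of "signed_colour j"]) blast+
  then have "\<forall>a b. {a, b} \<in> E \<longrightarrow> f b = f a + signed_colour j a b" by blast
  then have "\<forall>a b. {a, b} \<in> E \<longrightarrow> colour_count j b = colour_count j a + signed_colour j a b"
    unfolding colour_count_def
    by (rule someI[of "\<lambda>f. \<forall>a b. {a, b} \<in> E \<longrightarrow> f b = f a + signed_colour j a b"])
  then show ?thesis using assms by blast
qed

lemma colour_count_even:
  assumes "k \<in> colour_group" "k \<in> even_group"
  shows "colour_count j (k v) - colour_count j v = colour_count j (k w) - colour_count j w"
proof (rule constant_if_gradients_equal)
  fix u w assume e: "{u, w} \<in> E"
  have "{k u, k w} \<in> E" "c {k u, k w} = c {u, w}"
    using assms(1) e by (simp_all add: colour_group_def aut_iff)
  moreover have "parity (k u) = parity u" using assms(2) by (simp add: even_group_def)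
  ultimately show "colour_count j (k w) - colour_count j (k u) = colour_count j w - colour_count j u"
    using colour_count[OF e, of j] colour_count[of "k u" "k w" j] by (simp add: signed_colour_def)
qed

lemma colour_count_translation:
  assumes ij: "i \<in> {1..d}" "j \<in> {1..d}" "i \<noteq> l"
  shows "colour_count l ((translation u i j ^^ a) u) =
    colour_count l u + (if j = l then (if parity u then - int a else int a) else 0)"
proof (induction a)
  case (Suc a)
  let ?x = "(translation u i j ^^ a) u"
  have "parity (nb ?x i) = (\<not> parity u)"
    using parity[OF nb(1)[OF ij(1), of ?x]] parity_translation[OF ij(1,2)] by simp
  then show ?case
    using colour_count[OF nb(1)[OF ij(1), of ?x], of l] colour_count[OF nb(1)[OF ij(2), of "nb ?x i"], of l]
      nb(2)[OF ij(1)] nb(2)[OF ij(2)] Suc ij(3)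
    unfolding translation_funpow[OF ij(1,2)]
    by (cases "j = l"; cases "parity u") (simp_all add: signed_colour_def)
qed simp

text \<open>Through an edge of colour \<open>i\<close> there are two lines whose only common colour is \<open>i\<close>.  Within one
  period, the translation along each of them crosses the orbit of the edge exactly once.  The image of
  the edge has the same crossing numbers modulo \<open>P\<close>, so it lies in the orbit of an edge of the first
  line and also in the orbit of an edge of the second line.  Comparing the counts of a second colour of
  the first line shows that it lies in the \<open>K2\<close>-orbit of the edge itself.  Since the colour group acts
  freely on the vertices, the element of \<open>K2\<close> does not depend on the edge.\<close>

lemma preserves_crossings:
  assumes d: "3 \<le> d" and P: "3 \<le> P"
    and K2: "perm_group K2" "K2 \<subseteq> colour_group"
    and n: "\<And>g. g \<in> colour_group \<Longrightarrow> g ^^ n \<in> K2"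
    and K0: "perm_group K0" "K0 \<subseteq> K2" "K0 \<subseteq> even_group"
    and count: "\<And>k j v. k \<in> K0 \<Longrightarrow> j \<in> {1..d} \<Longrightarrow> int n dvd colour_count j (k v) - colour_count j v"
    and power: "\<And>g. g \<in> colour_group \<Longrightarrow> \<exists>M>0. g ^^ M \<in> K0"
    and y: "aut y"
    and cross: "\<And>u w k. {u, w} \<in> E \<Longrightarrow> k \<in> K0 \<Longrightarrow>
      P dvd crossings K0 (y u) (y w) k - crossings K0 u w k"
  shows "y \<in> K2"
proof -
  have K0c: "K0 \<subseteq> colour_group" using K0(2) K2(2) by blast
  have edge: "\<exists>\<kappa>\<in>K2. y u = \<kappa> u \<and> y (nb u i) = \<kappa> (nb u i)" if i: "i \<in> {1..d}" for u i
  proof -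
    let ?p = "y u" and ?p' = "y (nb u i)"
    have e: "{u, nb u i} \<in> E" "c {u, nb u i} = i" using nb[OF i] by auto
    have pe: "{?p, ?p'} \<in> E" using y e(1) by (simp add: aut_iff)
    \<comment> \<open>The line with colours \<open>i\<close> and \<open>j\<close> through the edge crosses its orbit once per period.\<close>
    have line: "c {?p, ?p'} \<in> {i, j} \<and> (c {?p, ?p'} = i \<longrightarrow> (\<exists>a. \<exists>k\<in>K0. (translation u i j ^^ a) u = k ?p))"
      if j: "j \<in> {1..d}" "i \<noteq> j" for j
    proof -
      let ?t = "translation u i j"
      define M where "M = (LEAST M. 0 < M \<and> ?t ^^ M \<in> K0)"
      have "\<exists>M. 0 < M \<and> ?t ^^ M \<in> K0" using power[OF translation(1)] by blast
      then have M: "0 < M \<and> ?t ^^ M \<in> K0" unfolding M_def by (rule LeastI_ex)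
      have Mmin: "\<forall>a. 0 < a \<longrightarrow> a < M \<longrightarrow> ?t ^^ a \<notin> K0"
      proof (intro allI impI)
        fix a assume "0 < a" "a < M"
        then show "?t ^^ a \<notin> K0"
          using not_less_Least[of a "\<lambda>M. 0 < M \<and> ?t ^^ M \<in> K0"] unfolding M_def by blast
      qed
      note ct = crossings_translation[OF K0(1) K0c _ i j M[THEN conjunct2] Mmin]
      have "\<exists>a<M. \<exists>k\<in>K0. (?t ^^ a) u = k u"
        using M perm_groupD(1)[OF K0(1)] by (intro exI[of _ 0] conjI bexI[of _ id]) auto
      moreover have "\<not> (\<exists>a<M. \<exists>k\<in>K0. (?t ^^ a) u = k (nb u i))"
      proof
        assume "\<exists>a<M. \<exists>k\<in>K0. (?t ^^ a) u = k (nb u i)"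
        then obtain a k where k: "k \<in> K0" "(?t ^^ a) u = k (nb u i)" by blast
        have "parity u = parity ((?t ^^ a) u)" by (rule parity_translation[OF i j(1), symmetric])
        also have "\<dots> = parity (nb u i)" using k K0(3) by (auto simp: even_group_def)
        finally show False using parity[OF e(1)] by simp
      qed
      ultimately have "crossings K0 u (nb u i) (?t ^^ M) = 1"
        using ct(2)[OF e] by simp
      then have dvd: "P dvd crossings K0 ?p ?p' (?t ^^ M) - 1"
        using cross[OF e(1) M[THEN conjunct2]] by simp
      have not_dvd: "\<not> P dvd - 1" "\<not> P dvd - 2"
        using zdvd_imp_le[of P 1] zdvd_imp_le[of P 2] P by auto
      show ?thesis
      proof (intro conjI impI)
        show "c {?p, ?p'} \<in> {i, j}"
        proof (rule ccontr)
          assume "c {?p, ?p'} \<notin> {i, j}"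
          from ct(1)[OF pe this] show False using dvd not_dvd by simp
        qed
        assume ci: "c {?p, ?p'} = i"
        have "\<exists>a<M. \<exists>k\<in>K0. (?t ^^ a) u = k ?p"
          using ct(2)[OF pe ci] dvd not_dvd by (auto simp: of_bool_def split: if_splits)
        then show "\<exists>a. \<exists>k\<in>K0. (?t ^^ a) u = k ?p" by blast
      qed
    qed
    obtain j k where jk: "j \<in> {1..d}" "k \<in> {1..d}" "i \<noteq> j" "i \<noteq> k" "j \<noteq> k"
    proof -
      consider "i = 1" | "i = 2" | "i \<noteq> 1" "i \<noteq> 2" by blast
      then show thesis
        by cases (use that[of 2 3] that[of 1 3] that[of 1 2] d in auto)
    qed
    have ci: "c {?p, ?p'} = i" using line[OF jk(1,3)] line[OF jk(2,4)] jk(5) by auto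
    obtain a \<kappa> where a: "\<kappa> \<in> K0" "(translation u i j ^^ a) u = \<kappa> ?p"
      using line[OF jk(1,3)] ci by blast
    obtain b \<kappa>' where b: "\<kappa>' \<in> K0" "(translation u i k ^^ b) u = \<kappa>' ?p"
      using line[OF jk(2,4)] ci by blast
    \<comment> \<open>The count of the colour \<open>j\<close> determines the position on the first line and does not change
      along the second line.\<close>
    have ca: "colour_count j (\<kappa> ?p) = colour_count j u + (if parity u then - int a else int a)"
      using colour_count_translation[OF i jk(1,3), where u = u and a = a] unfolding a(2) by simp
    have cb: "colour_count j (\<kappa>' ?p) = colour_count j u"
      using colour_count_translation[OF i jk(2,3), where u = u and a = b] jk(5) unfolding b(2) by simp
    have "int n dvd (colour_count j (\<kappa> ?p) - colour_count j ?p) - (colour_count j (\<kappa>' ?p) - colour_count j ?p)"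
      by (rule dvd_diff[OF count[OF a(1) jk(1)] count[OF b(1) jk(1)]])
    then have "int n dvd int a" unfolding ca cb by (simp split: if_splits)
    then have "n dvd a" by (simp only: int_dvd_int_iff)
    then obtain q where q: "a = n * q" by (rule dvdE)
    have "translation u i j ^^ a \<in> K2"
      unfolding q funpow_mult[symmetric] by (rule perm_group_funpow[OF K2(1) n[OF translation(1)]])
    moreover have "pinv \<kappa> \<in> K2" using perm_groupD(3)[OF K0(1) a(1)] K0(2) by blast
    ultimately have \<mu>: "pinv \<kappa> \<circ> (translation u i j ^^ a) \<in> K2" (is "?\<mu> \<in> K2")
      by (intro perm_groupD(4)[OF K2(1)])
    have p: "?p = ?\<mu> u" using a(2) perm_groupD(2)[OF K0(1) a(1)] by (simp add: pinv_simps)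
    moreover have "?p' = ?\<mu> (nb u i)"
      using colour_group_nb[OF subsetD[OF K2(2) \<mu>] i, of u] nb_eqI[OF pe ci] p by simp
    ultimately show ?thesis using \<mu> by blast
  qed
  have 1: "1 \<in> {1..d}" using d by simp
  obtain \<kappa> where \<kappa>: "\<kappa> \<in> K2" "y undefined = \<kappa> undefined" using edge[OF 1] by blast
  have "y v = \<kappa> v" for v
  proof (induction v rule: tree_induct[where r = undefined])
    case (step u v)
    have "nb u (c {u, v}) = v" by (rule nb_eqI[OF step(1) refl])
    then obtain \<mu> where \<mu>: "\<mu> \<in> K2" "y u = \<mu> u" "y v = \<mu> v"
      using edge[OF colour_range[OF step(1)], of u] by auto
    have "\<mu> = \<kappa>" using colour_group_eqI[of \<mu> \<kappa> u] \<mu> \<kappa> step K2(2) by auto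
    then show ?case using \<mu> by simp
  qed (rule \<kappa>(2))
  then have "y = \<kappa>" by (rule ext)
  then show ?thesis using \<kappa> by simp
qed

end

section \<open>The congruence subgroup property\<close>

lemma perm_group_INT_conj_by:
  assumes "perm_group \<Gamma>" "\<And>g. g \<in> S \<Longrightarrow> bij g"
  shows "perm_group (\<Gamma> \<inter> (\<Inter>g\<in>S. conj_by g \<Gamma>))"
proof -
  have "perm_group (conj_by g \<Gamma>)" if "g \<in> S" for g
    by (rule perm_group_conj_by[OF assms(2)[OF that] assms(1)])
  from perm_groupD[OF this] perm_groupD[OF assms(1)] show ?thesis
    by (simp add: perm_group_def)
qed

lemma conj_funpow:
  fixes g x :: "'a \<Rightarrow> 'a"
  assumes "bij g" shows "(pinv g \<circ> x \<circ> g) ^^ n = pinv g \<circ> x ^^ n \<circ> g"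
proof (induction n)
  case (Suc n)
  show ?case unfolding funpow.simps(2) Suc by (simp add: fun_eq_iff pinv_simps(2)[OF assms])
qed (use assms in \<open>simp add: pinv_simps\<close>)

context coloured_tree
begin

text \<open>The colour counts are homomorphisms on \<open>K\<close>, whose reductions modulo \<open>n\<close> have finite image.\<close>

lemma count_subgroup:
  assumes K: "perm_group K" "K \<subseteq> colour_group" "K \<subseteq> even_group" and n: "n > 0"
  defines "K1 \<equiv> {k \<in> K. \<forall>j\<in>{1..d}. int n dvd colour_count j (k undefined) - colour_count j undefined}"
  shows "perm_group K1" "fin_index K1 K"
    "\<And>k j v. k \<in> K1 \<Longrightarrow> j \<in> {1..d} \<Longrightarrow> int n dvd colour_count j (k v) - colour_count j v"
proof -
  define \<chi> where "\<chi> j k = colour_count j (k undefined) - colour_count j undefined" for j and k :: "'a \<Rightarrow> 'a"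
  have \<chi>: "colour_count j (k v) - colour_count j v = \<chi> j k" if "k \<in> K" for j k v
    unfolding \<chi>_def by (rule colour_count_even) (use that K in auto)
  have K1: "K1 = {k \<in> K. \<forall>j\<in>{1..d}. int n dvd \<chi> j k}" by (simp add: K1_def \<chi>_def)
  have comp: "\<chi> j (h \<circ> k) = \<chi> j h + \<chi> j k" if "h \<in> K" "k \<in> K" for j h k
    using \<chi>[OF that(1), of j "k undefined"] by (simp add: \<chi>_def)
  have inv: "\<chi> j (pinv k) = - \<chi> j k" if "k \<in> K" for j k
    using comp[OF perm_groupD(3)[OF K(1) that] that, of j] perm_groupD(2)[OF K(1) that]
    by (simp add: pinv_simps) (simp add: \<chi>_def)
  show "int n dvd colour_count j (k v) - colour_count j v" if "k \<in> K1" "j \<in> {1..d}" for k j v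
    using that \<chi>[of k j v] by (simp add: K1)
  show pg: "perm_group K1"
    unfolding perm_group_def
  proof (intro conjI ballI)
    show "id \<in> K1" using perm_groupD(1)[OF K(1)] by (simp add: K1_def)
  next
    fix g assume g: "g \<in> K1"
    then have gK: "g \<in> K" by (simp add: K1)
    show "bij g" by (rule perm_groupD(2)[OF K(1) gK])
    show "pinv g \<in> K1" using g inv[OF gK] perm_groupD(3)[OF K(1) gK] by (simp add: K1)
  next
    fix g h assume gh: "g \<in> K1" "h \<in> K1"
    then have "g \<in> K" "h \<in> K" by (simp_all add: K1)
    then show "g \<circ> h \<in> K1" using gh comp[of g h] perm_groupD(4)[OF K(1), of g h] by (simp add: K1)
  qed
  show "fin_index K1 K"
  proof (rule fin_indexI[OF pg K(1), where \<Phi> = "\<lambda>k. \<lambda>j\<in>{1..d}. \<chi> j k mod int n"])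
    have "(\<lambda>k. \<lambda>j\<in>{1..d}. \<chi> j k mod int n) ` K \<subseteq> {1..d} \<rightarrow>\<^sub>E {0..<int n}"
      using n by auto
    then show "finite ((\<lambda>k. \<lambda>j\<in>{1..d}. \<chi> j k mod int n) ` K)"
      by (rule finite_subset) (simp add: finite_PiE)
    fix a b assume a: "a \<in> K" and b: "b \<in> K"
      and eq: "(\<lambda>j\<in>{1..d}. \<chi> j a mod int n) = (\<lambda>j\<in>{1..d}. \<chi> j b mod int n)"
    have "int n dvd \<chi> j (a \<circ> pinv b)" if "j \<in> {1..d}" for j
    proof -
      have "\<chi> j a mod int n = \<chi> j b mod int n" using fun_cong[OF eq, of j] that by simp
      then have "int n dvd \<chi> j a - \<chi> j b" by (simp add: mod_eq_dvd_iff)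
      then show ?thesis
        unfolding comp[OF a perm_groupD(3)[OF K(1) b]] inv[OF b] by simp
    qed
    then show "a \<circ> pinv b \<in> K1"
      using perm_groupD(4)[OF K(1) a perm_groupD(3)[OF K(1) b]] by (simp only: K1 mem_Collect_eq) blast
  qed
qed

text \<open>If no element of \<open>K\<close> inverts an edge, this is the kernel of the map from \<open>K\<close> to the first homology
  of the graph \<open>K\T\<close> with coefficients modulo \<open>P\<close>.\<close>

definition crossing_subgroup :: "('a \<Rightarrow> 'a) set \<Rightarrow> int \<Rightarrow> ('a \<Rightarrow> 'a) set" where
  "crossing_subgroup K P = {k \<in> K. \<forall>u w. {u, w} \<in> E \<longrightarrow> P dvd crossings K u w k}"

lemma crossing_subgroup:
  assumes K: "perm_group K" "K \<subseteq> colour_group" "fin_orbits K" and P: "P > 0"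
  shows "perm_group (crossing_subgroup K P)" "fin_index (crossing_subgroup K P) K"
proof -
  let ?N = "crossing_subgroup K P"
  show pg: "perm_group ?N"
    unfolding perm_group_def
  proof (intro conjI ballI)
    show "id \<in> ?N" using perm_groupD(1)[OF K(1)] by (simp add: crossing_subgroup_def crossings_id)
  next
    fix g assume g: "g \<in> ?N"
    then have gK: "g \<in> K" by (simp add: crossing_subgroup_def)
    show "bij g" by (rule perm_groupD(2)[OF K(1) gK])
    show "pinv g \<in> ?N"
      using g perm_groupD(3)[OF K(1) gK] crossings_pinv[OF K(1,2) gK] by (simp add: crossing_subgroup_def)
  next
    fix g h assume gh: "g \<in> ?N" "h \<in> ?N"
    then have "g \<in> K" "h \<in> K" by (simp_all add: crossing_subgroup_def)
    then show "g \<circ> h \<in> ?N"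
      using gh crossings_comp[OF K(1,2), of g h] perm_groupD(4)[OF K(1), of g h]
      by (simp add: crossing_subgroup_def)
  qed
  obtain R where R: "finite R" "\<And>v. \<exists>h\<in>K. \<exists>r\<in>R. v = h r" by (rule fin_orbitsE[OF K(3)]) (rule that)
  let ?I = "R \<times> {1..d}"
  define \<Phi> where "\<Phi> k = (\<lambda>(r, i)\<in>?I. crossings K r (nb r i) k mod P)" for k
  show "fin_index ?N K"
  proof (rule fin_indexI[OF pg K(1), where \<Phi> = \<Phi>])
    have "\<Phi> ` K \<subseteq> ?I \<rightarrow>\<^sub>E {0..<P}" using P by (auto simp: \<Phi>_def PiE_iff extensional_def split: if_splits)
    then show "finite (\<Phi> ` K)" by (rule finite_subset) (simp add: finite_PiE R(1))
    fix a b assume a: "a \<in> K" and b: "b \<in> K" and eq: "\<Phi> a = \<Phi> b"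
    have ab: "a \<circ> pinv b \<in> K" by (rule perm_groupD(4)[OF K(1) a perm_groupD(3)[OF K(1) b]])
    have "P dvd crossings K u w (a \<circ> pinv b)" if e: "{u, w} \<in> E" for u w
    proof -
      let ?i = "c {u, w}"
      obtain h r where hr: "h \<in> K" "r \<in> R" "u = h r" using R(2)[of u] by blast
      have i: "?i \<in> {1..d}" by (rule colour_range[OF e])
      have "h (nb r ?i) = nb (h r) ?i" by (rule colour_group_nb[OF subsetD[OF K(2) hr(1)] i])
      also have "\<dots> = w" unfolding hr(3)[symmetric] by (rule nb_eqI[OF e refl])
      finally have w: "w = h (nb r ?i)" by simp
      have 1: "crossings K u w k = crossings K r (nb r ?i) k" if "k \<in> K" for k
        using crossings_orbit[OF K(1,2) hr(1) that, of r "nb r ?i"] by (simp flip: hr(3) w)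
      have "\<Phi> a (r, ?i) = \<Phi> b (r, ?i)" by (simp only: eq)
      then have "crossings K u w a mod P = crossings K u w b mod P"
        unfolding 1[OF a] 1[OF b] \<Phi>_def using hr(2) i by simp
      then have "P dvd crossings K u w a - crossings K u w b" by (simp add: mod_eq_dvd_iff)
      then show ?thesis
        unfolding crossings_comp[OF K(1,2) a perm_groupD(3)[OF K(1) b]] crossings_pinv[OF K(1,2) b] by simp
    qed
    then show "a \<circ> pinv b \<in> ?N" using ab by (simp only: crossing_subgroup_def mem_Collect_eq) blast
  qed
qed

text \<open>The elements that are used for the colour group also serve for \<open>\<Gamma>\<close>.  If an element \<open>x\<close> of \<open>\<Gamma>\<close> and its
  conjugates by these elements all lie in \<open>\<Gamma>\<close>, then a fixed power of \<open>x\<close> and of its conjugates lies in the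
  colour group, so that at first only a fixed power \<open>x ^^ m\<close> is known to be small.  The remedy is to let
  small mean trivial in the homology of \<open>K0\T\<close> modulo an integer \<open>P\<close> that is prime to \<open>m\<close>:
  then an element of \<open>K0\<close> is small as soon as its power is.  The congruence subgroup \<open>N\<close> is normal
  in \<open>\<Gamma>\<close>, so that the commutators of its elements with \<open>K0\<close> lie in both \<open>N\<close> and \<open>K0\<close> and are small.
  This means that the elements of \<open>N\<close> act trivially on the homology, and \<open>preserves_crossings\<close>
  places them in \<open>K2\<close>, a subgroup of \<open>H\<close>.\<close>

lemma congruence_subgroup_in:
  assumes d: "3 \<le> d" and F: "subgroup F (sym_group d)" and nf: "\<not> acts_freely F {1..d}"
    and \<Gamma>: "perm_group \<Gamma>" "\<Gamma> \<subseteq> univ_group F" "fin_orbits \<Gamma>"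
    and K: "fin_index (\<Gamma> \<inter> colour_group) \<Gamma>"
    and H: "perm_group H" "H \<subseteq> \<Gamma>" "fin_index H \<Gamma>"
  obtains S where "finite S" "S \<subseteq> univ_group F"
    "\<And>g. g \<in> S \<Longrightarrow> fin_orbits (\<Gamma> \<inter> conj_by g \<Gamma>)"
    "core \<Gamma> (\<Gamma> \<inter> (\<Inter>g\<in>S. conj_by g \<Gamma>)) \<subseteq> H"
proof -
  note CG = perm_group_colour_group
  let ?K = "\<Gamma> \<inter> colour_group"
  have pK: "perm_group ?K" by (rule perm_group_Int[OF \<Gamma>(1) CG])
  have oK: "fin_orbits ?K" by (rule fin_orbits_fin_index[OF pK \<Gamma>(1) K \<Gamma>(3)])
  have aut\<Gamma>: "aut g" if "g \<in> \<Gamma>" for g using that \<Gamma>(2) by (auto simp: univ_group_iff[OF F])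
  define K2 where "K2 = (H \<inter> ?K) \<inter> (\<Gamma> \<inter> even_group)"
  have pE: "perm_group (\<Gamma> \<inter> even_group)" by (rule perm_group_Int[OF \<Gamma>(1) perm_group_even_group])
  have pHK: "perm_group (H \<inter> ?K)" by (rule perm_group_Int[OF H(1) pK])
  have K2: "perm_group K2" unfolding K2_def by (rule perm_group_Int[OF pHK pE])
  have K2s: "K2 \<subseteq> H" "K2 \<subseteq> \<Gamma>" "K2 \<subseteq> colour_group" "K2 \<subseteq> even_group" by (auto simp: K2_def)
  have fK2: "fin_index K2 \<Gamma>"
    unfolding K2_def
    by (rule fin_index_Int[OF pHK pE \<Gamma>(1) fin_index_Int[OF H(1) pK \<Gamma>(1) H(3) K]
          fin_index_even[OF \<Gamma>(1) aut\<Gamma>]])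
  have fK2c: "fin_index K2 colour_group"
    by (rule fin_index_colour_group[OF K2 K2s(3) fin_orbits_fin_index[OF K2 \<Gamma>(1) fK2 \<Gamma>(3)]])
  obtain n where n: "n > 0" "\<And>g. g \<in> colour_group \<Longrightarrow> g ^^ n \<in> K2"
    by (rule fin_index_power[OF K2 CG fK2c]) (rule that)
  define K1 where "K1 = {k \<in> K2. \<forall>j\<in>{1..d}. int n dvd colour_count j (k undefined) - colour_count j undefined}"
  have K1: "perm_group K1" "fin_index K1 K2" unfolding K1_def
    by (rule count_subgroup[OF K2 K2s(3,4) n(1)])+
  have K1count: "int n dvd colour_count j (k v) - colour_count j v" if "k \<in> K1" "j \<in> {1..d}" for k j v
    by (rule count_subgroup(3)[OF K2 K2s(3,4) n(1) that(1)[unfolded K1_def] that(2)])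
  have K1s: "K1 \<subseteq> K2" by (auto simp: K1_def)
  have fK1: "fin_index K1 \<Gamma>" by (rule fin_index_trans[OF K1(1) K2 \<Gamma>(1) K1(2) fK2])
  \<comment> \<open>Normality in \<open>\<Gamma>\<close> keeps the commutators of \<open>K0\<close> with \<open>\<Gamma>\<close> in \<open>K0\<close>.\<close>
  define K0 where "K0 = core \<Gamma> K1"
  have K0: "perm_group K0" unfolding K0_def by (rule perm_group_core[OF \<Gamma>(1) K1(1)])
  have K0s: "K0 \<subseteq> K1" "K0 \<subseteq> \<Gamma>" unfolding K0_def using core_subset[OF \<Gamma>(1)] by blast+
  have K0c: "K0 \<subseteq> colour_group" using K0s K1s K2s by blast
  have fK0: "fin_index K0 \<Gamma>"
    unfolding K0_def by (rule fin_index_core[OF \<Gamma>(1) K1(1) subset_trans[OF K1s K2s(2)] fK1])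
  have oK0: "fin_orbits K0" by (rule fin_orbits_fin_index[OF K0 \<Gamma>(1) fK0 \<Gamma>(3)])
  obtain m where m: "m > 0" "\<And>g. g \<in> \<Gamma> \<Longrightarrow> g ^^ m \<in> K0"
    by (rule fin_index_power[OF K0 \<Gamma>(1) fK0]) (rule that)
  \<comment> \<open>A modulus that is prime to the exponent \<open>m\<close> and greater than 2.\<close>
  define P where "P = 2 * int m + 1"
  have P: "P \<ge> 3" "coprime P (int m)"
  proof -
    show "P \<ge> 3" using m(1) by (simp add: P_def)
    show "coprime P (int m)"
    proof (rule coprimeI)
      fix e assume "e dvd P" "e dvd int m"
      then have "e dvd P - 2 * int m" by (intro dvd_diff dvd_mult)
      then show "is_unit e" by (simp add: P_def)
    qed
  qed
  define H0 where "H0 = crossing_subgroup K0 P"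
  have H0: "perm_group H0" "fin_index H0 K0"
    unfolding H0_def by (rule crossing_subgroup[OF K0 K0c oK0]; use P in simp)+
  have H0s: "H0 \<subseteq> colour_group" using K0c by (auto simp: H0_def crossing_subgroup_def)
  have fH0: "fin_index H0 colour_group"
    by (rule fin_index_colour_group[OF H0(1) H0s fin_orbits_fin_index[OF H0(1) K0 H0(2) oK0]])
  obtain S where S: "finite S" "S \<subseteq> univ_group F"
    "\<And>g. g \<in> S \<Longrightarrow> fin_orbits (colour_group \<inter> conj_by g colour_group)"
    "\<And>x. x \<in> colour_group \<Longrightarrow> (\<And>g. g \<in> S \<Longrightarrow> x \<in> conj_by g colour_group) \<Longrightarrow> x \<in> H0"
    by (rule colour_group_congruence[OF F nf H0(1) H0s fH0]) blast
  have bijS: "bij g" if "g \<in> S" for g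
    using subsetD[OF S(2) that] by (simp add: univ_group_iff[OF F] aut_iff)
  define M where "M = \<Gamma> \<inter> (\<Inter>g\<in>S. conj_by g \<Gamma>)"
  have pM: "perm_group M" unfolding M_def by (rule perm_group_INT_conj_by[OF \<Gamma>(1) bijS])
  define N where "N = core \<Gamma> M"
  have N: "perm_group N" unfolding N_def by (rule perm_group_core[OF \<Gamma>(1) pM])
  have Ns: "N \<subseteq> M" "N \<subseteq> \<Gamma>" unfolding N_def using core_subset[OF \<Gamma>(1)] by blast+
  have pow: "x ^^ m \<in> H0" if x: "x \<in> N" for x
  proof (rule S(4))
    show "x ^^ m \<in> colour_group" using m(2)[OF subsetD[OF Ns(2) x]] K0c by blast
    fix g assume g: "g \<in> S"
    have "x \<in> conj_by g \<Gamma>" using subsetD[OF Ns(1) x] g by (simp add: M_def)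
    then have "pinv g \<circ> x \<circ> g \<in> \<Gamma>" by (simp only: mem_conj_by[OF bijS[OF g]])
    from m(2)[OF this] have "pinv g \<circ> x ^^ m \<circ> g \<in> K0" by (simp only: conj_funpow[OF bijS[OF g]])
    then show "x ^^ m \<in> conj_by g colour_group"
      using K0c by (simp only: mem_conj_by[OF bijS[OF g]]) blast
  qed
  have NK0: "P dvd crossings K0 u w x" if x: "x \<in> N" "x \<in> K0" and e: "{u, w} \<in> E" for x u w
  proof -
    have "P dvd crossings K0 u w (x ^^ m)"
      using pow[OF x(1)] e by (simp only: H0_def crossing_subgroup_def mem_Collect_eq)
    then have "P dvd int m * crossings K0 u w x" by (simp only: crossings_funpow[OF K0 K0c x(2)])
    then show ?thesis using P(2) by (simp only: coprime_dvd_mult_right_iff)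
  qed
  have "N \<subseteq> H"
  proof
    fix y assume y: "y \<in> N"
    have y\<Gamma>: "y \<in> \<Gamma>" "pinv y \<in> \<Gamma>" using y Ns(2) perm_groupD(3)[OF N y] by blast+
    have bij: "bij y" by (rule perm_groupD(2)[OF N y])
    have norm: "y \<circ> k \<circ> pinv y \<in> K0" "pinv y \<circ> k \<circ> y \<in> K0" if k: "k \<in> K0" for k
      using core_normal[OF \<Gamma>(1) k[unfolded K0_def] y\<Gamma>(1)] core_normal[OF \<Gamma>(1) k[unfolded K0_def] y\<Gamma>(2)]
        bij by (simp_all add: K0_def pinv_simps)
    have "pinv y \<in> K2"
    proof (rule preserves_crossings[OF d P(1) K2 K2s(3) n(2) K0])
      show "K0 \<subseteq> K2" "K0 \<subseteq> even_group" using K0s K1s K2s by blast+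
      show "int n dvd colour_count j (k v) - colour_count j v" if "k \<in> K0" "j \<in> {1..d}" for k j v
        using K1count that K0s(1) by blast
      show "\<exists>M>0. g ^^ M \<in> K0" if g: "g \<in> colour_group" for g
      proof -
        have "g ^^ n \<in> \<Gamma>" using n(2)[OF g] K2s(2) by blast
        from m(2)[OF this] have "g ^^ (n * m) \<in> K0" by (simp only: funpow_mult)
        then show ?thesis using n(1) m(1) by (intro exI[of _ "n * m"]) simp
      qed
      show "aut (pinv y)" by (rule aut_pinv[OF aut\<Gamma>[OF y\<Gamma>(1)]])
      fix u w k assume e: "{u, w} \<in> E" and k: "k \<in> K0"
      have e': "{pinv y u, pinv y w} \<in> E"
        using aut_pinv[OF aut\<Gamma>[OF y\<Gamma>(1)]] e by (simp add: aut_iff)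
      \<comment> \<open>The commutator by which \<open>k\<close> and its conjugate differ.\<close>
      let ?z = "pinv y \<circ> (k \<circ> y \<circ> pinv k)"
      have bk: "bij k" by (rule perm_groupD(2)[OF K0 k])
      have z: "?z \<circ> k = pinv y \<circ> k \<circ> y" using bk by (simp add: fun_eq_iff pinv_simps)
      have "k \<circ> y \<circ> pinv k \<in> N"
        using core_normal[OF \<Gamma>(1) y[unfolded N_def]] k K0s(2) unfolding N_def by blast
      then have zN: "?z \<in> N" by (rule perm_groupD(4)[OF N perm_groupD(3)[OF N y]])
      have "?z = (pinv y \<circ> k \<circ> y) \<circ> pinv k" by (simp add: comp_assoc)
      also have "\<dots> \<in> K0" by (rule perm_groupD(4)[OF K0 norm(2)[OF k] perm_groupD(3)[OF K0 k]])
      finally have zK: "?z \<in> K0" .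
      have "crossings K0 u w k = crossings K0 (pinv y u) (pinv y w) (pinv y \<circ> k \<circ> y)"
        by (rule crossings_conj[OF K0 K0c aut\<Gamma>[OF y\<Gamma>(1)] norm(2,1) k, symmetric])
      also have "\<dots> = crossings K0 (pinv y u) (pinv y w) ?z + crossings K0 (pinv y u) (pinv y w) k"
        unfolding z[symmetric] by (rule crossings_comp[OF K0 K0c zK k])
      finally show "P dvd crossings K0 (pinv y u) (pinv y w) k - crossings K0 u w k"
        using NK0[OF zN zK e'] by simp
    qed
    then have "pinv (pinv y) \<in> H" using perm_groupD(3)[OF K2] K2s(1) by blast
    then show "y \<in> H" using bij by (simp add: pinv_simps)
  qed
  moreover have "fin_orbits (\<Gamma> \<inter> conj_by g \<Gamma>)" if g: "g \<in> S" for g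
  proof -
    let ?L = "colour_group \<inter> conj_by g colour_group"
    have pc: "perm_group (conj_by g colour_group)" "perm_group (conj_by g ?K)"
      by (rule perm_group_conj_by[OF bijS[OF g]], rule CG pK)+
    have pL: "perm_group ?L" by (rule perm_group_Int[OF CG pc(1)])
    have fK: "fin_index ?K colour_group" by (rule fin_index_colour_group[OF pK _ oK]) blast
    have 1: "fin_index (?K \<inter> ?L) ?L" by (rule fin_index_restrict[OF pK CG fK pL]) blast
    have 2: "fin_index (conj_by g ?K \<inter> ?L) ?L"
      by (rule fin_index_restrict[OF pc(2,1) fin_index_conj_by[OF bijS[OF g] pK CG fK] pL]) blast
    have 3: "perm_group (?K \<inter> ?L)" "perm_group (conj_by g ?K \<inter> ?L)"
      by (rule perm_group_Int[OF pK pL], rule perm_group_Int[OF pc(2) pL])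
    have "fin_orbits ((?K \<inter> ?L) \<inter> (conj_by g ?K \<inter> ?L))"
      by (rule fin_orbits_fin_index[OF perm_group_Int[OF 3] pL fin_index_Int[OF 3 pL 1 2] S(3)[OF g]])
    moreover have "(?K \<inter> ?L) \<inter> (conj_by g ?K \<inter> ?L) \<subseteq> \<Gamma> \<inter> conj_by g \<Gamma>"
      by (auto simp: mem_conj_by[OF bijS[OF g]])
    ultimately show ?thesis by (rule fin_orbits_mono)
  qed
  ultimately show thesis using that[OF S(1,2)] by (simp only: N_def M_def)
qed

end

section \<open>A colouring that is invariant under a subgroup of finite index\<close>

text \<open>The fibres of the transport that is constructed below consist of pairs, on which permutations act
  freely through the first component.\<close>

definition act :: "('a \<Rightarrow> 'a) \<Rightarrow> ('a \<Rightarrow> 'a) \<times> 'x \<Rightarrow> ('a \<Rightarrow> 'a) \<times> 'x" where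
  "act h p = (h \<circ> fst p, snd p)"

lemma act_act: "act h (act k p) = act (h \<circ> k) p"
  by (simp add: act_def comp_assoc)

lemma act_id [simp]: "act id p = p"
  by (simp add: act_def)

lemma act_pinv: "bij g \<Longrightarrow> act (pinv g) (act g p) = p" "bij g \<Longrightarrow> act g (act (pinv g) p) = p"
  by (simp_all add: act_act pinv_simps)

text \<open>Both sets are disjoint unions of regular orbits of \<open>D\<close>, on which the labels are constant.  One
  orbit of each set is matched and removed at a time.\<close>

lemma equivariant_bijection:
  fixes A B :: "(('a \<Rightarrow> 'a) \<times> 'x) set" and l l' :: "('a \<Rightarrow> 'a) \<times> 'x \<Rightarrow> 'l"
  assumes D: "perm_group D" "finite D"
    and A: "finite A" "\<And>p. p \<in> A \<Longrightarrow> bij (fst p)" "\<And>h p. h \<in> D \<Longrightarrow> p \<in> A \<Longrightarrow> act h p \<in> A"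
      "\<And>h p. h \<in> D \<Longrightarrow> p \<in> A \<Longrightarrow> l (act h p) = l p"
    and B: "finite B" "\<And>p. p \<in> B \<Longrightarrow> bij (fst p)" "\<And>h p. h \<in> D \<Longrightarrow> p \<in> B \<Longrightarrow> act h p \<in> B"
      "\<And>h p. h \<in> D \<Longrightarrow> p \<in> B \<Longrightarrow> l' (act h p) = l' p"
    and card: "\<And>j. card {p \<in> A. l p = j} = card {p \<in> B. l' p = j}"
  shows "\<exists>\<phi>. bij_betw \<phi> A B \<and> (\<forall>p\<in>A. l' (\<phi> p) = l p) \<and> (\<forall>h\<in>D. \<forall>p\<in>A. \<phi> (act h p) = act h (\<phi> p))"
  using A B card
proof (induction "card A" arbitrary: A B rule: less_induct)
  case less
  show ?case
  proof (cases "A = {}")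
    case True
    have "b \<notin> B" for b
    proof
      assume "b \<in> B"
      then have "b \<in> {p \<in> B. l' p = l' b}" by simp
      moreover have "finite {p \<in> B. l' p = l' b}" using less.prems(5) by simp
      ultimately have "card {p \<in> B. l' p = l' b} \<noteq> 0" by (metis card_0_eq empty_iff)
      then show False using less.prems(9)[of "l' b"] True by simp
    qed
    then show ?thesis using True by (auto simp: bij_betw_def)
  next
    case False
    then obtain a0 where a0: "a0 \<in> A" by blast
    then have "a0 \<in> {p \<in> A. l p = l a0}" by simp
    moreover have "finite {p \<in> A. l p = l a0}" using less.prems(1) by simp
    ultimately have "card {p \<in> A. l p = l a0} \<noteq> 0" by (metis card_0_eq empty_iff)
    then have "{p \<in> B. l' p = l a0} \<noteq> {}" using less.prems(9)[of "l a0"] by (metis card.empty)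
    then obtain b0 where b0: "b0 \<in> B" "l' b0 = l a0" by blast
    have inj: "inj_on (\<lambda>h. act h p) D" if "bij (fst p)" for p :: "('a \<Rightarrow> 'a) \<times> 'x"
    proof (rule inj_onI)
      fix h k assume "act h p = act k p"
      then have "h \<circ> fst p \<circ> pinv (fst p) = k \<circ> fst p \<circ> pinv (fst p)" by (simp add: act_def)
      then show "h = k" using that by (simp add: comp_assoc pinv_simps)
    qed
    define Oa where "Oa = (\<lambda>h. act h a0) ` D"
    define Ob where "Ob = (\<lambda>h. act h b0) ` D"
    have fO: "finite Oa" "finite Ob" using D(2) by (simp_all add: Oa_def Ob_def)
    have cO: "card Oa = card Ob"
      using card_image[OF inj[OF less.prems(2)[OF a0]]] card_image[OF inj[OF less.prems(6)[OF b0(1)]]]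
      by (simp add: Oa_def Ob_def)
    have Oa: "Oa \<subseteq> A" "\<And>p. p \<in> Oa \<Longrightarrow> l p = l a0"
      using less.prems(3,4)[OF _ a0] by (auto simp: Oa_def)
    have Ob: "Ob \<subseteq> B" "\<And>p. p \<in> Ob \<Longrightarrow> l' p = l a0"
      using less.prems(7,8)[OF _ b0(1)] b0(2) by (auto simp: Ob_def)
    have act_O: "act h p \<in> (\<lambda>h. act h q) ` D \<longleftrightarrow> p \<in> (\<lambda>h. act h q) ` D" if h: "h \<in> D"
      for h and p q :: "('a \<Rightarrow> 'a) \<times> 'x"
    proof
      assume "p \<in> (\<lambda>h. act h q) ` D"
      then obtain k where "k \<in> D" "p = act k q" by blast
      then show "act h p \<in> (\<lambda>h. act h q) ` D"
        using perm_groupD(4)[OF D(1) h, of k] by (simp add: act_act)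
    next
      assume "act h p \<in> (\<lambda>h. act h q) ` D"
      then obtain k where k: "k \<in> D" "act h p = act k q" by blast
      have "p = act (pinv h) (act h p)" by (simp add: act_pinv(1)[OF perm_groupD(2)[OF D(1) h]])
      also have "\<dots> = act (pinv h \<circ> k) q" by (simp add: k(2) act_act)
      finally show "p \<in> (\<lambda>h. act h q) ` D"
        using perm_groupD(4)[OF D(1) perm_groupD(3)[OF D(1) h] k(1)] by blast
    qed
    have a0O: "a0 \<in> Oa" using perm_groupD(1)[OF D(1)] unfolding Oa_def by (rule rev_image_eqI) simp
    have "\<exists>\<phi>. bij_betw \<phi> (A - Oa) (B - Ob) \<and> (\<forall>p\<in>A - Oa. l' (\<phi> p) = l p) \<and>
        (\<forall>h\<in>D. \<forall>p\<in>A - Oa. \<phi> (act h p) = act h (\<phi> p))"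
    proof (rule less.hyps)
      show "card (A - Oa) < card A"
        using a0 a0O less.prems(1) by (intro psubset_card_mono) auto
      show "act h p \<in> A - Oa" if "h \<in> D" "p \<in> A - Oa" for h p
        using that less.prems(3) act_O[OF that(1), of p a0] by (simp add: Oa_def)
      show "act h p \<in> B - Ob" if "h \<in> D" "p \<in> B - Ob" for h p
        using that less.prems(7) act_O[OF that(1), of p b0] by (simp add: Ob_def)
      show "card {p \<in> A - Oa. l p = j} = card {p \<in> B - Ob. l' p = j}" for j
      proof (cases "j = l a0")
        case True
        have "{p \<in> A - Oa. l p = j} = {p \<in> A. l p = j} - Oa" "{p \<in> B - Ob. l' p = j} = {p \<in> B. l' p = j} - Ob"
          by auto
        moreover have "Oa \<subseteq> {p \<in> A. l p = j}" "Ob \<subseteq> {p \<in> B. l' p = j}"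
          using Oa Ob True by auto
        ultimately show ?thesis
          using fO cO less.prems(9)[of j] by (simp add: card_Diff_subset)
      next
        case False
        then have "{p \<in> A - Oa. l p = j} = {p \<in> A. l p = j}" "{p \<in> B - Ob. l' p = j} = {p \<in> B. l' p = j}"
          using Oa(2) Ob(2) by auto
        then show ?thesis using less.prems(9)[of j] by simp
      qed
    qed (use less.prems in auto)
    then obtain \<phi> where \<phi>: "bij_betw \<phi> (A - Oa) (B - Ob)" "\<forall>p\<in>A - Oa. l' (\<phi> p) = l p"
      "\<forall>h\<in>D. \<forall>p\<in>A - Oa. \<phi> (act h p) = act h (\<phi> p)" by blast
    define \<psi> where "\<psi> p = (if p \<in> Oa then act (inv_into D (\<lambda>h. act h a0) p) b0 else \<phi> p)" for p
    have \<psi>O: "\<psi> (act h a0) = act h b0" if "h \<in> D" for h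
      using that inv_into_f_f[OF inj[OF less.prems(2)[OF a0]] that] by (simp add: \<psi>_def Oa_def)
    have "bij_betw \<psi> Oa Ob"
    proof (rule bij_betw_imageI)
      show "inj_on \<psi> Oa"
      proof (rule inj_onI)
        fix p q assume "p \<in> Oa" "q \<in> Oa" and eq: "\<psi> p = \<psi> q"
        then obtain h k where h: "h \<in> D" "p = act h a0" and k: "k \<in> D" "q = act k a0"
          by (auto simp: Oa_def)
        have "act h b0 = act k b0" using eq \<psi>O h k by simp
        then have "h = k" by (rule inj_onD[OF inj[OF less.prems(6)[OF b0(1)]] _ h(1) k(1)])
        then show "p = q" by (simp only: h k)
      qed
      show "\<psi> ` Oa = Ob" using \<psi>O by (force simp: Oa_def Ob_def)
    qed
    moreover have "bij_betw \<psi> (A - Oa) (B - Ob)"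
      using \<phi>(1) by (rule bij_betw_cong[THEN iffD1, rotated]) (simp add: \<psi>_def)
    ultimately have "bij_betw \<psi> (Oa \<union> (A - Oa)) (Ob \<union> (B - Ob))"
      by (rule bij_betw_combine) blast
    moreover have "Oa \<union> (A - Oa) = A" "Ob \<union> (B - Ob) = B" using Oa(1) Ob(1) by blast+
    ultimately have "bij_betw \<psi> A B" by simp
    moreover have "l' (\<psi> p) = l p" if "p \<in> A" for p
    proof (cases "p \<in> Oa")
      case True
      then obtain h where "h \<in> D" "p = act h a0" by (auto simp: Oa_def)
      then show ?thesis using \<psi>O less.prems(4,8) a0 b0 by simp
    next
      case False
      then show ?thesis using \<phi>(2) that by (simp add: \<psi>_def)
    qed
    moreover have "\<psi> (act h p) = act h (\<psi> p)" if h: "h \<in> D" and p: "p \<in> A" for h p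
    proof (cases "p \<in> Oa")
      case True
      then obtain k where k: "k \<in> D" "p = act k a0" by (auto simp: Oa_def)
      then show ?thesis using \<psi>O[OF k(1)] \<psi>O[OF perm_groupD(4)[OF D(1) h k(1)]] by (simp add: act_act)
    next
      case False
      then have "act h p \<notin> Oa" using act_O[OF h, of p a0] by (simp add: Oa_def)
      then show ?thesis using \<phi>(3) False h p by (simp add: \<psi>_def)
    qed
    ultimately show ?thesis by blast
  qed
qed

context coloured_tree
begin

text \<open>Over every vertex \<open>v\<close> there is a finite set \<open>P v\<close> whose elements consist of a local colouring at \<open>v\<close> and of
  auxiliary data that make the action of the stabiliser of \<open>v\<close> free and the size of \<open>P v\<close>
  independent of \<open>v\<close>.  The number of elements that give an edge a prescribed colour is the same
  at both ends of the edge.  Hence there is an equivariant parallel transport that preserves the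
  colour of the edge, a parallel section is a colouring, and the finitely many parallel sections are
  permuted by \<open>\<Gamma>\<close>.\<close>

lemma invariant_colouring:
  assumes F: "subgroup F (sym_group d)"
    and \<Gamma>: "perm_group \<Gamma>" "\<Gamma> \<subseteq> univ_group F" "fin_orbits \<Gamma>" "\<And>v. finite {g \<in> \<Gamma>. g v = v}"
  obtains c' where "colouring_equiv F c c'" "fin_index (\<Gamma> \<inter> coloured_tree.colour_group E c') \<Gamma>"
proof -
  define \<Gamma>0 where "\<Gamma>0 = \<Gamma> \<inter> even_group"
  have aut\<Gamma>: "aut g" if "g \<in> \<Gamma>" for g using subsetD[OF \<Gamma>(2) that] by (simp add: univ_group_iff[OF F])
  have \<Gamma>0: "perm_group \<Gamma>0" unfolding \<Gamma>0_def by (rule perm_group_Int[OF \<Gamma>(1) perm_group_even_group])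
  have f\<Gamma>0: "fin_index \<Gamma>0 \<Gamma>" unfolding \<Gamma>0_def by (rule fin_index_even[OF \<Gamma>(1) aut\<Gamma>])
  have o\<Gamma>0: "fin_orbits \<Gamma>0" by (rule fin_orbits_fin_index[OF \<Gamma>0 \<Gamma>(1) f\<Gamma>0 \<Gamma>(3)])
  have \<Gamma>0s: "\<Gamma>0 \<subseteq> \<Gamma>" by (simp add: \<Gamma>0_def)
  have bij: "bij g" if "g \<in> \<Gamma>0" for g by (rule perm_groupD(2)[OF \<Gamma>0 that])
  have pinv\<Gamma>0: "pinv g \<in> \<Gamma>0" if "g \<in> \<Gamma>0" for g by (rule perm_groupD(3)[OF \<Gamma>0 that])
  have comp\<Gamma>0: "g \<circ> h \<in> \<Gamma>0" if "g \<in> \<Gamma>0" "h \<in> \<Gamma>0" for g h by (rule perm_groupD(4)[OF \<Gamma>0 that])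
  have edge\<Gamma>0: "{g u, g v} \<in> E \<longleftrightarrow> {u, v} \<in> E" if "g \<in> \<Gamma>0" for g u v
    using aut\<Gamma>[of g] \<Gamma>0s that by (auto simp: aut_iff)
  have parity\<Gamma>0: "parity (g v) = parity v" if "g \<in> \<Gamma>0" for g v
    using that by (simp add: \<Gamma>0_def even_group_def)
  define rep where "rep v = (SOME r. \<exists>g\<in>\<Gamma>0. g r = v)" for v
  have rep: "\<exists>g\<in>\<Gamma>0. g (rep v) = v" for v
    unfolding rep_def by (rule someI[of _ v]) (rule bexI[OF _ perm_groupD(1)[OF \<Gamma>0]], simp)
  have rep_eq: "rep (h v) = rep v" if h: "h \<in> \<Gamma>0" for h v
  proof -
    have "(\<exists>g\<in>\<Gamma>0. g r = h v) \<longleftrightarrow> (\<exists>g\<in>\<Gamma>0. g r = v)" for r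
    proof
      assume "\<exists>g\<in>\<Gamma>0. g r = h v"
      then obtain g where "g \<in> \<Gamma>0" "g r = h v" by blast
      then have "(pinv h \<circ> g) r = v" by (simp add: pinv_simps(1)[OF bij[OF h]])
      then show "\<exists>g\<in>\<Gamma>0. g r = v" using comp\<Gamma>0[OF pinv\<Gamma>0[OF h] \<open>g \<in> \<Gamma>0\<close>] by blast
    next
      assume "\<exists>g\<in>\<Gamma>0. g r = v"
      then obtain g where "g \<in> \<Gamma>0" "g r = v" by blast
      then have "(h \<circ> g) r = h v" by simp
      then show "\<exists>g\<in>\<Gamma>0. g r = h v" using comp\<Gamma>0[OF h \<open>g \<in> \<Gamma>0\<close>] by blast
    qed
    then show ?thesis by (simp add: rep_def)
  qed
  have fin_rep: "finite (range rep)"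
  proof -
    obtain R where R: "finite R" "\<And>v. \<exists>h\<in>\<Gamma>0. \<exists>r\<in>R. v = h r" by (rule fin_orbitsE[OF o\<Gamma>0]) (rule that)
    have "range rep \<subseteq> rep ` R"
    proof (rule image_subsetI)
      fix v
      obtain h r where "h \<in> \<Gamma>0" "r \<in> R" "v = h r" using R(2)[of v] by blast
      then show "rep v \<in> rep ` R" using rep_eq by simp
    qed
    then show ?thesis using R(1) by (rule finite_subset[OF _ finite_imageI])
  qed
  define stab where "stab v = {g \<in> \<Gamma>0. g v = v}" for v
  have fstab: "finite (stab v)" for v
    by (rule finite_subset[OF _ \<Gamma>(4)[of v]]) (use \<Gamma>0s in \<open>auto simp: stab_def\<close>)
  have cstab: "card (stab v) > 0" for v
    using fstab perm_groupD(1)[OF \<Gamma>0] by (auto simp: card_gt_0_iff stab_def)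
  define N where "N = (\<Prod>r\<in>range rep. card (stab r))"
  define n where "n v = N div card (stab (rep v))" for v
  have n: "card (stab (rep v)) * n v = N" for v
  proof -
    have "card (stab (rep v)) dvd N" unfolding N_def by (rule dvd_prodI[OF fin_rep]) simp
    then show ?thesis by (simp add: n_def)
  qed
  have "N > 0" unfolding N_def using cstab by (simp add: prod_pos)
  then have n0: "n v > 0" for v using n[of v] by (metis mult_0_right not_gr_zero)
  define T where "T v = {g \<in> \<Gamma>0. g (rep v) = v}" for v
  have T_bij: "bij_betw (\<lambda>g. h \<circ> g) (stab (rep v)) (T v)" if h: "h \<in> \<Gamma>0" "h (rep v) = v" for h v
  proof (rule bij_betw_byWitness[where f' = "\<lambda>g. pinv h \<circ> g"])
    show "\<forall>g\<in>stab (rep v). pinv h \<circ> (h \<circ> g) = g" "\<forall>g\<in>T v. h \<circ> (pinv h \<circ> g) = g"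
      using bij[OF h(1)] by (simp_all add: fun_eq_iff pinv_simps)
    show "(\<lambda>g. h \<circ> g) ` stab (rep v) \<subseteq> T v"
      using comp\<Gamma>0[OF h(1)] h(2) by (auto simp: stab_def T_def)
    have "pinv h v = rep v" using pinv_simps(1)[OF bij[OF h(1)], of "rep v"] h(2) by simp
    then show "(\<lambda>g. pinv h \<circ> g) ` T v \<subseteq> stab (rep v)"
      using comp\<Gamma>0[OF pinv\<Gamma>0[OF h(1)]] by (auto simp: stab_def T_def)
  qed
  have T: "finite (T v)" "card (T v) = card (stab (rep v))" for v
  proof -
    obtain h where h: "h \<in> \<Gamma>0" "h (rep v) = v" using rep by blast
    show "finite (T v)" using bij_betw_finite[OF T_bij[OF h]] fstab by simp
    show "card (T v) = card (stab (rep v))" using bij_betw_same_card[OF T_bij[OF h]] by simp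
  qed
  have finF: "finite F"
    using finite_subset[of F "{p. p permutes {1..d}}"] perm_subgroup(2)[OF F] finite_permutations[of "{1..d}"]
    by auto
  \<comment> \<open>An element \<open>(g, i, a)\<close> of \<open>P v\<close> carries the local colouring \<open>a \<circ> c\<close> at the representative
    \<open>rep v\<close>, which is moved to \<open>v\<close> by \<open>g\<close>.  The index \<open>i\<close> makes up for the different orders of the
    stabilisers, and \<open>lab v w\<close> is the colour of the edge from \<open>v\<close> to \<open>w\<close>.\<close>
  define P where "P v = T v \<times> ({..<n v} \<times> F)" for v
  define lab where "lab v w p = snd (snd p) (c {pinv (fst p) v, pinv (fst p) w})"
    for v w and p :: "('a \<Rightarrow> 'a) \<times> nat \<times> (nat \<Rightarrow> nat)"
  have finP: "finite (P v)" for v using T(1) finF by (simp add: P_def)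
  have P_bij: "bij (fst p)" "fst p \<in> \<Gamma>0" if "p \<in> P v" for p v
    using that bij by (auto simp: P_def T_def)
  have act_P: "act h p \<in> P (h v)" if h: "h \<in> \<Gamma>0" and p: "p \<in> P v" for h p v
    using p comp\<Gamma>0[OF h] rep_eq[OF h, of v] by (auto simp: P_def T_def act_def n_def)
  have act_P': "act (pinv h) p \<in> P v" if h: "h \<in> \<Gamma>0" and p: "p \<in> P (h v)" for h p v
    using act_P[OF pinv\<Gamma>0[OF h] p] by (simp add: pinv_simps(1)[OF bij[OF h]])
  have lab_act: "lab (h v) (h w) (act h p) = lab v w p" if h: "h \<in> \<Gamma>0" and p: "p \<in> P v" for h p v w
    unfolding lab_def act_def using pinv_comp[OF bij[OF h] P_bij(1)[OF p]]
    by (simp add: pinv_simps(1)[OF bij[OF h]])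
  have local: "\<exists>\<sigma>\<in>F. \<forall>w. {v, w} \<in> E \<longrightarrow> c {pinv g v, pinv g w} = \<sigma> (c {v, w})" if g: "g \<in> \<Gamma>0" for g v
    using subsetD[OF \<Gamma>(2) subsetD[OF \<Gamma>0s pinv\<Gamma>0[OF g]]] by (simp add: univ_group_iff[OF F])
  have count: "card {p \<in> P v. lab v w p = j} = N * card {a \<in> F. a (c {v, w}) = j}" if e: "{v, w} \<in> E" for v w j
  proof -
    let ?C = "\<lambda>g. {a \<in> F. a (c {pinv g v, pinv g w}) = j}"
    have cC: "card (?C g) = card {a \<in> F. a (c {v, w}) = j}" if g: "g \<in> T v" for g
    proof -
      have "g \<in> \<Gamma>0" using g by (simp add: T_def)
      then obtain \<sigma> where \<sigma>: "\<sigma> \<in> F" "c {pinv g v, pinv g w} = \<sigma> (c {v, w})" using local e by blast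
      have b\<sigma>: "bij \<sigma>" using perm_subgroup(2)[OF F \<sigma>(1)] by (rule permutes_bij)
      have "bij_betw (\<lambda>a. a \<circ> \<sigma>) (?C g) {a \<in> F. a (c {v, w}) = j}"
      proof (rule bij_betw_byWitness[where f' = "\<lambda>a. a \<circ> pinv \<sigma>"])
        show "\<forall>a\<in>?C g. a \<circ> \<sigma> \<circ> pinv \<sigma> = a" "\<forall>a\<in>{a \<in> F. a (c {v, w}) = j}. a \<circ> pinv \<sigma> \<circ> \<sigma> = a"
          using b\<sigma> by (simp_all add: comp_assoc pinv_simps)
        show "(\<lambda>a. a \<circ> \<sigma>) ` ?C g \<subseteq> {a \<in> F. a (c {v, w}) = j}"
          using \<sigma> perm_subgroup(4)[OF F _ \<sigma>(1)] by auto
        show "(\<lambda>a. a \<circ> pinv \<sigma>) ` {a \<in> F. a (c {v, w}) = j} \<subseteq> ?C g"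
          using \<sigma>(2) perm_subgroup(4)[OF F _ perm_subgroup(3)[OF F \<sigma>(1)]] pinv_simps(1)[OF b\<sigma>] by auto
      qed
      then show ?thesis by (rule bij_betw_same_card)
    qed
    have "{p \<in> P v. lab v w p = j} = (SIGMA g:T v. {..<n v} \<times> ?C g)"
      by (auto simp: P_def lab_def)
    then have "card {p \<in> P v. lab v w p = j} = (\<Sum>g\<in>T v. card ({..<n v} \<times> ?C g))"
      using T(1) finF by (simp add: card_SigmaI)
    also have "\<dots> = (\<Sum>g\<in>T v. n v * card {a \<in> F. a (c {v, w}) = j})"
      by (rule sum.cong[OF refl]) (simp add: card_cartesian_product cC)
    also have "\<dots> = (card (T v) * n v) * card {a \<in> F. a (c {v, w}) = j}" by simp
    also have "\<dots> = N * card {a \<in> F. a (c {v, w}) = j}" by (simp only: T(2) n)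
    finally show ?thesis .
  qed
  \<comment> \<open>The transport is chosen on representatives of the orbits of edges, where it has to commute with
    the stabiliser of the edge, and then extended by translation.\<close>
  have "\<exists>\<psi>. bij_betw \<psi> (P v) (P w) \<and> (\<forall>p\<in>P v. lab w v (\<psi> p) = lab v w p) \<and>
      (\<forall>h\<in>stab v \<inter> stab w. \<forall>p\<in>P v. \<psi> (act h p) = act h (\<psi> p))" if e: "{v, w} \<in> E" for v w
  proof (rule equivariant_bijection)
    have pstab: "perm_group (stab v)" for v
      unfolding perm_group_def
    proof (intro conjI ballI)
      show "id \<in> stab v" using perm_groupD(1)[OF \<Gamma>0] by (simp add: stab_def)
      show "bij g" if "g \<in> stab v" for g using that bij by (simp add: stab_def)
      show "pinv g \<in> stab v" if g: "g \<in> stab v" for g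
        using g pinv\<Gamma>0[of g] pinv_simps(1)[OF bij, of g v] by (simp add: stab_def)
      show "g \<circ> h \<in> stab v" if "g \<in> stab v" "h \<in> stab v" for g h
        using that comp\<Gamma>0 by (simp add: stab_def)
    qed
    show "perm_group (stab v \<inter> stab w)" by (rule perm_group_Int[OF pstab pstab])
    show "finite (stab v \<inter> stab w)" using fstab by blast
    show "finite (P v)" "finite (P w)" by (rule finP)+
    show "bij (fst p)" if "p \<in> P v" for p by (rule P_bij(1)[OF that])
    show "bij (fst p)" if "p \<in> P w" for p by (rule P_bij(1)[OF that])
    fix h p assume h: "h \<in> stab v \<inter> stab w"
    then have hs: "h \<in> \<Gamma>0" "h v = v" "h w = w" by (auto simp: stab_def)
    show "act h p \<in> P v" if "p \<in> P v" using act_P[OF hs(1) that] hs by simp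
    show "act h p \<in> P w" if "p \<in> P w" using act_P[OF hs(1) that] hs by simp
    show "lab v w (act h p) = lab v w p" if "p \<in> P v" using lab_act[OF hs(1) that, of w] hs by simp
    show "lab w v (act h p) = lab w v p" if "p \<in> P w" using lab_act[OF hs(1) that, of v] hs by simp
  next
    have "{w, v} \<in> E" using e by (simp add: insert_commute)
    then show "card {p \<in> P v. lab v w p = j} = card {p \<in> P w. lab w v p = j}" for j
      using count[OF e, of j] count[of w v j] by (simp add: insert_commute)
  qed
  then obtain \<psi> where \<psi>: "\<And>v w. {v, w} \<in> E \<Longrightarrow> bij_betw (\<psi> v w) (P v) (P w)"
    "\<And>v w p. {v, w} \<in> E \<Longrightarrow> p \<in> P v \<Longrightarrow> lab w v (\<psi> v w p) = lab v w p"
    "\<And>v w h p. {v, w} \<in> E \<Longrightarrow> h \<in> stab v \<inter> stab w \<Longrightarrow> p \<in> P v \<Longrightarrow> \<psi> v w (act h p) = act h (\<psi> v w p)"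
    by metis
  define erep where "erep e = (SOME r. \<exists>g\<in>\<Gamma>0. g (fst r) = fst e \<and> g (snd r) = snd e)" for e
  define tr where "tr e = (SOME g. g \<in> \<Gamma>0 \<and> g (fst (erep e)) = fst e \<and> g (snd (erep e)) = snd e)" for e
  have tr: "tr e \<in> \<Gamma>0" "tr e (fst (erep e)) = fst e" "tr e (snd (erep e)) = snd e" for e
  proof -
    have "\<exists>g\<in>\<Gamma>0. g (fst (erep e)) = fst e \<and> g (snd (erep e)) = snd e"
      unfolding erep_def by (rule someI[of _ e]) (rule bexI[OF _ perm_groupD(1)[OF \<Gamma>0]], simp)
    then have "\<exists>g. g \<in> \<Gamma>0 \<and> g (fst (erep e)) = fst e \<and> g (snd (erep e)) = snd e" by blast
    then have "tr e \<in> \<Gamma>0 \<and> tr e (fst (erep e)) = fst e \<and> tr e (snd (erep e)) = snd e"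
      unfolding tr_def by (rule someI_ex)
    then show "tr e \<in> \<Gamma>0" "tr e (fst (erep e)) = fst e" "tr e (snd (erep e)) = snd e" by auto
  qed
  have erep_eq: "erep (h v, h w) = erep (v, w)" if h: "h \<in> \<Gamma>0" for h v w
  proof -
    have "(\<exists>g\<in>\<Gamma>0. g (fst r) = h v \<and> g (snd r) = h w) \<longleftrightarrow> (\<exists>g\<in>\<Gamma>0. g (fst r) = v \<and> g (snd r) = w)" for r
    proof
      assume "\<exists>g\<in>\<Gamma>0. g (fst r) = h v \<and> g (snd r) = h w"
      then obtain g where g: "g \<in> \<Gamma>0" "g (fst r) = h v" "g (snd r) = h w" by blast
      then have "(pinv h \<circ> g) (fst r) = v \<and> (pinv h \<circ> g) (snd r) = w"
        by (simp add: pinv_simps(1)[OF bij[OF h]])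
      then show "\<exists>g\<in>\<Gamma>0. g (fst r) = v \<and> g (snd r) = w" by (rule bexI[OF _ comp\<Gamma>0[OF pinv\<Gamma>0[OF h] g(1)]])
    next
      assume "\<exists>g\<in>\<Gamma>0. g (fst r) = v \<and> g (snd r) = w"
      then obtain g where g: "g \<in> \<Gamma>0" "g (fst r) = v" "g (snd r) = w" by blast
      then have "(h \<circ> g) (fst r) = h v \<and> (h \<circ> g) (snd r) = h w" by simp
      then show "\<exists>g\<in>\<Gamma>0. g (fst r) = h v \<and> g (snd r) = h w" by (rule bexI[OF _ comp\<Gamma>0[OF h g(1)]])
    qed
    then show ?thesis by (simp add: erep_def)
  qed
  define x where "x v w = fst (erep (v, w))" for v w
  define y where "y v w = snd (erep (v, w))" for v w
  define \<phi> where "\<phi> v w p = act (tr (v, w)) (\<psi> (x v w) (y v w) (act (pinv (tr (v, w))) p))" for v w p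
  have txy: "tr (v, w) \<in> \<Gamma>0" "tr (v, w) (x v w) = v" "tr (v, w) (y v w) = w" for v w
    using tr[of "(v, w)"] by (simp_all add: x_def y_def)
  have exy: "{x v w, y v w} \<in> E" if "{v, w} \<in> E" for v w
    using edge\<Gamma>0[OF txy(1)[of v w], of "x v w" "y v w"] that by (simp only: txy)
  have in_x: "act (pinv (tr (v, w))) p \<in> P (x v w)" if "p \<in> P v" for v w p
    by (rule act_P'[OF txy(1)]) (simp only: txy that)
  have \<phi>_bij: "bij_betw (\<phi> v w) (P v) (P w)" if e: "{v, w} \<in> E" for v w
  proof -
    let ?t = "tr (v, w)"
    have 1: "bij_betw (act (pinv ?t)) (P v) (P (x v w))"
    proof (rule bij_betw_byWitness[where f' = "act ?t"])
      show "act ?t ` P (x v w) \<subseteq> P v" using act_P[OF txy(1)[of v w], of _ "x v w"] txy(2)[of v w] by auto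
      show "act (pinv ?t) ` P v \<subseteq> P (x v w)" using in_x by blast
    qed (use act_pinv[OF bij[OF txy(1)]] in auto)
    have 2: "bij_betw (act ?t) (P (y v w)) (P w)"
    proof (rule bij_betw_byWitness[where f' = "act (pinv ?t)"])
      show "act ?t ` P (y v w) \<subseteq> P w" using act_P[OF txy(1)[of v w], of _ "y v w"] txy(3)[of v w] by auto
      show "act (pinv ?t) ` P w \<subseteq> P (y v w)"
        using act_P'[OF txy(1)[of v w], of _ "y v w"] txy(3)[of v w] by auto
    qed (use act_pinv[OF bij[OF txy(1)]] in auto)
    have "bij_betw (act ?t \<circ> (\<psi> (x v w) (y v w) \<circ> act (pinv ?t))) (P v) (P w)"
      by (rule bij_betw_trans[OF bij_betw_trans[OF 1 \<psi>(1)[OF exy[OF e]]] 2])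
    moreover have "act ?t \<circ> (\<psi> (x v w) (y v w) \<circ> act (pinv ?t)) = \<phi> v w"
      by (simp add: fun_eq_iff \<phi>_def)
    ultimately show ?thesis by simp
  qed
  have \<phi>_in: "\<phi> v w p \<in> P w" if "{v, w} \<in> E" "p \<in> P v" for v w p
    using \<phi>_bij[OF that(1)] that(2) by (rule bij_betwE[THEN bspec])
  have \<phi>_lab: "lab w v (\<phi> v w p) = lab v w p" if e: "{v, w} \<in> E" and p: "p \<in> P v" for v w p
  proof -
    let ?t = "tr (v, w)" and ?q = "act (pinv (tr (v, w))) p"
    have q: "?q \<in> P (x v w)" by (rule in_x[OF p])
    have q': "\<psi> (x v w) (y v w) ?q \<in> P (y v w)"
      using \<psi>(1)[OF exy[OF e]] q by (rule bij_betwE[THEN bspec])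
    have "lab w v (\<phi> v w p) = lab (y v w) (x v w) (\<psi> (x v w) (y v w) ?q)"
      using lab_act[OF txy(1)[of v w] q', of "x v w"] by (simp only: txy \<phi>_def)
    also have "\<dots> = lab (x v w) (y v w) ?q" by (rule \<psi>(2)[OF exy[OF e] q])
    also have "\<dots> = lab v w (act ?t ?q)"
      using lab_act[OF txy(1)[of v w] q, of "y v w"] by (simp only: txy)
    finally show ?thesis by (simp only: act_pinv(2)[OF bij[OF txy(1)]])
  qed
  have \<phi>_act: "\<phi> (h v) (h w) (act h p) = act h (\<phi> v w p)"
    if h: "h \<in> \<Gamma>0" and e: "{v, w} \<in> E" and p: "p \<in> P v" for h v w p
  proof -
    let ?g = "tr (v, w)" and ?g' = "tr (h v, h w)"
    let ?t = "pinv ?g \<circ> pinv h \<circ> ?g'"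
    have same: "x (h v) (h w) = x v w" "y (h v) (h w) = y v w" by (simp_all add: x_def y_def erep_eq[OF h])
    have b: "bij ?g" "bij ?g'" "bij h" by (rule bij[OF txy(1)], rule bij[OF txy(1)], rule bij[OF h])
    have t\<Gamma>: "?t \<in> \<Gamma>0" by (intro comp\<Gamma>0 pinv\<Gamma>0 txy(1) h)
    have tx: "?t (x v w) = x v w"
    proof -
      have "?g' (x v w) = h v" using txy(2)[of "h v" "h w"] by (simp only: same)
      then have "?t (x v w) = pinv ?g (pinv h (h v))" by simp
      also have "\<dots> = pinv ?g (?g (x v w))" by (simp only: pinv_simps(1)[OF b(3)] txy)
      finally show ?thesis by (simp only: pinv_simps(1)[OF b(1)])
    qed
    have ty: "?t (y v w) = y v w"
    proof -
      have "?g' (y v w) = h w" using txy(3)[of "h v" "h w"] by (simp only: same)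
      then have "?t (y v w) = pinv ?g (pinv h (h w))" by simp
      also have "\<dots> = pinv ?g (?g (y v w))" by (simp only: pinv_simps(1)[OF b(3)] txy)
      finally show ?thesis by (simp only: pinv_simps(1)[OF b(1)])
    qed
    have ts: "pinv ?t \<in> stab (x v w) \<inter> stab (y v w)"
      using pinv\<Gamma>0[OF t\<Gamma>] pinv_simps(1)[OF bij[OF t\<Gamma>], of "x v w"] pinv_simps(1)[OF bij[OF t\<Gamma>], of "y v w"]
      by (simp only: tx ty stab_def Int_iff mem_Collect_eq simp_thms)
    let ?q = "act (pinv ?g) p"
    have q: "?q \<in> P (x v w)" by (rule in_x[OF p])
    have eq1: "act (pinv ?g') (act h p) = act (pinv ?t) ?q"
      using b by (simp add: act_act pinv_comp bij_comp pinv_simps comp_assoc)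
    have eq2: "?g' \<circ> pinv ?t = h \<circ> ?g"
      using b by (simp add: pinv_comp bij_comp pinv_simps fun_eq_iff)
    have "\<phi> (h v) (h w) (act h p) = act ?g' (\<psi> (x v w) (y v w) (act (pinv ?t) ?q))"
      unfolding \<phi>_def same eq1 ..
    also have "\<dots> = act ?g' (act (pinv ?t) (\<psi> (x v w) (y v w) ?q))"
      by (simp only: \<psi>(3)[OF exy[OF e] ts q])
    also have "\<dots> = act h (\<phi> v w p)" by (simp only: act_act eq2 \<phi>_def)
    finally show ?thesis .
  qed
  define move where "move u v p = (if parity u then \<phi> u v p else inv_into (P v) (\<phi> v u) p)" for u v p
  have rev: "{v, u} \<in> E" if "{u, v} \<in> E" for u v using that by (simp add: insert_commute)
  have odd: "inv_into (P v) (\<phi> v u) p \<in> P v \<and> \<phi> v u (inv_into (P v) (\<phi> v u) p) = p"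
    if e: "{u, v} \<in> E" and p: "p \<in> P u" for u v p
    using bij_betw_inv_into_right[OF \<phi>_bij[OF rev[OF e]] p]
      bij_betwE[OF bij_betw_inv_into[OF \<phi>_bij[OF rev[OF e]]]] p by blast
  have move_in: "move u v p \<in> P v" if "{u, v} \<in> E" "p \<in> P u" for u v p
    using \<phi>_in[OF that] odd[OF that] by (simp add: move_def)
  have move_move: "move v u (move u v p) = p" if e: "{u, v} \<in> E" and p: "p \<in> P u" for u v p
    using parity[OF e] odd[OF e p] bij_betw_inv_into_left[OF \<phi>_bij[OF e] p] by (simp add: move_def)
  have move_lab: "lab v u (move u v p) = lab u v p" if e: "{u, v} \<in> E" and p: "p \<in> P u" for u v p
    using \<phi>_lab[OF e p] \<phi>_lab[OF rev[OF e], of "inv_into (P v) (\<phi> v u) p"] odd[OF e p]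
    by (simp add: move_def)
  have move_act: "move (h u) (h v) (act h p) = act h (move u v p)"
    if h: "h \<in> \<Gamma>0" and e: "{u, v} \<in> E" and p: "p \<in> P u" for h u v p
  proof (cases "parity u")
    case True
    then show ?thesis using \<phi>_act[OF h e p] parity\<Gamma>0[OF h] by (simp add: move_def)
  next
    case False
    let ?q = "inv_into (P v) (\<phi> v u) p"
    have q: "?q \<in> P v" "\<phi> v u ?q = p" using odd[OF e p] by auto
    have he: "{h v, h u} \<in> E" using edge\<Gamma>0[OF h] rev[OF e] by blast
    have "\<phi> (h v) (h u) (act h ?q) = act h p" using \<phi>_act[OF h rev[OF e] q(1)] q(2) by simp
    then have "inv_into (P (h v)) (\<phi> (h v) (h u)) (act h p) = act h ?q"
      using bij_betw_inv_into_left[OF \<phi>_bij[OF he] act_P[OF h q(1)]] by simp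
    then show ?thesis using False parity\<Gamma>0[OF h] by (simp add: move_def)
  qed
  \<comment> \<open>A section is determined by its value at \<open>v0\<close>, so that the stabiliser \<open>K\<close> of a single
    section has finite index.\<close>
  fix v0 :: 'a
  obtain g0 where "g0 \<in> T v0" using rep[of v0] by (auto simp: T_def)
  then have "(g0, 0, id) \<in> P v0" using n0 perm_subgroup(1)[OF F] by (simp add: P_def)
  then obtain s where s: "\<And>v. s v \<in> P v" "\<And>u v. {u, v} \<in> E \<Longrightarrow> s v = move u v (s u)"
    by (rule parallel_section[of P move "(g0, 0, id)" v0, rotated 2]) (use move_in move_move in blast)+
  define K where "K = {h \<in> \<Gamma>0. \<forall>v. s (h v) = act h (s v)}"
  have K: "perm_group K"
    unfolding perm_group_def
  proof (intro conjI ballI)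
    show "id \<in> K" using perm_groupD(1)[OF \<Gamma>0] by (simp add: K_def)
  next
    fix g assume g: "g \<in> K"
    then have g0: "g \<in> \<Gamma>0" by (simp add: K_def)
    show bg: "bij g" by (rule bij[OF g0])
    have "s (pinv g v) = act (pinv g) (s v)" for v
    proof -
      have "s (g (pinv g v)) = act g (s (pinv g v))" using g by (simp add: K_def)
      then have "s v = act g (s (pinv g v))" by (simp only: pinv_simps(2)[OF bg])
      then show ?thesis by (simp only: act_pinv(1)[OF bg])
    qed
    then show "pinv g \<in> K" using pinv\<Gamma>0[OF g0] by (simp add: K_def)
  next
    fix g h assume "g \<in> K" "h \<in> K"
    then show "g \<circ> h \<in> K" using comp\<Gamma>0[of g h] by (simp add: K_def act_act)
  qed
  have fK: "fin_index K \<Gamma>0"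
  proof (rule fin_indexI[OF K \<Gamma>0, where \<Phi> = "\<lambda>h. act (pinv h) (s (h v0))"])
    have "(\<lambda>h. act (pinv h) (s (h v0))) ` \<Gamma>0 \<subseteq> P v0" using act_P'[OF _ s(1)] by blast
    then show "finite ((\<lambda>h. act (pinv h) (s (h v0))) ` \<Gamma>0)" by (rule finite_subset) (rule finP)
    fix a b assume a: "a \<in> \<Gamma>0" and b: "b \<in> \<Gamma>0" and eq: "act (pinv a) (s (a v0)) = act (pinv b) (s (b v0))"
    have par: "act (pinv h) (s (h v)) = move u v (act (pinv h) (s (h u)))"
      if h: "h \<in> \<Gamma>0" and e: "{u, v} \<in> E" for h u v
    proof -
      have he: "{h u, h v} \<in> E" using edge\<Gamma>0[OF h] e by blast
      have "move (pinv h (h u)) (pinv h (h v)) (act (pinv h) (s (h u))) = act (pinv h) (move (h u) (h v) (s (h u)))"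
        by (rule move_act[OF pinv\<Gamma>0[OF h] he s(1)])
      then show ?thesis by (simp only: pinv_simps(1)[OF bij[OF h]] s(2)[OF he])
    qed
    have "(\<lambda>v. act (pinv a) (s (a v))) = (\<lambda>v. act (pinv b) (s (b v)))"
      by (rule parallel_section_unique[where \<phi> = move and ?v0.0 = v0, OF par[OF a] par[OF b] eq])
    then have eq': "act (pinv a) (s (a v)) = act (pinv b) (s (b v))" for v by (rule fun_cong)
    have "s ((a \<circ> pinv b) v) = act (a \<circ> pinv b) (s v)" for v
    proof -
      have "s (a (pinv b v)) = act a (act (pinv a) (s (a (pinv b v))))"
        by (simp only: act_pinv(2)[OF bij[OF a]])
      also have "\<dots> = act a (act (pinv b) (s v))" by (simp only: eq' pinv_simps(2)[OF bij[OF b]])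
      finally show ?thesis by (simp add: act_act)
    qed
    then show "a \<circ> pinv b \<in> K" using comp\<Gamma>0[OF a pinv\<Gamma>0[OF b]] by (simp only: K_def mem_Collect_eq simp_thms)
  qed
  define c' where "c' e = (SOME i. \<exists>v w. e = {v, w} \<and> i = lab v w (s v))" for e
  have c': "c' {v, w} = lab v w (s v)" if e: "{v, w} \<in> E" for v w
    unfolding c'_def
  proof (rule some_equality)
    fix i assume "\<exists>v' w'. {v, w} = {v', w'} \<and> i = lab v' w' (s v')"
    then obtain v' w' where vw: "{v, w} = {v', w'}" "i = lab v' w' (s v')" by blast
    have "lab w v (s w) = lab v w (s v)" using move_lab[OF e s(1)] s(2)[OF e] by simp
    then show "i = lab v w (s v)" using vw by (auto simp: doubleton_eq_iff)
  qed blast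
  have equiv: "colouring_equiv F c c'"
    unfolding colouring_equiv_def
  proof
    fix v
    obtain g i a where sv: "s v = (g, i, a)" by (metis prod_cases3)
    then have "g \<in> \<Gamma>0" "a \<in> F" using s(1)[of v] by (auto simp: P_def T_def)
    then obtain \<sigma> where \<sigma>: "\<sigma> \<in> F" "\<And>w. {v, w} \<in> E \<Longrightarrow> c {pinv g v, pinv g w} = \<sigma> (c {v, w})"
      using local by blast
    have "c' {v, w} = (a \<circ> \<sigma>) (c {v, w})" if "{v, w} \<in> E" for w
      using c'[OF that] \<sigma>(2)[OF that] by (simp add: sv lab_def)
    then show "\<exists>p\<in>F. \<forall>w. {v, w} \<in> E \<longrightarrow> c' {v, w} = p (c {v, w})"
      by (intro bexI[OF _ perm_subgroup(4)[OF F \<open>a \<in> F\<close> \<sigma>(1)]]) simp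
  qed
  interpret c': coloured_tree E d c' by unfold_locales (rule legal_if_equiv[OF F equiv])
  have "K \<subseteq> \<Gamma> \<inter> c'.colour_group"
  proof
    fix h assume h: "h \<in> K"
    then have h0: "h \<in> \<Gamma>0" by (simp add: K_def)
    have "c' {h u, h v} = c' {u, v}" if e: "{u, v} \<in> E" for u v
    proof -
      have "{h u, h v} \<in> E" using edge\<Gamma>0[OF h0] e by blast
      then have "c' {h u, h v} = lab (h u) (h v) (act h (s u))" using h c' by (simp add: K_def)
      then show ?thesis by (simp only: lab_act[OF h0 s(1)] c'[OF e])
    qed
    then show "h \<in> \<Gamma> \<inter> c'.colour_group"
      using h0 \<Gamma>0s aut\<Gamma> unfolding c'.colour_group_def by blast
  qed
  moreover have "fin_index K \<Gamma>" by (rule fin_index_trans[OF K \<Gamma>0 \<Gamma>(1) fK f\<Gamma>0])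
  ultimately have "fin_index (\<Gamma> \<inter> c'.colour_group) \<Gamma>"
    using fin_index_mono[OF K \<Gamma>(1) _ perm_group_Int[OF \<Gamma>(1) c'.perm_group_colour_group]] by blast
  then show thesis using that equiv by blast
qed

end

section \<open>Abstract groups of permutations\<close>

text \<open>This condition holds for \<open>U(F)\<close> and for all structures that arise from it by changing the
  carrier.  It serves to translate subgroups, cosets and conjugates in these structures into sets of
  permutations.\<close>

definition perm_structure :: "('a \<Rightarrow> 'a, 'b) monoid_scheme \<Rightarrow> bool" where
  "perm_structure M \<longleftrightarrow> perm_group (carrier M) \<and> \<one>\<^bsub>M\<^esub> = id \<and>
     (\<forall>g h. bij g \<longrightarrow> bij h \<longrightarrow> g \<otimes>\<^bsub>M\<^esub> h = g \<circ> h)"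

lemma perm_structure_update:
  "perm_structure M \<Longrightarrow> perm_group K \<Longrightarrow> perm_structure (M\<lparr>carrier := K\<rparr>)"
  by (simp add: perm_structure_def)

lemma perm_structureD:
  assumes "perm_structure M"
  shows "perm_group (carrier M)" "\<one>\<^bsub>M\<^esub> = id" "bij g \<Longrightarrow> bij h \<Longrightarrow> g \<otimes>\<^bsub>M\<^esub> h = g \<circ> h"
    "g \<in> carrier M \<Longrightarrow> bij g"
  using assms perm_groupD(2)[of "carrier M" g] by (auto simp: perm_structure_def)

lemma perm_structure_mult:
  assumes "perm_structure M" "g \<in> carrier M" "h \<in> carrier M"
  shows "g \<otimes>\<^bsub>M\<^esub> h = g \<circ> h"
  by (rule perm_structureD(3)[OF assms(1) perm_structureD(4)[OF assms(1,2)] perm_structureD(4)[OF assms(1,3)]])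

lemma perm_structure_group:
  assumes M: "perm_structure M" shows "group M"
proof (rule groupI)
  note PG = perm_structureD(1)[OF M]
  show "x \<otimes>\<^bsub>M\<^esub> y \<in> carrier M" if "x \<in> carrier M" "y \<in> carrier M" for x y
    unfolding perm_structure_mult[OF M that] by (rule perm_groupD(4)[OF PG that])
  show "\<one>\<^bsub>M\<^esub> \<in> carrier M" using perm_groupD(1)[OF PG] perm_structureD(2)[OF M] by simp
  fix x assume x: "x \<in> carrier M"
  have bx: "bij x" by (rule perm_structureD(4)[OF M x])
  show "\<one>\<^bsub>M\<^esub> \<otimes>\<^bsub>M\<^esub> x = x" using perm_structureD(3)[OF M bij_id bx] perm_structureD(2)[OF M] by simp
  show "\<exists>y\<in>carrier M. y \<otimes>\<^bsub>M\<^esub> x = \<one>\<^bsub>M\<^esub>"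
  proof (rule bexI)
    show "pinv x \<in> carrier M" by (rule perm_groupD(3)[OF PG x])
    then show "pinv x \<otimes>\<^bsub>M\<^esub> x = \<one>\<^bsub>M\<^esub>"
      using perm_structure_mult[OF M _ x] perm_structureD(2)[OF M] bx by (simp add: pinv_simps)
  qed
  fix y z assume yz: "y \<in> carrier M" "z \<in> carrier M"
  have b: "bij y" "bij z" using yz perm_structureD(4)[OF M] by blast+
  have "x \<otimes>\<^bsub>M\<^esub> y = x \<circ> y" "y \<otimes>\<^bsub>M\<^esub> z = y \<circ> z"
    by (rule perm_structureD(3)[OF M bx b(1)], rule perm_structureD(3)[OF M b])
  moreover have "(x \<circ> y) \<otimes>\<^bsub>M\<^esub> z = (x \<circ> y) \<circ> z" "x \<otimes>\<^bsub>M\<^esub> (y \<circ> z) = x \<circ> (y \<circ> z)"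
    by (rule perm_structureD(3)[OF M bij_comp[OF b(1) bx] b(2)], rule perm_structureD(3)[OF M bx bij_comp[OF b(2,1)]])
  ultimately show "x \<otimes>\<^bsub>M\<^esub> y \<otimes>\<^bsub>M\<^esub> z = x \<otimes>\<^bsub>M\<^esub> (y \<otimes>\<^bsub>M\<^esub> z)"
    by (simp only: comp_assoc)
qed

lemma perm_structure_inv:
  assumes M: "perm_structure M" and g: "g \<in> carrier M" shows "inv\<^bsub>M\<^esub> g = pinv g"
proof (rule group.inv_equality[OF perm_structure_group[OF M] _ g])
  show p: "pinv g \<in> carrier M" by (rule perm_groupD(3)[OF perm_structureD(1)[OF M] g])
  show "pinv g \<otimes>\<^bsub>M\<^esub> g = \<one>\<^bsub>M\<^esub>"
    using perm_structure_mult[OF M p g] perm_structureD(2)[OF M] perm_structureD(4)[OF M g]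
    by (simp add: pinv_simps)
qed

lemma perm_structure_subgroup:
  assumes M: "perm_structure M"
  shows "subgroup H M \<longleftrightarrow> H \<subseteq> carrier M \<and> perm_group H"
proof
  assume H: "subgroup H M"
  have s: "g \<in> carrier M" if "g \<in> H" for g using subgroup.subset[OF H] that by blast
  have "perm_group H"
    unfolding perm_group_def
  proof (intro conjI ballI)
    show "id \<in> H" using subgroup.one_closed[OF H] perm_structureD(2)[OF M] by simp
    show "bij g" if "g \<in> H" for g by (rule perm_structureD(4)[OF M s[OF that]])
    show "pinv g \<in> H" if "g \<in> H" for g
      using subgroup.m_inv_closed[OF H that] perm_structure_inv[OF M s[OF that]] by simp
    show "g \<circ> h \<in> H" if "g \<in> H" "h \<in> H" for g h
      using subgroup.m_closed[OF H that] perm_structure_mult[OF M s[OF that(1)] s[OF that(2)]] by simp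
  qed
  then show "H \<subseteq> carrier M \<and> perm_group H" using s by blast
next
  assume H: "H \<subseteq> carrier M \<and> perm_group H"
  then have s: "g \<in> carrier M" if "g \<in> H" for g using that by blast
  note PG = H[THEN conjunct2]
  show "subgroup H M"
  proof (rule subgroup.intro)
    show "H \<subseteq> carrier M" using H by blast
    show "x \<otimes>\<^bsub>M\<^esub> y \<in> H" if "x \<in> H" "y \<in> H" for x y
      unfolding perm_structure_mult[OF M s[OF that(1)] s[OF that(2)]] by (rule perm_groupD(4)[OF PG that])
    show "\<one>\<^bsub>M\<^esub> \<in> H" unfolding perm_structureD(2)[OF M] by (rule perm_groupD(1)[OF PG])
    show "inv\<^bsub>M\<^esub> x \<in> H" if "x \<in> H" for x
      unfolding perm_structure_inv[OF M s[OF that]] by (rule perm_groupD(3)[OF PG that])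
  qed
qed

lemma perm_structure_finite_index:
  assumes M: "perm_structure M" and K: "perm_group K"
  shows "finite_index M H K \<longleftrightarrow> H \<subseteq> K \<and> perm_group H \<and> fin_index H K"
proof -
  let ?M = "M\<lparr>carrier := K\<rparr>"
  have M': "perm_structure ?M" by (rule perm_structure_update[OF M K])
  have "rcosets\<^bsub>?M\<^esub> H = (\<lambda>a. (\<lambda>h. h \<circ> a) ` H) ` K" if "H \<subseteq> K"
  proof -
    have "H #>\<^bsub>?M\<^esub> a = (\<lambda>h. h \<circ> a) ` H" if a: "a \<in> K" for a
    proof -
      have "h \<otimes>\<^bsub>?M\<^esub> a = h \<circ> a" if "h \<in> H" for h
        by (rule perm_structure_mult[OF M']) (use that a \<open>H \<subseteq> K\<close> in auto)
      then show ?thesis unfolding r_coset_def by auto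
    qed
    then show ?thesis unfolding RCOSETS_def by auto
  qed
  then show ?thesis
    unfolding finite_index_def perm_structure_subgroup[OF M'] fin_index_def by auto
qed

lemma perm_structure_l_coset:
  assumes M: "perm_structure M" and g: "g \<in> carrier M" and H: "H \<subseteq> carrier M"
  shows "g <#\<^bsub>M\<^esub> H = (\<lambda>h. g \<circ> h) ` H"
proof -
  have "g \<otimes>\<^bsub>M\<^esub> h = g \<circ> h" if "h \<in> H" for h
    by (rule perm_structure_mult[OF M g]) (use that H in blast)
  then show ?thesis unfolding l_coset_def by auto
qed

lemma perm_structure_conj:
  assumes M: "perm_structure M" and g: "g \<in> carrier M" and H: "H \<subseteq> carrier M"
  shows "conj_subgroup M g H = conj_by g H"
proof -
  have "(g \<circ> h) \<otimes>\<^bsub>M\<^esub> pinv g = g \<circ> h \<circ> pinv g" if "h \<in> H" for h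
    using perm_structureD(4)[OF M g] perm_structureD(4)[OF M subsetD[OF H that]]
    by (intro perm_structureD(3)[OF M] bij_comp) (auto simp: pinv_simps)
  then show ?thesis
    unfolding conj_subgroup_def perm_structure_l_coset[OF assms] perm_structure_inv[OF M g]
      r_coset_def conj_by_def by auto
qed

definition commens :: "('a \<Rightarrow> 'a) set \<Rightarrow> ('a \<Rightarrow> 'a) set \<Rightarrow> bool" where
  "commens H K \<longleftrightarrow> fin_index (H \<inter> K) H \<and> fin_index (H \<inter> K) K"

lemma commens_sym: "commens H K \<Longrightarrow> commens K H"
  by (simp add: commens_def Int_commute)

lemma commens_refl:
  assumes "perm_group H" shows "commens H H"
proof -
  have "fin_index H H"
    by (rule fin_indexI_representatives[OF assms, of "{id}"]) auto
  then show ?thesis by (simp add: commens_def)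
qed

lemma commens_trans:
  assumes pg: "perm_group H" "perm_group K" "perm_group L" and "commens H K" "commens K L"
  shows "commens H L"
proof -
  have dev: "fin_index (A \<inter> C) A"
    if pg: "perm_group A" "perm_group B" "perm_group C" and AB: "commens A B" and BC: "commens B C" for A B C :: "('a \<Rightarrow> 'a) set"
  proof -
    have p: "perm_group (A \<inter> B)" "perm_group (B \<inter> C)" "perm_group (B \<inter> C \<inter> (A \<inter> B))" "perm_group (A \<inter> C)"
      using pg perm_group_Int by blast+
    have "fin_index (B \<inter> C \<inter> (A \<inter> B)) (A \<inter> B)"
      by (rule fin_index_restrict[OF p(2) pg(2) _ p(1)]) (use BC in \<open>auto simp: commens_def\<close>)
    then have "fin_index (B \<inter> C \<inter> (A \<inter> B)) A"
      by (rule fin_index_trans[OF p(3,1) pg(1)]) (use AB in \<open>simp add: commens_def\<close>)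
    then show ?thesis by (rule fin_index_mono[OF p(3) pg(1) _ p(4)]) blast
  qed
  show ?thesis
    unfolding commens_def using dev[OF pg assms(4,5)] dev[OF pg(3,2,1) commens_sym[OF assms(5)] commens_sym[OF assms(4)]]
    by (simp add: Int_commute)
qed

lemma commens_conj:
  assumes "bij g" "perm_group H" "perm_group K" "commens H K"
  shows "commens (conj_by g H) (conj_by g K)"
  using assms(4) fin_index_conj_by[OF assms(1) perm_group_Int[OF assms(2,3)] assms(2)]
    fin_index_conj_by[OF assms(1) perm_group_Int[OF assms(2,3)] assms(3)]
  by (simp add: commens_def conj_by_Int[OF assms(1)])

lemma perm_structure_commensurable:
  assumes "perm_structure M" "perm_group H" "perm_group K"
  shows "commensurable M H K \<longleftrightarrow> commens H K"
  using perm_structure_finite_index[OF assms(1,2)] perm_structure_finite_index[OF assms(1,3)]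
    perm_group_Int[OF assms(2,3)] by (simp add: commensurable_def commens_def)

lemma perm_structure_commensurator:
  assumes M: "perm_structure M" and \<Gamma>: "perm_group \<Gamma>" "\<Gamma> \<subseteq> carrier M"
  shows "commensurator M \<Gamma> = {g \<in> carrier M. commens \<Gamma> (conj_by g \<Gamma>)}"
proof -
  have "commensurable M \<Gamma> (conj_subgroup M g \<Gamma>) \<longleftrightarrow> commens \<Gamma> (conj_by g \<Gamma>)" if g: "g \<in> carrier M" for g
    unfolding perm_structure_conj[OF M g \<Gamma>(2)]
    by (rule perm_structure_commensurable[OF M \<Gamma>(1) perm_group_conj_by[OF perm_structureD(4)[OF M g] \<Gamma>(1)]])
  then show ?thesis unfolding commensurator_def by blast
qed

lemma perm_group_commensurator:
  assumes M: "perm_structure M" and \<Gamma>: "perm_group \<Gamma>" "\<Gamma> \<subseteq> carrier M"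
  shows "perm_group (commensurator M \<Gamma>)" "\<Gamma> \<subseteq> commensurator M \<Gamma>"
proof -
  note eq = perm_structure_commensurator[OF assms]
  note PG = perm_structureD(1)[OF M]
  have pc: "perm_group (conj_by g \<Gamma>)" if "bij g" for g by (rule perm_group_conj_by[OF that \<Gamma>(1)])
  show "perm_group (commensurator M \<Gamma>)"
    unfolding perm_group_def
  proof (intro conjI ballI)
    show "id \<in> commensurator M \<Gamma>" using perm_groupD(1)[OF PG] commens_refl[OF \<Gamma>(1)] by (simp add: eq)
  next
    fix g assume g: "g \<in> commensurator M \<Gamma>"
    then have gM: "g \<in> carrier M" by (simp add: eq)
    show b: "bij g" by (rule perm_structureD(4)[OF M gM])
    have "commens (conj_by (pinv g) \<Gamma>) (conj_by (pinv g) (conj_by g \<Gamma>))"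
      by (rule commens_conj[OF pinv_simps(6)[OF b] \<Gamma>(1) pc[OF b]]) (use g in \<open>simp add: eq\<close>)
    then have "commens (conj_by (pinv g) \<Gamma>) \<Gamma>"
      by (simp only: conj_by_conj_by[OF pinv_simps(6)[OF b] b] pinv_simps(3)[OF b] conj_by_id)
    then have "commens \<Gamma> (conj_by (pinv g) \<Gamma>)" by (rule commens_sym)
    then show "pinv g \<in> commensurator M \<Gamma>" using perm_groupD(3)[OF PG gM] by (simp add: eq)
  next
    fix g h assume g: "g \<in> commensurator M \<Gamma>" and h: "h \<in> commensurator M \<Gamma>"
    have M': "g \<in> carrier M" "h \<in> carrier M" using g h by (simp_all add: eq)
    have b: "bij g" "bij h" by (rule perm_structureD(4)[OF M M'(1)], rule perm_structureD(4)[OF M M'(2)])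
    have "commens (conj_by g \<Gamma>) (conj_by g (conj_by h \<Gamma>))"
      by (rule commens_conj[OF b(1) \<Gamma>(1) pc[OF b(2)]]) (use h in \<open>simp add: eq\<close>)
    then have "commens (conj_by g \<Gamma>) (conj_by (g \<circ> h) \<Gamma>)" by (simp only: conj_by_conj_by[OF b])
    then have "commens \<Gamma> (conj_by (g \<circ> h) \<Gamma>)"
      by (rule commens_trans[OF \<Gamma>(1) pc[OF b(1)] pc[OF bij_comp[OF b(2,1)]], rotated]) (use g in \<open>simp add: eq\<close>)
    then show "g \<circ> h \<in> commensurator M \<Gamma>" using perm_groupD(4)[OF PG M'] by (simp add: eq)
  qed
  show "\<Gamma> \<subseteq> commensurator M \<Gamma>"
    using commens_refl[OF \<Gamma>(1)] conj_by_mem[OF \<Gamma>(1)] \<Gamma>(2) by (auto simp: eq)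
qed

text \<open>It suffices to find congruence subgroups of the form \<open>core \<Gamma> M\<close>, where \<open>M\<close> is the
  intersection of \<open>\<Gamma>\<close> with finitely many of its conjugates, since a core is again a finite
  intersection of conjugates.\<close>

lemma has_CSP_if_cores:
  assumes M: "perm_structure M" and \<Gamma>: "perm_group \<Gamma>" "\<Gamma> \<subseteq> carrier M"
    and cores: "\<And>H. perm_group H \<Longrightarrow> H \<subseteq> \<Gamma> \<Longrightarrow> fin_index H \<Gamma> \<Longrightarrow>
      \<exists>S. finite S \<and> S \<subseteq> commensurator M \<Gamma> \<and> core \<Gamma> (\<Gamma> \<inter> (\<Inter>g\<in>S. conj_by g \<Gamma>)) \<subseteq> H"
  shows "has_CSP (M\<lparr>carrier := commensurator M \<Gamma>\<rparr>) \<Gamma>"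
proof -
  let ?C = "commensurator M \<Gamma>"
  let ?M = "M\<lparr>carrier := ?C\<rparr>"
  note C = perm_group_commensurator[OF M \<Gamma>]
  have M': "perm_structure ?M" by (rule perm_structure_update[OF M C(1)])
  have M'': "perm_structure (?M\<lparr>carrier := \<Gamma>\<rparr>)" by (rule perm_structure_update[OF M' \<Gamma>(1)])
  have \<Gamma>C: "\<Gamma> \<subseteq> carrier ?M" using C(2) by simp
  have "subgroup \<Gamma> ?M" using C \<Gamma>(1) by (simp add: perm_structure_subgroup[OF M'])
  moreover have "commensurator ?M \<Gamma> = carrier ?M"
    unfolding perm_structure_commensurator[OF M' \<Gamma>(1) \<Gamma>C]
    by (auto simp: perm_structure_commensurator[OF M \<Gamma>])
  moreover have "\<exists>N\<in>congruence_subgroups ?M \<Gamma>. N \<subseteq> H" if H: "finite_index ?M H \<Gamma>" for H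
  proof -
    have H': "perm_group H" "H \<subseteq> \<Gamma>" "fin_index H \<Gamma>"
      using H unfolding perm_structure_finite_index[OF M' \<Gamma>(1)] by auto
    obtain S where S: "finite S" "S \<subseteq> ?C" "core \<Gamma> (\<Gamma> \<inter> (\<Inter>g\<in>S. conj_by g \<Gamma>)) \<subseteq> H"
      using cores[OF H'] by blast
    have bijS: "bij g" if "g \<in> S" for g by (rule perm_groupD(2)[OF C(1) subsetD[OF S(2) that]])
    define L where "L = \<Gamma> \<inter> (\<Inter>g\<in>S. conj_by g \<Gamma>)"
    have pL: "perm_group L" unfolding L_def by (rule perm_group_INT_conj_by[OF \<Gamma>(1) bijS])
    have "fin_index L \<Gamma> \<and> perm_group L"
      unfolding L_def using S(1,2) bijS
    proof (induction S rule: finite_induct)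
      case empty
      then show ?case using commens_refl[OF \<Gamma>(1)] \<Gamma>(1) by (simp add: commens_def)
    next
      case (insert g S)
      let ?L = "\<Gamma> \<inter> (\<Inter>g\<in>S. conj_by g \<Gamma>)"
      have IH: "fin_index ?L \<Gamma>" "perm_group ?L" using insert by auto
      have pg: "perm_group (\<Gamma> \<inter> conj_by g \<Gamma>)"
        by (rule perm_group_Int[OF \<Gamma>(1) perm_group_conj_by[OF _ \<Gamma>(1)]]) (use insert.prems in simp)
      have "fin_index (\<Gamma> \<inter> conj_by g \<Gamma>) \<Gamma>"
        using insert.prems(1) by (simp add: perm_structure_commensurator[OF M \<Gamma>] commens_def)
      then have "fin_index ((\<Gamma> \<inter> conj_by g \<Gamma>) \<inter> ?L) \<Gamma>" "perm_group ((\<Gamma> \<inter> conj_by g \<Gamma>) \<inter> ?L)"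
        using fin_index_Int[OF pg IH(2) \<Gamma>(1) _ IH(1)] perm_group_Int[OF pg IH(2)] by blast+
      moreover have "(\<Gamma> \<inter> conj_by g \<Gamma>) \<inter> ?L = \<Gamma> \<inter> (\<Inter>g\<in>insert g S. conj_by g \<Gamma>)" by auto
      ultimately show ?case by simp
    qed
    then have fL: "fin_index L \<Gamma>" by blast
    have Ls: "L \<subseteq> \<Gamma>" by (auto simp: L_def)
    let ?N = "core \<Gamma> L"
    have pN: "perm_group ?N" by (rule perm_group_core[OF \<Gamma>(1) pL])
    have N\<Gamma>: "?N \<subseteq> \<Gamma>" using core_subset[OF \<Gamma>(1)] by blast
    obtain R where R: "finite R" "R \<noteq> {}" "R \<subseteq> \<Gamma>" "?N = (\<Inter>r\<in>R. conj_by r L)"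
      by (rule core_finite_intersection[OF \<Gamma>(1) pL Ls fL])
    have bijR: "bij r" if "r \<in> R" for r by (rule perm_groupD(2)[OF \<Gamma>(1) subsetD[OF R(3) that]])
    define S' where "S' = (\<lambda>(r, g). r \<circ> g) ` (R \<times> insert id S)"
    have "?N \<lhd> ?M\<lparr>carrier := \<Gamma>\<rparr>"
      unfolding group.normal_inv_iff[OF perm_structure_group[OF M'']] perm_structure_subgroup[OF M'']
    proof (intro conjI ballI)
      show "?N \<subseteq> carrier (?M\<lparr>carrier := \<Gamma>\<rparr>)" using N\<Gamma> by simp
      show "perm_group ?N" by (rule pN)
      fix x h assume "x \<in> carrier (?M\<lparr>carrier := \<Gamma>\<rparr>)" and h: "h \<in> ?N"
      then have x: "x \<in> \<Gamma>" by simp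
      have "x \<otimes>\<^bsub>?M\<lparr>carrier := \<Gamma>\<rparr>\<^esub> h \<otimes>\<^bsub>?M\<lparr>carrier := \<Gamma>\<rparr>\<^esub> inv\<^bsub>?M\<lparr>carrier := \<Gamma>\<rparr>\<^esub> x = x \<circ> h \<circ> pinv x"
      proof -
        have b: "bij x" "bij h" by (rule perm_groupD(2)[OF \<Gamma>(1) x], rule perm_groupD(2)[OF pN h])
        have i: "inv\<^bsub>?M\<lparr>carrier := \<Gamma>\<rparr>\<^esub> x = pinv x" by (rule perm_structure_inv[OF M'']) (simp add: x)
        show ?thesis
          unfolding i perm_structureD(3)[OF M'' b] by (rule perm_structureD(3)[OF M'' bij_comp[OF b(2,1)] pinv_simps(6)[OF b(1)]])
      qed
      then show "x \<otimes>\<^bsub>?M\<lparr>carrier := \<Gamma>\<rparr>\<^esub> h \<otimes>\<^bsub>?M\<lparr>carrier := \<Gamma>\<rparr>\<^esub> inv\<^bsub>?M\<lparr>carrier := \<Gamma>\<rparr>\<^esub> x \<in> ?N"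
        using core_normal[OF \<Gamma>(1) h x] by simp
    qed
    moreover have "finite_index ?M ?N \<Gamma>"
      unfolding perm_structure_finite_index[OF M' \<Gamma>(1)]
      using N\<Gamma> pN fin_index_core[OF \<Gamma>(1) pL Ls fL] by blast
    moreover have "finite S'" "S' \<noteq> {}" using R(1,2) S(1) by (auto simp: S'_def)
    moreover have S'C: "S' \<subseteq> carrier ?M"
    proof -
      have "r \<circ> g \<in> ?C" if "r \<in> R" "g \<in> insert id S" for r g
        by (rule perm_groupD(4)[OF C(1)]) (use that R(3) C(2) S(2) perm_groupD(1)[OF C(1)] in auto)
      then show ?thesis by (auto simp: S'_def)
    qed
    moreover have "?N = (\<Inter>g\<in>S'. conj_subgroup ?M g \<Gamma>)"
    proof -
      have "(\<Inter>g\<in>S'. conj_subgroup ?M g \<Gamma>) = (\<Inter>g\<in>S'. conj_by g \<Gamma>)"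
        by (rule INF_cong[OF refl]) (rule perm_structure_conj[OF M' subsetD[OF S'C] \<Gamma>C])
      also have "\<dots> = (\<Inter>r\<in>R. \<Inter>g\<in>insert id S. conj_by (r \<circ> g) \<Gamma>)" by (auto simp: S'_def)
      also have "\<dots> = (\<Inter>r\<in>R. conj_by r L)"
      proof (rule INF_cong[OF refl])
        fix r assume r: "r \<in> R"
        have "conj_by (r \<circ> g) \<Gamma> = conj_by r (conj_by g \<Gamma>)" if "g \<in> insert id S" for g
          by (rule conj_by_conj_by[OF bijR[OF r], symmetric]) (use bijS that in auto)
        then have "(\<Inter>g\<in>insert id S. conj_by (r \<circ> g) \<Gamma>) = (\<Inter>g\<in>insert id S. conj_by r (conj_by g \<Gamma>))"
          by (rule INF_cong[OF refl])
        also have "\<dots> = conj_by r L" by (simp add: L_def set_eq_iff mem_conj_by[OF bijR[OF r]])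
        finally show "(\<Inter>g\<in>insert id S. conj_by (r \<circ> g) \<Gamma>) = conj_by r L" .
      qed
      finally show ?thesis using R(4) by simp
    qed
    ultimately have "?N \<in> congruence_subgroups ?M \<Gamma>" unfolding congruence_subgroups_def by blast
    then show ?thesis using S(3) by (auto simp: L_def)
  qed
  ultimately show ?thesis unfolding has_CSP_def by blast
qed

section \<open>Cocompact lattices\<close>

text \<open>Compact sets of vertices are finite, so that a basic open set only restricts finitely many values.\<close>

lemma (in tree) tree_aut_topology_nhd:
  assumes "openin (tree_aut_topology E) W" "f \<in> W"
  shows "\<exists>B. finite B \<and> (\<forall>g. aut g \<longrightarrow> (\<forall>b\<in>B. g b = f b) \<longrightarrow> g \<in> W)"
proof -
  let ?S = "{{f \<in> carrier (tree_aut E). f ` K \<subseteq> U} |K U.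
    compactin (discrete_topology UNIV) K \<and> openin (discrete_topology UNIV) U}"
  have "generate_topology_on ?S W"
    using assms(1) unfolding tree_aut_topology_def compact_open_topology_def openin_topology_generated_by_iff .
  then show ?thesis using assms(2)
  proof (induction arbitrary: f rule: generate_topology_on.induct)
    case Empty
    then show ?case by simp
  next
    case (Int a b)
    have "f \<in> a" "f \<in> b" using Int.prems by auto
    from Int.IH(1)[OF this(1)] Int.IH(2)[OF this(2)]
    obtain A B where AB: "finite A \<and> (\<forall>g. aut g \<longrightarrow> (\<forall>b\<in>A. g b = f b) \<longrightarrow> g \<in> a)"
      "finite B \<and> (\<forall>g. aut g \<longrightarrow> (\<forall>b\<in>B. g b = f b) \<longrightarrow> g \<in> b)"
      by (elim exE)
    have "g \<in> a \<inter> b" if "aut g" "\<forall>b\<in>A \<union> B. g b = f b" for g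
      using AB[THEN conjunct2, THEN spec, of g] that by simp
    moreover have "finite (A \<union> B)" using AB by simp
    ultimately show ?case by blast
  next
    case (UN K)
    then obtain k where k: "k \<in> K" "f \<in> k" by blast
    from UN.IH[OF k]
    obtain B where B: "finite B \<and> (\<forall>g. aut g \<longrightarrow> (\<forall>b\<in>B. g b = f b) \<longrightarrow> g \<in> k)"
      by (elim exE)
    then have "\<forall>g. aut g \<longrightarrow> (\<forall>b\<in>B. g b = f b) \<longrightarrow> g \<in> \<Union>K" using k(1) by simp blast
    then show ?case using B by (intro exI[of _ B] conjI) simp_all
  next
    case (Basis s)
    then obtain K U where s: "s = {f \<in> carrier (tree_aut E). f ` K \<subseteq> U}" "compactin (discrete_topology UNIV) K"
      by blast
    have "finite K" using s(2) by (simp add: compactin_discrete_topology)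
    moreover have "g \<in> s" if "aut g" "\<forall>b\<in>K. g b = f b" for g
      using that Basis.prems by (auto simp: s(1) image_subset_iff)
    ultimately show ?case by (intro exI[of _ K] conjI allI impI) simp_all
  qed
qed

context coloured_tree
begin

lemma perm_structure_universal_group:
  assumes F: "subgroup F (sym_group d)"
  shows "perm_structure (universal_group d E c F)"
  unfolding perm_structure_def
proof (intro conjI allI impI)
  show "perm_group (univ_group F)" by (rule perm_group_univ_group[OF F])
  show "\<one>\<^bsub>universal_group d E c F\<^esub> = id"
    by (simp add: universal_group_def tree_aut_def BijGroup_def fun_eq_iff)
  show "g \<otimes>\<^bsub>universal_group d E c F\<^esub> h = g \<circ> h" if "bij g" "bij h" for g h
    using tree_aut_mult[of g h] that by (simp add: universal_group_def tree_aut_def Bij_def)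
qed

text \<open>In a discrete group \<open>\<Gamma>\<close> only the identity fixes a certain finite set \<open>B\<close> of vertices pointwise.  The
  tree is locally finite, so that the elements that fix \<open>v\<close> map each vertex of \<open>B\<close> to one of finitely
  many vertices.\<close>

lemma finite_stabiliser_if_discrete:
  assumes F: "subgroup F (sym_group d)" and \<Gamma>: "perm_group \<Gamma>" "\<Gamma> \<subseteq> univ_group F"
    and disc: "subtopology (universal_group_topology d E c F) \<Gamma> = discrete_topology \<Gamma>"
  shows "finite {g \<in> \<Gamma>. g v = v}"
proof -
  let ?S = "{g \<in> \<Gamma>. g v = v}"
  have aut\<Gamma>: "aut g" if "g \<in> \<Gamma>" for g using subsetD[OF \<Gamma>(2) that] by (simp add: univ_group_iff[OF F])
  have "openin (subtopology (universal_group_topology d E c F) \<Gamma>) {id}"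
    unfolding disc using perm_groupD(1)[OF \<Gamma>(1)] by simp
  then obtain W where W: "openin (tree_aut_topology E) W" "{id} = W \<inter> univ_group F \<inter> \<Gamma>"
    unfolding universal_group_topology_def openin_subtopology by blast
  obtain B where B: "finite B" "\<And>g. aut g \<Longrightarrow> (\<forall>b\<in>B. g b = id b) \<Longrightarrow> g \<in> W"
    using tree_aut_topology_nhd[OF W(1), of id] W(2) by blast
  have trivial: "g = id" if "g \<in> \<Gamma>" "\<forall>b\<in>B. g b = b" for g
    using B(2)[OF aut\<Gamma>[OF that(1)]] W(2) that \<Gamma>(2) by auto
  have orbits: "finite ((\<lambda>g. g b) ` ?S)" for b
  proof (induction b rule: tree_induct[where r = v])
    case base
    have "(\<lambda>g. g v) ` ?S \<subseteq> {v}" by auto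
    then show ?case by (rule finite_subset) simp
  next
    case (step u w)
    have "(\<lambda>g. g w) ` ?S \<subseteq> (\<Union>x\<in>(\<lambda>g. g u) ` ?S. nb x ` {1..d})"
    proof (rule image_subsetI)
      fix g assume g: "g \<in> ?S"
      have "{g u, g w} \<in> E" using aut\<Gamma>[of g] g step(1) by (simp add: aut_iff)
      then have "g w = nb (g u) (c {g u, g w})" "c {g u, g w} \<in> {1..d}"
        using nb_eqI colour_range by auto
      then show "g w \<in> (\<Union>x\<in>(\<lambda>g. g u) ` ?S. nb x ` {1..d})" using g by blast
    qed
    then show ?case
      by (rule finite_subset) (intro finite_UN_I step(2) finite_imageI finite_atLeastAtMost)
  qed
  have "(\<lambda>g. restrict g B) ` ?S \<subseteq> (\<Pi>\<^sub>E b\<in>B. (\<lambda>g. g b) ` ?S)" by auto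
  then have "finite ((\<lambda>g. restrict g B) ` ?S)"
    by (rule finite_subset) (simp add: finite_PiE B(1) orbits)
  moreover have "inj_on (\<lambda>g. restrict g B) ?S"
  proof (rule inj_onI)
    fix g h assume gh: "g \<in> ?S" "h \<in> ?S" and eq: "restrict g B = restrict h B"
    have gb: "g b = h b" if "b \<in> B" for b using fun_cong[OF eq, of b] that by simp
    have bh: "bij h" using perm_groupD(2)[OF \<Gamma>(1), of h] gh by simp
    have "pinv h \<circ> g = id"
    proof (rule trivial)
      show "pinv h \<circ> g \<in> \<Gamma>" using gh perm_groupD(3,4)[OF \<Gamma>(1)] by simp
      show "\<forall>b\<in>B. (pinv h \<circ> g) b = b" using gb bh by (simp add: pinv_simps)
    qed
    then have "h \<circ> (pinv h \<circ> g) = h" by simp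
    then show "g = h" using bh by (simp add: fun_eq_iff pinv_simps)
  qed
  ultimately show ?thesis by (rule finite_imageD)
qed

text \<open>The cosets \<open>g \<Gamma>\<close> for which \<open>g\<close> maps some element of a given \<open>\<Gamma>\<close>-orbit of vertices
  to a fixed vertex form an open set, and the orbits correspond to a covering by such sets.\<close>

lemma fin_orbits_if_cocompact:
  assumes F: "subgroup F (sym_group d)" and \<Gamma>: "perm_group \<Gamma>" "\<Gamma> \<subseteq> univ_group F"
    and compact: "compact_space (quotient_topology (universal_group_topology d E c F)
      (\<lambda>g. g <#\<^bsub>universal_group d E c F\<^esub> \<Gamma>))"
  shows "fin_orbits \<Gamma>"
proof -
  let ?U = "univ_group F" and ?T = "universal_group_topology d E c F"
  let ?q = "\<lambda>g. g <#\<^bsub>universal_group d E c F\<^esub> \<Gamma>"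
  let ?Q = "quotient_topology ?T ?q"
  fix v0 :: 'a
  note PU = perm_group_univ_group[OF F]
  have q: "?q g = (\<lambda>h. g \<circ> h) ` \<Gamma>" if "g \<in> ?U" for g
    by (rule perm_structure_l_coset[OF perm_structure_universal_group[OF F] that \<Gamma>(2)])
  have topT: "topspace ?T = ?U" by (rule topspace_universal_group_topology)
  have topQ: "topspace ?Q = ?q ` ?U"
    using quotient_map_quotient_topology[of ?T ?q] unfolding quotient_map_def topT by blast
  define O' where "O' w = {x \<in> ?U. \<exists>\<gamma>\<in>\<Gamma>. x (\<gamma> w) = v0}" for w
  have openO: "openin ?T (O' w)" for w
  proof -
    have "openin ?T (?U \<inter> {f \<in> carrier (tree_aut E). f ` {\<gamma> w} \<subseteq> {v0}})" for \<gamma>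
      unfolding universal_group_topology_def tree_aut_topology_def compact_open_topology_def
      by (intro openin_subtopology_Int2 topology_generated_by_Basis CollectI,
          rule exI[of _ "{\<gamma> w}"], rule exI[of _ "{v0}"]) simp
    then have "openin ?T (\<Union>\<gamma>\<in>\<Gamma>. ?U \<inter> {f \<in> carrier (tree_aut E). f ` {\<gamma> w} \<subseteq> {v0}})" by blast
    moreover have "(\<Union>\<gamma>\<in>\<Gamma>. ?U \<inter> {f \<in> carrier (tree_aut E). f ` {\<gamma> w} \<subseteq> {v0}}) = O' w"
      unfolding O'_def by (auto simp: univ_group_iff[OF F])
    ultimately show ?thesis by simp
  qed
  have sat: "x \<in> O' w" if x: "x \<in> ?U" and qx: "?q x \<in> ?q ` O' w" for x w
  proof -
    obtain y where y: "y \<in> O' w" "?q x = ?q y" using qx by blast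
    then have yU: "y \<in> ?U" by (simp add: O'_def)
    obtain \<gamma> where \<gamma>: "\<gamma> \<in> \<Gamma>" "y (\<gamma> w) = v0" using y(1) by (auto simp: O'_def)
    have "x \<circ> id \<in> ?q x" unfolding q[OF x] using perm_groupD(1)[OF \<Gamma>(1)] by (rule imageI)
    then obtain \<delta> where \<delta>: "\<delta> \<in> \<Gamma>" "x = y \<circ> \<delta>" unfolding y(2) q[OF yU] by auto
    have "x ((pinv \<delta> \<circ> \<gamma>) w) = v0"
      using \<gamma>(2) pinv_simps(2)[OF perm_groupD(2)[OF \<Gamma>(1) \<delta>(1)]] by (simp add: \<delta>(2))
    then show ?thesis
      unfolding O'_def using x perm_groupD(4)[OF \<Gamma>(1) perm_groupD(3)[OF \<Gamma>(1) \<delta>(1)] \<gamma>(1)] by blast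
  qed
  have openQ: "openin ?Q (?q ` O' w)" for w
  proof -
    have "{x \<in> ?U. ?q x \<in> ?q ` O' w} = O' w"
    proof
      show "{x \<in> ?U. ?q x \<in> ?q ` O' w} \<subseteq> O' w" using sat by blast
      have "O' w \<subseteq> ?U" by (auto simp: O'_def)
      then show "O' w \<subseteq> {x \<in> ?U. ?q x \<in> ?q ` O' w}" by blast
    qed
    moreover have "?q ` O' w \<subseteq> ?q ` ?U" by (auto simp: O'_def)
    ultimately show ?thesis using openO by (simp add: openin_quotient_topology topT)
  qed
  have cover: "topspace ?Q \<subseteq> \<Union>(range (\<lambda>w. ?q ` O' w))"
  proof -
    have "x \<in> O' (pinv x v0)" if "x \<in> ?U" for x
      using that perm_groupD(1)[OF \<Gamma>(1)] pinv_simps(2)[OF perm_groupD(2)[OF PU that]]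
      by (auto simp: O'_def intro!: bexI[of _ id])
    then show ?thesis unfolding topQ by blast
  qed
  have "\<exists>\<F>. finite \<F> \<and> \<F> \<subseteq> range (\<lambda>w. ?q ` O' w) \<and> topspace ?Q \<subseteq> \<Union>\<F>"
    by (rule compactinD[OF compact[unfolded compact_space_def] _ cover]) (use openQ in blast)
  then obtain \<F> where \<F>: "finite \<F>" "\<F> \<subseteq> range (\<lambda>w. ?q ` O' w)" "topspace ?Q \<subseteq> \<Union>\<F>"
    by (elim exE conjE)
  obtain R where R: "finite R" "\<F> = (\<lambda>w. ?q ` O' w) ` R"
    using finite_subset_image[OF \<F>(1,2)] by blast
  show ?thesis
    unfolding fin_orbits_def
  proof (intro exI[of _ R] conjI allI R(1))
    fix v
    obtain g where g: "g \<in> colour_group" "g v = v0" by (rule colour_group_transitive)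
    have gU: "g \<in> ?U" using g(1) colour_group_subset_univ_group[OF F] by blast
    then have "?q g \<in> \<Union>\<F>" using \<F>(3) topQ by blast
    then obtain w where w: "w \<in> R" "?q g \<in> ?q ` O' w" unfolding R(2) by blast
    obtain \<gamma> where \<gamma>: "\<gamma> \<in> \<Gamma>" "g (\<gamma> w) = v0" using sat[OF gU w(2)] by (auto simp: O'_def)
    have "\<gamma> w = v"
      using \<gamma>(2) g(2) bij_is_inj[OF perm_groupD(2)[OF PU gU]] by (metis injD)
    then show "\<exists>h\<in>\<Gamma>. \<exists>r\<in>R. v = h r" using \<gamma>(1) w(1) by blast
  qed
qed

end

theorem theorem6p11:
  fixes d :: nat and E :: "'v set set" and c :: "'v set \<Rightarrow> nat"
    and F :: "(nat \<Rightarrow> nat) set" and \<Gamma> :: "('v \<Rightarrow> 'v) set"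
  defines "G \<equiv> universal_group d E c F"
  assumes "d \<ge> 3"
    and "regular_tree d E"
    and "legal_coloring d E c"
    and "subgroup F (sym_group d)"
    and "\<not> acts_freely F {1..d}"
    and "cocompact_lattice G (universal_group_topology d E c F) \<Gamma>"
  shows "has_CSP (G\<lparr>carrier := commensurator G \<Gamma>\<rparr>) \<Gamma>"
proof -
  interpret coloured_tree E d c
    using assms(3,4) by unfold_locales (auto simp: regular_tree_def)
  note F = assms(5)
  have G: "perm_structure G" unfolding G_def by (rule perm_structure_universal_group[OF F])
  have lat: "subgroup \<Gamma> G" "subtopology (universal_group_topology d E c F) \<Gamma> = discrete_topology \<Gamma>"
    "compact_space (quotient_topology (universal_group_topology d E c F) (\<lambda>g. g <#\<^bsub>G\<^esub> \<Gamma>))"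
    using assms(7) by (auto simp: cocompact_lattice_def)
  have \<Gamma>: "perm_group \<Gamma>" "\<Gamma> \<subseteq> univ_group F"
    using lat(1) unfolding perm_structure_subgroup[OF G] by (auto simp: G_def)
  have stab: "finite {g \<in> \<Gamma>. g v = v}" for v
    by (rule finite_stabiliser_if_discrete[OF F \<Gamma> lat(2)])
  have orb: "fin_orbits \<Gamma>"
    by (rule fin_orbits_if_cocompact[OF F \<Gamma> lat(3)[unfolded G_def]])
  \<comment> \<open>From here on, the colouring is the one that is adapted to the lattice.\<close>
  obtain c' where c': "colouring_equiv F c c'" "fin_index (\<Gamma> \<inter> coloured_tree.colour_group E c') \<Gamma>"
    by (rule invariant_colouring[OF F \<Gamma> orb stab])
  interpret c': coloured_tree E d c' by unfold_locales (rule legal_if_equiv[OF F c'(1)])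
  have U: "univ_group F = c'.univ_group F"
    using univ_group_equiv[OF F c'(1)] c'.univ_group_equiv[OF F colouring_equiv_sym[OF F c'(1)]] by blast
  have \<Gamma>G: "\<Gamma> \<subseteq> carrier G" using \<Gamma>(2) by (simp add: G_def)
  have carG: "carrier G = c'.univ_group F" unfolding G_def by (rule U)
  show ?thesis
  proof (rule has_CSP_if_cores[OF G \<Gamma>(1) \<Gamma>G])
    fix H assume H: "perm_group H" "H \<subseteq> \<Gamma>" "fin_index H \<Gamma>"
    obtain S where S: "finite S" "S \<subseteq> c'.univ_group F"
      "\<And>g. g \<in> S \<Longrightarrow> fin_orbits (\<Gamma> \<inter> conj_by g \<Gamma>)"
      "core \<Gamma> (\<Gamma> \<inter> (\<Inter>g\<in>S. conj_by g \<Gamma>)) \<subseteq> H"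
      by (rule c'.congruence_subgroup_in[OF assms(2) F assms(6) \<Gamma>(1) \<Gamma>(2)[unfolded U] orb c'(2) H]) (rule that)
    have "g \<in> commensurator G \<Gamma>" if g: "g \<in> S" for g
    proof -
      have gG: "g \<in> carrier G" using S(2) g by (auto simp: carG)
      have b: "bij g" by (rule perm_structureD(4)[OF G gG])
      have pc: "perm_group (conj_by g \<Gamma>)" by (rule perm_group_conj_by[OF b \<Gamma>(1)])
      have pI: "perm_group (\<Gamma> \<inter> conj_by g \<Gamma>)" by (rule perm_group_Int[OF \<Gamma>(1) pc])
      have "fin_index (\<Gamma> \<inter> conj_by g \<Gamma>) \<Gamma>"
        by (rule fin_index_if_fin_orbits[OF pI \<Gamma>(1) _ S(3)[OF g] stab]) blast
      moreover have "fin_index (\<Gamma> \<inter> conj_by g \<Gamma>) (conj_by g \<Gamma>)"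
      proof (rule fin_index_if_fin_orbits[OF pI pc _ S(3)[OF g], of "g undefined"])
        have "{k \<in> conj_by g \<Gamma>. k (g undefined) = g undefined} \<subseteq> conj_by g {h \<in> \<Gamma>. h undefined = undefined}"
        proof
          fix k assume k: "k \<in> {k \<in> conj_by g \<Gamma>. k (g undefined) = g undefined}"
          then show "k \<in> conj_by g {h \<in> \<Gamma>. h undefined = undefined}"
            using pinv_simps(1)[OF b] by (simp add: mem_conj_by[OF b])
        qed
        then show "finite {k \<in> conj_by g \<Gamma>. k (g undefined) = g undefined}"
          by (rule finite_subset) (simp add: conj_by_def stab)
      qed blast
      ultimately show ?thesis
        using gG by (simp add: perm_structure_commensurator[OF G \<Gamma>(1) \<Gamma>G] commens_def)
    qed
    then show "\<exists>S. finite S \<and> S \<subseteq> commensurator G \<Gamma> \<and> core \<Gamma> (\<Gamma> \<inter> (\<Inter>g\<in>S. conj_by g \<Gamma>)) \<subseteq> H"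
      using S(1,4) by blast
  qed
qed

end
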